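(* Fix $N\in\mathbb{N}$, $m\in\mathbb{N}$ and let $\{(\alpha^{(k)},t^{(k)})\}_{k=1}^m\subset\mathbb{N}_0\times(0,\infty)$ be a space-like path. Let $\vec X^{(k)}=\{X^N_j(\alpha^{(k)},t^{(k)})\}_{j=1}^N$. Then $\vec X^{(k)}$, $k=1,\dots,m$, is a Markov process in $k$.
   Context: $\mathbb{N}=\{1,2,\dots\}$, $\mathbb{N}_0=\mathbb{N}\cup\{0\}$. Let $B_{ij}(t)$, $i,j\in\mathbb{N}$, $t\ge 0$, be i.i.d. complex Brownian motions, $B_{ij}=\frac{1}{\sqrt2}b_{ij}+\frac{\mathrm i}{\sqrt2}\tilde b_{ij}$ with $b_{ij},\tilde b_{ij}$ independent standard real Brownian motions started at $0$. For $\alpha\in\mathbb{N}_0$, $t\ge 0$ let $A^N(\alpha,t)=(B_{ij}(t))_{1\le i\le N+\alpha,\,1\le j\le N}$ and let $0\le X_1^N(\alpha,t)\le\dots\le X_N^N(\alpha,t)$ be the ordered eigenvalues of $A^N(\alpha,t)^*A^N(\alpha,t)$ (all defined from the same family $B_{ij}$). A sequence $\{(\alpha^{(k)},t^{(k)})\}_{k=1}^m$ is a space-like path if for each $k<m$: $\alpha^{(k)}\ge\alpha^{(k+1)}$, $t^{(k)}\le t^{(k+1)}$ and $(\alpha^{(k)},t^{(k)})\ne(\alpha^{(k+1)},t^{(k+1)})$. Markov processes here may be time-inhomogeneous. *)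

theory Defs
  imports
    "HOL-Probability.Probability"
    "Jordan_Normal_Form.Schur_Decomposition"
begin

definition standard_brownian_motion :: "'a measure \<Rightarrow> (real \<Rightarrow> 'a \<Rightarrow> real) \<Rightarrow> bool" where
  "standard_brownian_motion M W \<longleftrightarrow>
     (\<forall>t\<ge>0. W t \<in> borel_measurable M) \<and>
     (AE \<omega> in M. W 0 \<omega> = 0) \<and>
     (\<forall>s\<ge>0. \<forall>t>s. distributed M lborel (\<lambda>\<omega>. W t \<omega> - W s \<omega>) (normal_density 0 (sqrt (t - s)))) \<and>
     (\<forall>(n::nat) (\<tau> :: nat \<Rightarrow> real). 0 \<le> \<tau> 0 \<longrightarrow> (\<forall>i<n. \<tau> i \<le> \<tau> (Suc i)) \<longrightarrow>
        prob_space.indep_vars M (\<lambda>_. borel) (\<lambda>i \<omega>. W (\<tau> (Suc i)) \<omega> - W (\<tau> i) \<omega>) {..<n}) \<and>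
     (AE \<omega> in M. continuous_on {0..} (\<lambda>t. W t \<omega>))"

text \<open>Independence of processes is independence of the path-valued random variables
  obtained by restricting time to $[0,\infty)$, with the product sigma-algebra on the
  space of paths.\<close>

definition sample_path :: "(real \<Rightarrow> 'a \<Rightarrow> 'b) \<Rightarrow> 'a \<Rightarrow> real \<Rightarrow> 'b" where
  "sample_path W \<omega> = (\<lambda>t\<in>{0..}. W t \<omega>)"

abbreviation path_space :: "(real \<Rightarrow> 'b::topological_space) measure" where
  "path_space \<equiv> PiM {0..} (\<lambda>_. borel)"

definition complex_brownian_motion :: "'a measure \<Rightarrow> (real \<Rightarrow> 'a \<Rightarrow> complex) \<Rightarrow> bool" where
  "complex_brownian_motion M Z \<longleftrightarrow>
     (\<exists>b b'. standard_brownian_motion M b \<and> standard_brownian_motion M b' \<and>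
        prob_space.indep_var M path_space (sample_path b) path_space (sample_path b') \<and>
        (\<forall>t\<ge>0. \<forall>\<omega>\<in>space M.
           Z t \<omega> = 1 / complex_of_real (sqrt 2) * complex_of_real (b t \<omega>)
                  + \<i> / complex_of_real (sqrt 2) * complex_of_real (b' t \<omega>)))"

text \<open>Rows and columns of the array are indexed by the positive integers; the values of
  \<open>B\<close> at index 0 are irrelevant. All members have the same law because
  \<open>complex_brownian_motion\<close> determines it.\<close>

definition iid_complex_brownian_motions ::
    "'a measure \<Rightarrow> (nat \<Rightarrow> nat \<Rightarrow> real \<Rightarrow> 'a \<Rightarrow> complex) \<Rightarrow> bool" where
  "iid_complex_brownian_motions M B \<longleftrightarrow>
     (\<forall>i\<ge>1. \<forall>j\<ge>1. complex_brownian_motion M (B i j)) \<and>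
     prob_space.indep_vars M (\<lambda>_. path_space) (\<lambda>(i, j). sample_path (B i j)) ({1..} \<times> {1..})"

text \<open>Matrices of type \<open>mat\<close> are indexed from 0, hence the shift.\<close>

definition BM_matrix ::
    "(nat \<Rightarrow> nat \<Rightarrow> real \<Rightarrow> 'a \<Rightarrow> complex) \<Rightarrow> nat \<Rightarrow> nat \<Rightarrow> real \<Rightarrow> 'a \<Rightarrow> complex mat" where
  "BM_matrix B N \<alpha> t \<omega> = mat (N + \<alpha>) N (\<lambda>(i, j). B (Suc i) (Suc j) t \<omega>)"

text \<open>The eigenvalues, with algebraic multiplicity, in increasing order. This is only
  meaningful for matrices with real spectrum, such as Hermitian ones.\<close>

definition ordered_eigenvalues :: "complex mat \<Rightarrow> real list" where
  "ordered_eigenvalues H = sorted_list_of_multiset (image_mset Re (proots (char_poly H)))"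

definition X_ev ::
    "(nat \<Rightarrow> nat \<Rightarrow> real \<Rightarrow> 'a \<Rightarrow> complex) \<Rightarrow> nat \<Rightarrow> nat \<Rightarrow> real \<Rightarrow> nat \<Rightarrow> 'a \<Rightarrow> real" where
  "X_ev B N \<alpha> t j \<omega> =
     ordered_eigenvalues (mat_adjoint (BM_matrix B N \<alpha> t \<omega>) * BM_matrix B N \<alpha> t \<omega>) ! (j - 1)"

definition space_like_path :: "nat \<Rightarrow> (nat \<Rightarrow> nat) \<Rightarrow> (nat \<Rightarrow> real) \<Rightarrow> bool" where
  "space_like_path m \<alpha> t \<longleftrightarrow>
     (\<forall>k\<in>{1..<m}. \<alpha> k \<ge> \<alpha> (Suc k) \<and> t k \<le> t (Suc k) \<and> (\<alpha> k, t k) \<noteq> (\<alpha> (Suc k), t (Suc k)))"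

text \<open>The (time-inhomogeneous) Markov property of \<open>Y 1, \<dots>, Y m\<close> with values in \<open>S\<close>:
  the conditional law of \<open>Y (k + 1)\<close> given \<open>Y 1, \<dots>, Y k\<close> equals that given \<open>Y k\<close>.\<close>

definition markov_process :: "'a measure \<Rightarrow> 's measure \<Rightarrow> nat \<Rightarrow> (nat \<Rightarrow> 'a \<Rightarrow> 's) \<Rightarrow> bool" where
  "markov_process M S m Y \<longleftrightarrow>
     (\<forall>k\<in>{1..m}. Y k \<in> measurable M S) \<and>
     (\<forall>k\<in>{1..<m}. \<forall>A\<in>sets S. AE \<omega> in M.
        real_cond_exp M (vimage_algebra (space M) (\<lambda>\<omega>. \<lambda>i\<in>{1..k}. Y i \<omega>) (PiM {1..k} (\<lambda>_. S)))
          (\<lambda>\<omega>. indicator A (Y (Suc k) \<omega>)) \<omega> =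
        real_cond_exp M (vimage_algebra (space M) (Y k) S)
          (\<lambda>\<omega>. indicator A (Y (Suc k) \<omega>)) \<omega>)"

end

theory Submission
  imports Defs
begin

text \<open>The spectra \<open>X 1, \<dots>, X k\<close> and \<open>X (k + 1)\<close> are conditionally independent given
\<open>X k\<close> because of two facts about the matrices \<open>A 1, \<dots>, A m\<close>, where \<open>A l\<close> consists of the first
\<open>N + \<alpha> l\<close> rows of the Brownian array at time \<open>t l\<close>.

The first is a Brownian bridge decomposition. Fix \<open>k\<close> and put \<open>r = N + \<alpha> k\<close>. For \<open>l < k\<close> subtract from the
first \<open>r\<close> rows of the array at time \<open>t l\<close> the fraction \<open>t l / t k\<close> of the array at time \<open>t k\<close>, and leave
the other rows as they are. Since \<open>t l \<le> t k \<le> t (k + 1)\<close>, what remains is uncorrelated with the first \<open>r\<close> rows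
at the times \<open>t k\<close> and \<open>t (k + 1)\<close>, and hence independent of them, as everything is jointly Gaussian. Because \<open>\<alpha>\<close>
decreases, those rows contain both \<open>A k\<close> and \<open>A (k + 1)\<close>. So, conditionally on \<open>A k\<close> and \<open>A (k + 1)\<close>, the event
that \<open>(X 1, \<dots>, X k)\<close> lies in \<open>E\<close> has a probability that is an explicit function \<open>\<psi> (A k)\<close> of \<open>A k\<close> alone,
obtained by integrating over the residual array (\<open>past_prob\<close>).

The second is unitary invariance. The law of the residual array does not change if its first \<open>r\<close> rows are mixed by a
unitary matrix \<open>U\<close> and its columns by a unitary matrix \<open>V\<close>, and such a change also preserves the spectra that
are built from it together with \<open>U * A k * V\<close>, since each \<open>A l\<close> with \<open>l < k\<close> has at least \<open>r\<close> rows. Therefore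
\<open>\<psi> (U * A k * V) = \<psi> (A k)\<close> for every \<open>U\<close> and \<open>V\<close>, and by the singular value decomposition \<open>\<psi> (A k)\<close> is a function of
the ordered eigenvalues \<open>X k\<close> (\<open>past_prob_eigenvalues\<close>). The identity
holds for every matrix, and therefore also for the random rotation that diagonalises \<open>A k\<close>.

Consequently the conditional probability of every past event given \<open>A k\<close> and \<open>A (k + 1)\<close> is measurable with respect to
\<open>X k\<close>. By the symmetry of conditional independence (\<open>real_cond_exp_eq_of_intermediate\<close>) the future value \<open>X (k + 1)\<close>,
which is a function of \<open>A (k + 1)\<close>, has the same conditional law given \<open>X 1, \<dots>, X k\<close> as given \<open>X k\<close>.

The Gaussian facts are all obtained from characteristic functions: a \<open>gaussian_array\<close> is a finite family whose
characteristic function is the exponential of a quadratic form, such a family is determined in law by that form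
(\<open>gaussian_array_law_unique\<close>), and the bridge decomposition, the independence and the unitary invariance are statements about
quadratic forms. The eigenvalues are measurable because the power sums of the eigenvalues are traces of matrix
powers and the eigenvalues can be read off from their power sums.\<close>

unbundle no vec_syntax

section \<open>Unitary matrices and singular values\<close>

lemma dim_mat_adjoint [simp]:
  "dim_row (mat_adjoint A) = dim_col A" "dim_col (mat_adjoint A) = dim_row A"
  by (auto simp: mat_adjoint_def)

lemma mat_adjoint_carrier [simp]: "A \<in> carrier_mat r c \<Longrightarrow> mat_adjoint A \<in> carrier_mat c r"
  by (rule carrier_matI) auto

lemma mat_adjoint_index [simp]:
  fixes A :: "complex mat"
  assumes "i < dim_col A" "j < dim_row A"
  shows "mat_adjoint A $$ (i, j) = cnj (A $$ (j, i))"
  using assms by (simp add: mat_adjoint_def mat_of_rows_index conjugate_complex_def)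

lemma mat_mult_index:
  assumes "A \<in> carrier_mat r n" "B \<in> carrier_mat n c" "i < r" "j < c"
  shows "(A * B) $$ (i, j) = (\<Sum>k<n. A $$ (i, k) * B $$ (k, j))"
  using assms by (auto simp: scalar_prod_def atLeast0LessThan intro!: sum.cong)

lemma mat_adjoint_mult:
  fixes A :: "complex mat"
  assumes "A \<in> carrier_mat r n" "B \<in> carrier_mat n c"
  shows "mat_adjoint (A * B) = mat_adjoint B * mat_adjoint A"
proof (rule eq_matI)
  fix i j assume "i < dim_row (mat_adjoint B * mat_adjoint A)" "j < dim_col (mat_adjoint B * mat_adjoint A)"
  then have ij: "i < c" "j < r" using assms by auto
  have "mat_adjoint (A * B) $$ (i, j) = cnj (\<Sum>k<n. A $$ (j, k) * B $$ (k, i))"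
    using ij assms by (subst mat_adjoint_index) (auto simp del: index_mult_mat(1) simp: mat_mult_index[OF assms])
  also have "\<dots> = (\<Sum>k<n. mat_adjoint B $$ (i, k) * mat_adjoint A $$ (k, j))"
    using ij assms by (auto simp: mult.commute intro!: sum.cong)
  also have "\<dots> = (mat_adjoint B * mat_adjoint A) $$ (i, j)"
    by (rule mat_mult_index[symmetric]) (use ij assms in auto)
  finally show "mat_adjoint (A * B) $$ (i, j) = (mat_adjoint B * mat_adjoint A) $$ (i, j)" .
qed (use assms in auto)

lemma mat_adjoint_adjoint [simp]: "mat_adjoint (mat_adjoint A) = (A :: complex mat)"
  by (rule eq_matI) auto

definition unitary_matrix :: "nat \<Rightarrow> complex mat \<Rightarrow> bool" where
  "unitary_matrix n U \<longleftrightarrow> U \<in> carrier_mat n n \<and> mat_adjoint U * U = 1\<^sub>m n \<and> U * mat_adjoint U = 1\<^sub>m n"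

lemma unitary_matrixI:
  assumes "U \<in> carrier_mat n n" "mat_adjoint U * U = 1\<^sub>m n"
  shows "unitary_matrix n U"
  using assms mat_mult_left_right_inverse[of "mat_adjoint U" n U] by (auto simp: unitary_matrix_def)

lemma unitary_matrix_mult:
  assumes "unitary_matrix n U" "unitary_matrix n V"
  shows "unitary_matrix n (U * V)"
proof (rule unitary_matrixI)
  have c [simp]: "U \<in> carrier_mat n n" "V \<in> carrier_mat n n" using assms by (auto simp: unitary_matrix_def)
  show "U * V \<in> carrier_mat n n" by (rule mult_carrier_mat[OF c])
  have "mat_adjoint (U * V) * (U * V) = mat_adjoint V * (mat_adjoint U * U) * V"
    by (simp add: mat_adjoint_mult[of _ n n _ n] assoc_mult_mat[of _ n n _ n _ n] mult_carrier_mat[of _ n n _ n])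
  then show "mat_adjoint (U * V) * (U * V) = 1\<^sub>m n"
    using assms by (simp add: unitary_matrix_def right_mult_one_mat[of _ n n])
qed

lemma normalise_vector:
  fixes v :: "nat \<Rightarrow> complex"
  assumes "k < n" "v k \<noteq> 0"
  shows "\<exists>c. (\<Sum>k<n. c * v k * cnj (c * v k)) = 1"
proof -
  define s where "s = (\<Sum>k<n. (cmod (v k))\<^sup>2)"
  have "s > 0" unfolding s_def using assms by (intro sum_pos2[of _ k]) auto
  let ?c = "complex_of_real (1 / sqrt s)"
  have "(\<Sum>k<n. (?c * v k) * cnj (?c * v k)) = (?c * ?c) * (\<Sum>k<n. v k * cnj (v k))"
    unfolding sum_distrib_left by (rule sum.cong) (simp_all add: ac_simps)
  also have "(\<Sum>k<n. v k * cnj (v k)) = of_real s"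
    by (simp add: s_def complex_norm_square del: of_real_power)
  also have "(?c * ?c) * of_real s = 1"
  proof -
    have "(1 / sqrt s * (1 / sqrt s)) * s = 1" using \<open>s > 0\<close> by simp
    then show ?thesis by (metis of_real_1 of_real_mult)
  qed
  finally show ?thesis by blast
qed

text \<open>A family of fewer than \<open>n\<close> vectors can be enlarged one vector at a time: the square matrix whose rows are the
conjugates of the given vectors, padded with zero rows, is singular, and a vector in its kernel is orthogonal to all of them. The
family is indexed by an arbitrary subset \<open>J\<close>, so that prescribed vectors keep their positions.\<close>

lemma extend_orthonormal:
  fixes u :: "nat \<Rightarrow> nat \<Rightarrow> complex"
  assumes "J \<subseteq> {..<n}"
    and "\<And>i j. i \<in> J \<Longrightarrow> j \<in> J \<Longrightarrow> (\<Sum>k<n. u i k * cnj (u j k)) = (if i = j then 1 else 0)"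
  shows "\<exists>u'. (\<forall>i\<in>J. u' i = u i) \<and>
    (\<forall>i<n. \<forall>j<n. (\<Sum>k<n. u' i k * cnj (u' j k)) = (if i = j then 1 else 0))"
  using assms
proof (induction "card ({..<n} - J)" arbitrary: J u)
  case 0
  then have "J = {..<n}" by auto
  then show ?case using 0 by (intro exI[of _ u]) auto
next
  case (Suc d)
  then obtain x where x: "x < n" "x \<notin> J"
    by (metis DiffE card.empty ex_in_conv lessThan_iff nat.distinct(1))
  define M where "M = mat n n (\<lambda>(i, k). if i \<in> J then cnj (u i k) else 0)"
  have "transpose_mat M *\<^sub>v unit_vec n x = 0\<^sub>v n"
    using x by (intro eq_vecI) (auto simp: M_def)
  moreover have "unit_vec n x \<noteq> (0\<^sub>v n :: complex vec)" using x by simp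
  moreover have "transpose_mat M \<in> carrier_mat n n" by (simp add: M_def)
  ultimately have "det (transpose_mat M) = 0"
    by (subst det_0_iff_vec_prod_zero[of _ n]) (auto intro: exI[of _ "unit_vec n x"])
  then have "det M = 0" using det_transpose[of M n] by (simp add: M_def)
  then obtain v where v: "v \<in> carrier_vec n" "v \<noteq> 0\<^sub>v n" "M *\<^sub>v v = 0\<^sub>v n"
    using det_0_iff_vec_prod_zero[of M n] by (auto simp: M_def)
  have orth: "(\<Sum>k<n. v $ k * cnj (u i k)) = 0" if "i \<in> J" for i
  proof -
    have "i < n" using that Suc.prems by auto
    then have "(M *\<^sub>v v) $ i = 0" using v by simp
    then show ?thesis using \<open>i < n\<close> that v
      by (simp add: M_def scalar_prod_def atLeast0LessThan mult.commute)
  qed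
  obtain c where c: "(\<Sum>k<n. (c * v $ k) * cnj (c * v $ k)) = 1"
  proof -
    obtain k where "k < n" "v $ k \<noteq> 0" using v by (metis carrier_vecD eq_vecI index_zero_vec(1) index_zero_vec(2))
    then show thesis using normalise_vector[of k n "\<lambda>k. v $ k"] that by blast
  qed
  define w where "w k = c * v $ k" for k
  have ww: "(\<Sum>k<n. w k * cnj (w k)) = 1" using c by (simp add: w_def)
  have wu: "(\<Sum>k<n. w k * cnj (u i k)) = 0" if "i \<in> J" for i
    using orth[OF that] by (simp add: w_def mult.assoc flip: sum_distrib_left)
  have uw: "(\<Sum>k<n. u i k * cnj (w k)) = 0" if "i \<in> J" for i
    using arg_cong[OF wu[OF that], of cnj] by (simp add: mult.commute)
  obtain u' where u': "\<forall>i\<in>insert x J. u' i = (u(x := w)) i"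
    "\<forall>i<n. \<forall>j<n. (\<Sum>k<n. u' i k * cnj (u' j k)) = (if i = j then 1 else 0)"
  proof -
    have "\<exists>u'. (\<forall>i\<in>insert x J. u' i = (u(x := w)) i) \<and>
    (\<forall>i<n. \<forall>j<n. (\<Sum>k<n. u' i k * cnj (u' j k)) = (if i = j then 1 else 0))"
  proof (rule Suc.hyps(1))
    have "{..<n} - insert x J = ({..<n} - J) - {x}" by auto
    then show "d = card ({..<n} - insert x J)" using Suc.hyps(2) x by auto
    show "insert x J \<subseteq> {..<n}" using x Suc.prems by auto
    show "(\<Sum>k<n. (u(x := w)) i k * cnj ((u(x := w)) j k)) = (if i = j then 1 else 0)"
      if "i \<in> insert x J" "j \<in> insert x J" for i j
      using that ww wu uw Suc.prems(2) x by (auto simp: fun_upd_def)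
  qed
    then show thesis using that by blast
  qed
  have "u' i = u i" if "i \<in> J" for i
    using u'(1) x that by (metis fun_upd_other insertCI)
  with u'(2) show ?case by (intro exI[of _ u']) blast
qed

lemma unitary_matrix_of_orthonormal:
  assumes "\<And>i j. i < n \<Longrightarrow> j < n \<Longrightarrow> (\<Sum>k<n. u i k * cnj (u j k)) = (if i = j then 1 else 0)"
  shows "unitary_matrix n (mat n n (\<lambda>(i, j). u j i))" (is "unitary_matrix n ?U")
proof (rule unitary_matrixI)
  show "mat_adjoint ?U * ?U = 1\<^sub>m n"
  proof (rule eq_matI)
    fix i j assume "i < dim_row (1\<^sub>m n :: complex mat)" "j < dim_col (1\<^sub>m n :: complex mat)"
    then have ij: "i < n" "j < n" by auto
    have "(mat_adjoint ?U * ?U) $$ (i, j) = (\<Sum>k<n. mat_adjoint ?U $$ (i, k) * ?U $$ (k, j))"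
      by (rule mat_mult_index) (use ij in auto)
    also have "\<dots> = (\<Sum>k<n. u j k * cnj (u i k))" using ij by (auto simp: mult.commute intro!: sum.cong)
    finally show "(mat_adjoint ?U * ?U) $$ (i, j) = 1\<^sub>m n $$ (i, j)" using assms ij by auto
  qed auto
qed auto

text \<open>Induction on the list of eigenvalues: complete a unit eigenvector for the first one to an orthonormal basis. In this
basis the first column is a multiple of the first unit vector, hence so is the first row because the matrix is Hermitian, and the
complementary block is Hermitian with the remaining eigenvalues. The eigenvalues appear on the diagonal in the order in
which the factorisation lists them; this is what makes the singular value decomposition below a function of the sorted
eigenvalues.\<close>

lemma hermitian_diagonalisation:
  assumes "H \<in> carrier_mat n n" "mat_adjoint H = H"
    and "char_poly H = (\<Prod>e\<leftarrow>es. [:- e, 1:])"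
  shows "\<exists>W. unitary_matrix n W \<and>
    H = W * mat n n (\<lambda>(i, j). if i = j then es ! i else 0) * mat_adjoint W"
  using assms
proof (induction es arbitrary: n H)
  case Nil
  then have "n = 0" using degree_monic_char_poly[OF Nil(1)] by simp
  then show ?case using Nil(1)
    by (intro exI[of _ "1\<^sub>m 0"]) (auto simp: unitary_matrix_def intro!: eq_matI)
next
  case (Cons e es)
  note H = Cons.prems(1)
  let ?q = "\<Prod>e\<leftarrow>es. [:- e, 1:]"
  have cp: "char_poly H = [:- e, 1:] * ?q" using Cons by simp
  have mon: "monic ?q" by (rule monic_prod_list) auto
  then have "?q \<noteq> 0" by auto
  then have "degree (char_poly H) = Suc (degree ?q)" unfolding cp by (subst degree_mult_eq) auto
  then obtain m where n: "n = Suc m" using degree_monic_char_poly[OF H] by simp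
  then have n0: "0 < n" by simp
  have "eigenvalue H e" unfolding eigenvalue_root_char_poly[OF H] cp by simp
  then obtain v where v: "v \<in> carrier_vec n" "v \<noteq> 0\<^sub>v n" "H *\<^sub>v v = e \<cdot>\<^sub>v v"
    using H by (auto simp: eigenvalue_def eigenvector_def)
  obtain c where c: "(\<Sum>k<n. (c * v $ k) * cnj (c * v $ k)) = 1"
  proof -
    obtain k where "k < n" "v $ k \<noteq> 0" using v by (metis carrier_vecD eq_vecI index_zero_vec(1) index_zero_vec(2))
    then show thesis using normalise_vector[of k n "\<lambda>k. v $ k"] that by blast
  qed
  define w where "w k = c * v $ k" for k
  have ww: "(\<Sum>k<n. w k * cnj (w k)) = 1" using c by (simp add: w_def)
  have Hw: "(\<Sum>k<n. H $$ (i, k) * w k) = e * w i" if "i < n" for i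
  proof -
    have "(H *\<^sub>v v) $ i = (\<Sum>k<n. H $$ (i, k) * v $ k)"
      using v(1) H that by (simp add: scalar_prod_def atLeast0LessThan)
    then have "(\<Sum>k<n. H $$ (i, k) * v $ k) = e * v $ i"
      using v that by simp
    then show ?thesis by (simp add: w_def mult.left_commute[of _ c] flip: sum_distrib_left)
  qed
  obtain u where u0: "u 0 = w"
    and u: "\<And>i j. i < n \<Longrightarrow> j < n \<Longrightarrow> (\<Sum>k<n. u i k * cnj (u j k)) = (if i = j then 1 else 0)"
    using extend_orthonormal[of "{0}" n "\<lambda>_. w"] ww n by auto
  define W where "W = mat n n (\<lambda>(i, j). u j i)"
  have UW: "unitary_matrix n W" unfolding W_def by (rule unitary_matrix_of_orthonormal) (rule u)
  have Wc [simp]: "W \<in> carrier_mat n n" by (simp add: W_def)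
  have WW: "mat_adjoint W * W = 1\<^sub>m n" "W * mat_adjoint W = 1\<^sub>m n" using UW by (auto simp: unitary_matrix_def)
  note [simp] = H mult_carrier_mat[of _ n n _ n]
  note as = assoc_mult_mat[of _ n n _ n _ n]
  define A where "A = mat_adjoint W * H * W"
  have Ac [simp]: "A \<in> carrier_mat n n" by (simp add: A_def)
  have Ah: "mat_adjoint A = A"
    by (simp add: A_def mat_adjoint_mult[of _ n n _ n] as Cons.prems(2))
  have col0: "A $$ (i, 0) = (if i = 0 then e else 0)" if "i < n" for i
  proof -
    have "A $$ (i, 0) = (\<Sum>k<n. mat_adjoint W $$ (i, k) * (H * W) $$ (k, 0))"
      unfolding A_def as[OF mat_adjoint_carrier[OF Wc] H Wc]
      by (rule mat_mult_index[of _ n n _ n]) (use that n0 in auto)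
    also have "\<dots> = (\<Sum>k<n. cnj (u i k) * (e * w k))"
    proof (rule sum.cong)
      fix k assume "k \<in> {..<n}"
      then have k: "k < n" by simp
      have "(H * W) $$ (k, 0) = (\<Sum>l<n. H $$ (k, l) * W $$ (l, 0))"
        by (rule mat_mult_index[of _ n n _ n]) (use k n0 in auto)
      also have "\<dots> = (\<Sum>l<n. H $$ (k, l) * w l)" using n u0 by (auto simp: W_def intro!: sum.cong)
      also have "\<dots> = e * w k" by (rule Hw[OF k])
      finally show "mat_adjoint W $$ (i, k) * (H * W) $$ (k, 0) = cnj (u i k) * (e * w k)"
        using that k by (simp add: W_def)
    qed auto
    also have "\<dots> = e * (\<Sum>k<n. u 0 k * cnj (u i k))" by (simp add: sum_distrib_left u0 ac_simps)
    also have "\<dots> = (if i = 0 then e else 0)" using u[of 0 i] that n by auto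
    finally show ?thesis .
  qed
  have row0: "A $$ (0, i) = 0" if "i < n" "i \<noteq> 0" for i
  proof -
    have "A $$ (0, i) = mat_adjoint A $$ (0, i)" by (simp only: Ah)
    also have "\<dots> = cnj (A $$ (i, 0))" using that n Ac by (intro mat_adjoint_index) auto
    finally show ?thesis using col0 that by simp
  qed
  define A1 where "A1 = mat 1 1 (\<lambda>_. e)"
  define A3 where "A3 = mat m m (\<lambda>(i, j). A $$ (Suc i, Suc j))"
  have A1c [simp]: "A1 \<in> carrier_mat 1 1" and A3c [simp]: "A3 \<in> carrier_mat m m"
    by (simp_all add: A1_def A3_def)
  have Ablock: "A = four_block_mat A1 (0\<^sub>m 1 m) (0\<^sub>m m 1) A3"
  proof (rule eq_matI)
    fix i j assume "i < dim_row (four_block_mat A1 (0\<^sub>m 1 m) (0\<^sub>m m 1) A3)"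
      "j < dim_col (four_block_mat A1 (0\<^sub>m 1 m) (0\<^sub>m m 1) A3)"
    then have "i < n" "j < n" by (auto simp: n A1_def A3_def)
    then show "A $$ (i, j) = four_block_mat A1 (0\<^sub>m 1 m) (0\<^sub>m m 1) A3 $$ (i, j)"
      using col0[of i] row0[of j] by (auto simp: A1_def A3_def n)
  qed (use Ac in \<open>auto simp: n A1_def A3_def simp del: Ac\<close>)
  have A3h: "mat_adjoint A3 = A3"
  proof (rule eq_matI)
    fix i j assume "i < dim_row A3" "j < dim_col A3"
    then have ij: "Suc i < n" "Suc j < n" "i < m" "j < m" by (auto simp: A3_def n)
    have "mat_adjoint A $$ (Suc i, Suc j) = cnj (A $$ (Suc j, Suc i))"
      using ij carrier_matD[OF Ac] by (intro mat_adjoint_index) simp_all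
    then show "mat_adjoint A3 $$ (i, j) = A3 $$ (i, j)"
      using ij by (simp add: Ah) (simp add: A3_def)
  qed (auto simp: A3_def)
  have "similar_mat_wit A H (mat_adjoint W) W"
    by (rule similar_mat_witI[of _ _ n]) (simp_all add: WW A_def)
  then have "similar_mat A H" by (auto simp: similar_mat_def)
  then have "char_poly A = char_poly H" by (rule char_poly_similar)
  moreover have "char_poly A = char_poly A1 * char_poly A3"
    unfolding Ablock by (rule char_poly_four_block_zeros_col[OF A1c _ A3c]) simp
  moreover have "char_poly A1 = [:- e, 1:]" by (simp add: A1_def char_poly_defs det_def sign_def)
  ultimately have "[:- e, 1:] * char_poly A3 = [:- e, 1:] * ?q" using cp by metis
  then have "char_poly A3 = ?q" by (simp only: mult_cancel_left) auto
  from Cons.IH[OF A3c A3h this] obtain W3 where UW3: "unitary_matrix m W3"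
    and A3W: "A3 = W3 * mat m m (\<lambda>(i, j). if i = j then es ! i else 0) * mat_adjoint W3" by auto
  have W3c [simp]: "W3 \<in> carrier_mat m m" using UW3 by (simp add: unitary_matrix_def)
  define D3 where "D3 = mat m m (\<lambda>(i, j). if i = j then es ! i else 0)"
  have D3c [simp]: "D3 \<in> carrier_mat m m" by (simp add: D3_def)
  define D where "D = mat n n (\<lambda>(i, j). if i = j then (e # es) ! i else 0)"
  have Dc [simp]: "D \<in> carrier_mat n n" by (simp add: D_def)
  have Dblock: "D = four_block_mat A1 (0\<^sub>m 1 m) (0\<^sub>m m 1) D3"
    by (rule eq_matI) (auto simp: D_def D3_def A1_def n nth_Cons')
  define P where "P = four_block_mat (1\<^sub>m 1) (0\<^sub>m 1 m) (0\<^sub>m m 1) W3"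
  have Pc [simp]: "P \<in> carrier_mat n n"
    unfolding P_def using four_block_carrier_mat[of "1\<^sub>m 1" 1 1 W3 m m] by (simp add: n)
  have Padj: "mat_adjoint P = four_block_mat (1\<^sub>m 1) (0\<^sub>m 1 m) (0\<^sub>m m 1) (mat_adjoint W3)"
  proof (rule eq_matI)
    fix i j assume "i < dim_row (four_block_mat (1\<^sub>m 1) (0\<^sub>m 1 m) (0\<^sub>m m 1) (mat_adjoint W3))"
      "j < dim_col (four_block_mat (1\<^sub>m 1) (0\<^sub>m 1 m) (0\<^sub>m m 1) (mat_adjoint W3))"
    then have "i < n" "j < n" using W3c by (auto simp: n)
    then show "mat_adjoint P $$ (i, j) = four_block_mat (1\<^sub>m 1) (0\<^sub>m 1 m) (0\<^sub>m m 1) (mat_adjoint W3) $$ (i, j)"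
      using W3c by (auto simp: P_def n simp del: W3c)
  qed (use W3c Pc in \<open>auto simp: n simp del: W3c Pc\<close>)
  note [simp] = mult_carrier_mat[of _ m m _ m] mult_carrier_mat[of _ 1 1 _ 1]
  have fb: "four_block_mat X (0\<^sub>m 1 m) (0\<^sub>m m 1) Y * four_block_mat X' (0\<^sub>m 1 m) (0\<^sub>m m 1) Y'
      = four_block_mat (X * X') (0\<^sub>m 1 m) (0\<^sub>m m 1) (Y * Y')"
    if "X \<in> carrier_mat 1 1" "X' \<in> carrier_mat 1 1" "Y \<in> carrier_mat m m" "Y' \<in> carrier_mat m m"
    for X X' Y Y' :: "complex mat"
    by (subst mult_four_block_mat[of _ 1 1 _ m _ m _ _ 1 _ m]) (use that in auto)
  have "P * D * mat_adjoint P = four_block_mat (1\<^sub>m 1 * A1 * 1\<^sub>m 1) (0\<^sub>m 1 m) (0\<^sub>m m 1) (W3 * D3 * mat_adjoint W3)"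
  proof -
    have "P * D = four_block_mat (1\<^sub>m 1 * A1) (0\<^sub>m 1 m) (0\<^sub>m m 1) (W3 * D3)"
      unfolding P_def Dblock by (rule fb[OF one_carrier_mat A1c W3c D3c])
    then show ?thesis
      unfolding Padj by (simp only:) (rule fb[OF mult_carrier_mat[OF one_carrier_mat A1c] one_carrier_mat
          mult_carrier_mat[OF W3c D3c] mat_adjoint_carrier[OF W3c]])
  qed
  then have "A = P * D * mat_adjoint P"
    unfolding Ablock A3W D3_def[symmetric] by (simp only: left_mult_one_mat[OF A1c] right_mult_one_mat[OF A1c])
  moreover have "H = W * A * mat_adjoint W"
  proof -
    have "W * A * mat_adjoint W = (W * mat_adjoint W) * H * (W * mat_adjoint W)"
      by (simp add: A_def as)
    then show ?thesis
      by (simp only: WW left_mult_one_mat[OF H] right_mult_one_mat[OF H])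
  qed
  ultimately have "H = (W * P) * D * mat_adjoint (W * P)"
    by (simp add: mat_adjoint_mult[of _ n n _ n] as)
  moreover have "unitary_matrix n P"
  proof (rule unitary_matrixI)
    have one: "four_block_mat (1\<^sub>m 1) (0\<^sub>m 1 m) (0\<^sub>m m 1) (1\<^sub>m m) = (1\<^sub>m n :: complex mat)"
      by (rule eq_matI) (auto simp: n)
    have W3W3: "mat_adjoint W3 * W3 = 1\<^sub>m m" using UW3 by (simp add: unitary_matrix_def)
    have "mat_adjoint P * P = four_block_mat (1\<^sub>m 1 * 1\<^sub>m 1) (0\<^sub>m 1 m) (0\<^sub>m m 1) (mat_adjoint W3 * W3)"
      unfolding Padj unfolding P_def by (rule fb[OF one_carrier_mat one_carrier_mat mat_adjoint_carrier[OF W3c] W3c])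
    then show "mat_adjoint P * P = 1\<^sub>m n"
      by (simp only: W3W3 one left_mult_one_mat[OF one_carrier_mat])
  qed auto
  ultimately show ?case using unitary_matrix_mult[OF UW] by (auto simp: D_def)
qed

lemma unitary_matrix_adjoint: "unitary_matrix n U \<Longrightarrow> unitary_matrix n (mat_adjoint U)"
  by (simp add: unitary_matrix_def)

lemma ordered_eigenvalues_of_factorisation:
  assumes "char_poly H = (\<Prod>e\<leftarrow>es. [:- e, 1:])"
  shows "ordered_eigenvalues H = sort (map Re es)"
proof -
  have "proots (\<Prod>e\<leftarrow>es. [:- e, 1:]) = mset es"
  proof (induction es)
    case (Cons e es)
    have "(\<Prod>e\<leftarrow>es. [:- e, 1:]) \<noteq> 0" by (auto simp: prod_list_zero_iff)
    then show ?case using Cons by (simp add: proots_mult del: mult_pCons_left)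
  qed simp
  then show ?thesis using assms
    by (simp add: ordered_eigenvalues_def sorted_list_of_multiset_mset flip: mset_map)
qed

text \<open>Conjugating the Gram matrix of \<open>A\<close> into diagonal form exhibits its eigenvalues as the squared norms of the columns of
\<open>A * W\<close>, so they are real and nonnegative, and taking real parts in the definition of \<open>ordered_eigenvalues\<close> loses nothing.\<close>

lemma ordered_eigenvalues_gram:
  assumes A: "A \<in> carrier_mat r n"
  defines "xs \<equiv> ordered_eigenvalues (mat_adjoint A * A)"
  shows "sorted xs" "length xs = n" "\<forall>x\<in>set xs. 0 \<le> x"
    and "char_poly (mat_adjoint A * A) = (\<Prod>x\<leftarrow>xs. [:- complex_of_real x, 1:])"
proof -
  let ?H = "mat_adjoint A * A"
  have H [simp]: "?H \<in> carrier_mat n n" using A by (intro mult_carrier_mat) auto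
  have Hh: "mat_adjoint ?H = ?H" using A by (subst mat_adjoint_mult[of _ n r _ n]) auto
  obtain es where es: "char_poly ?H = (\<Prod>e\<leftarrow>es. [:- e, 1:])" "length es = n"
    using char_poly_factorized[OF H] by auto
  obtain W where W: "unitary_matrix n W"
    "?H = W * mat n n (\<lambda>(i, j). if i = j then es ! i else 0) * mat_adjoint W" (is "_ = _ * ?D * _")
    using hermitian_diagonalisation[OF H Hh es(1)] by auto
  have Wc [simp]: "W \<in> carrier_mat n n" using W by (simp add: unitary_matrix_def)
  have Dc [simp]: "?D \<in> carrier_mat n n" by simp
  note [simp] = mult_carrier_mat[of _ n n _ n] mult_carrier_mat[of _ r n _ n]
    mult_carrier_mat[of _ n r _ n] A
  have "mat_adjoint (A * W) * (A * W) = mat_adjoint W * ?H * W"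
    by (simp add: mat_adjoint_mult[of _ r n _ n] assoc_mult_mat[of _ n n _ r _ n]
        assoc_mult_mat[of _ n r _ n _ n] assoc_mult_mat[of _ r n _ n _ n]
        assoc_mult_mat[of _ n n _ n _ n])
  also have "\<dots> = (mat_adjoint W * W) * ?D * (mat_adjoint W * W)"
    unfolding W(2) by (simp only: assoc_mult_mat[of _ n n _ n _ n] mult_carrier_mat[of _ n n _ n]
        Wc Dc mat_adjoint_carrier)
  also have "\<dots> = ?D" using W(1) by (simp add: unitary_matrix_def)
  finally have D: "mat_adjoint (A * W) * (A * W) = ?D" .
  have es_real: "es ! i = of_real (Re (es ! i)) \<and> Re (es ! i) \<ge> 0" if i: "i < n" for i
  proof -
    have "es ! i = (mat_adjoint (A * W) * (A * W)) $$ (i, i)" using i by (simp add: D)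
    also have "\<dots> = (\<Sum>k<r. mat_adjoint (A * W) $$ (i, k) * (A * W) $$ (k, i))"
      by (rule mat_mult_index[of _ n r _ n]) (use i in auto)
    also have "\<dots> = (\<Sum>k<r. of_real ((cmod ((A * W) $$ (k, i)))\<^sup>2))"
    proof (rule sum.cong)
      fix k assume k: "k \<in> {..<r}"
      have "mat_adjoint (A * W) $$ (i, k) = cnj ((A * W) $$ (k, i))"
        by (rule mat_adjoint_index) (use k i carrier_matD[OF A] carrier_matD[OF Wc] in auto)
      then show "mat_adjoint (A * W) $$ (i, k) * (A * W) $$ (k, i) = of_real ((cmod ((A * W) $$ (k, i)))\<^sup>2)"
        by (simp only: complex_norm_square mult.commute)
    qed simp
    also have "\<dots> = of_real (\<Sum>k<r. (cmod ((A * W) $$ (k, i)))\<^sup>2)" by simp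
    finally show ?thesis by (simp add: sum_nonneg del: of_real_sum)
  qed
  have xs: "xs = sort (map Re es)" unfolding xs_def by (rule ordered_eigenvalues_of_factorisation[OF es(1)])
  then show "sorted xs" "length xs = n" using es(2) by auto
  have Re_es: "map (\<lambda>e. complex_of_real (Re e)) es = es"
    using es_real es(2) by (intro nth_equalityI) auto
  show "\<forall>x\<in>set xs. 0 \<le> x" using es_real es(2) by (auto simp: xs in_set_conv_nth)
  have "mset (map (\<lambda>x. [:- complex_of_real x, 1:]) xs) =
      image_mset (\<lambda>x. [:- complex_of_real x, 1:]) (mset (map Re es))"
    by (simp add: xs)
  also have "\<dots> = mset (map (\<lambda>e. [:- e, 1:]) (map (\<lambda>e. complex_of_real (Re e)) es))"
    by (simp add: multiset.map_comp comp_def)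
  finally have "mset (map (\<lambda>x. [:- complex_of_real x, 1:]) xs) = mset (map (\<lambda>e. [:- e, 1:]) es)"
    unfolding Re_es .
  then show "char_poly ?H = (\<Prod>x\<leftarrow>xs. [:- complex_of_real x, 1:])"
    unfolding es(1) by (metis prod_mset_prod_list)
qed

definition singular_value_matrix :: "nat \<Rightarrow> nat \<Rightarrow> (nat \<Rightarrow> real) \<Rightarrow> complex mat" where
  "singular_value_matrix r n x = mat r n (\<lambda>(i, j). if i = j then of_real (sqrt (x i)) else 0)"

text \<open>If \<open>W\<close> diagonalises the Gram matrix, the columns of \<open>A * W\<close> are orthogonal with squared norms \<open>xs ! i\<close>. The
nonzero ones, normalised, form an orthonormal system, which \<open>extend_orthonormal\<close> completes to the columns of \<open>U\<close>.\<close>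

lemma singular_value_decomposition:
  assumes A: "A \<in> carrier_mat r n" and "n \<le> r"
  defines "xs \<equiv> ordered_eigenvalues (mat_adjoint A * A)"
  shows "\<exists>U V. unitary_matrix r U \<and> unitary_matrix n V \<and> A = U * singular_value_matrix r n (\<lambda>i. xs ! i) * V"
proof -
  let ?H = "mat_adjoint A * A"
  have H [simp]: "?H \<in> carrier_mat n n" using A by (intro mult_carrier_mat) auto
  have Hh: "mat_adjoint ?H = ?H" using A by (subst mat_adjoint_mult[of _ n r _ n]) auto
  note og = ordered_eigenvalues_gram[OF A, folded xs_def]
  have "char_poly ?H = (\<Prod>e\<leftarrow>map complex_of_real xs. [:- e, 1:])"
    using og(4) by (simp add: comp_def)
  from hermitian_diagonalisation[OF H Hh this] obtain W where W: "unitary_matrix n W"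
    "?H = W * mat n n (\<lambda>(i, j). if i = j then map complex_of_real xs ! i else 0) * mat_adjoint W" (is "_ = _ * ?D * _")
    by auto
  have Wc [simp]: "W \<in> carrier_mat n n" using W by (simp add: unitary_matrix_def)
  have Dc [simp]: "?D \<in> carrier_mat n n" by simp
  note [simp] = mult_carrier_mat[of _ n n _ n] mult_carrier_mat[of _ r n _ n]
    mult_carrier_mat[of _ n r _ n] A
  define Y where "Y = A * W"
  have Yc [simp]: "Y \<in> carrier_mat r n" by (simp add: Y_def)
  have "mat_adjoint Y * Y = mat_adjoint W * ?H * W"
    by (simp add: Y_def mat_adjoint_mult[of _ r n _ n] assoc_mult_mat[of _ n n _ r _ n]
        assoc_mult_mat[of _ n r _ n _ n] assoc_mult_mat[of _ r n _ n _ n]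
        assoc_mult_mat[of _ n n _ n _ n])
  also have "\<dots> = (mat_adjoint W * W) * ?D * (mat_adjoint W * W)"
    unfolding W(2) by (simp only: assoc_mult_mat[of _ n n _ n _ n] mult_carrier_mat[of _ n n _ n]
        Wc Dc mat_adjoint_carrier)
  also have "\<dots> = ?D" using W(1) by (simp add: unitary_matrix_def)
  finally have D: "mat_adjoint Y * Y = ?D" .
  have ip: "(\<Sum>k<r. Y $$ (k, i) * cnj (Y $$ (k, j))) = (if i = j then of_real (xs ! i) else 0)"
    if "i < n" "j < n" for i j
  proof -
    have "(\<Sum>k<r. mat_adjoint Y $$ (j, k) * Y $$ (k, i)) = (mat_adjoint Y * Y) $$ (j, i)"
      by (rule mat_mult_index[of _ n r _ n, symmetric]) (use that in auto)
    also have "\<dots> = (if i = j then of_real (xs ! i) else 0)" using that og(2) by (auto simp: D)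
    also have "(\<Sum>k<r. mat_adjoint Y $$ (j, k) * Y $$ (k, i)) = (\<Sum>k<r. Y $$ (k, i) * cnj (Y $$ (k, j)))"
    proof (rule sum.cong)
      fix k assume "k \<in> {..<r}"
      then have "mat_adjoint Y $$ (j, k) = cnj (Y $$ (k, j))"
        using that carrier_matD[OF Yc] by (intro mat_adjoint_index) simp_all
      then show "mat_adjoint Y $$ (j, k) * Y $$ (k, i) = Y $$ (k, i) * cnj (Y $$ (k, j))"
        by (simp only: mult.commute)
    qed simp
    finally show ?thesis by (simp only:)
  qed
  \<comment> \<open>Zero columns cannot be normalised; their columns of \<open>U\<close> are arbitrary.\<close>
  define J where "J = {i. i < n \<and> xs ! i > 0}"
  define u0 where "u0 i k = Y $$ (k, i) / of_real (sqrt (xs ! i))" for i k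
  have "J \<subseteq> {..<r}" using \<open>n \<le> r\<close> by (auto simp: J_def)
  moreover have "(\<Sum>k<r. u0 i k * cnj (u0 j k)) = (if i = j then 1 else 0)" if "i \<in> J" "j \<in> J" for i j
  proof -
    have "(\<Sum>k<r. u0 i k * cnj (u0 j k)) =
        (\<Sum>k<r. Y $$ (k, i) * cnj (Y $$ (k, j))) / (of_real (sqrt (xs ! i)) * of_real (sqrt (xs ! j)))"
      by (simp add: u0_def sum_divide_distrib)
    also have "\<dots> = (if i = j then 1 else 0)"
      using that ip[of i j] by (simp add: J_def flip: of_real_mult)
    finally show ?thesis .
  qed
  ultimately obtain u where u: "\<And>i. i \<in> J \<Longrightarrow> u i = u0 i"
    "\<And>i j. i < r \<Longrightarrow> j < r \<Longrightarrow> (\<Sum>k<r. u i k * cnj (u j k)) = (if i = j then 1 else 0)"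
    using extend_orthonormal[of J r u0] by blast
  define U where "U = mat r r (\<lambda>(i, j). u j i)"
  have UU: "unitary_matrix r U" unfolding U_def by (rule unitary_matrix_of_orthonormal) (rule u)
  have Uc [simp]: "U \<in> carrier_mat r r" by (simp add: U_def)
  let ?S = "singular_value_matrix r n (\<lambda>i. xs ! i)"
  have Sc [simp]: "?S \<in> carrier_mat r n" by (simp add: singular_value_matrix_def)
  have "Y = U * ?S"
  proof (rule eq_matI)
    fix i j assume "i < dim_row (U * ?S)" "j < dim_col (U * ?S)"
    then have ij: "i < r" "j < n" by (auto simp: U_def singular_value_matrix_def)
    have "(U * ?S) $$ (i, j) = (\<Sum>k<r. U $$ (i, k) * ?S $$ (k, j))"
      by (rule mat_mult_index[of _ r r _ n]) (use ij in auto)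
    also have "\<dots> = (\<Sum>k<r. if k = j then u j i * of_real (sqrt (xs ! j)) else 0)"
      using ij by (intro sum.cong) (auto simp: U_def singular_value_matrix_def)
    also have "\<dots> = u j i * of_real (sqrt (xs ! j))" using ij \<open>n \<le> r\<close> by simp
    also have "\<dots> = Y $$ (i, j)"
    proof (cases "xs ! j > 0")
      case True
      then show ?thesis using ij by (simp add: u J_def u0_def)
    next
      case False
      then have z: "xs ! j = 0" using og(2,3) ij by (metis less_eq_real_def nth_mem)
      have "complex_of_real (\<Sum>k<r. (cmod (Y $$ (k, j)))\<^sup>2) = 0"
        using ip[of j j] ij z by (simp add: complex_norm_square del: of_real_power)
      then have "(\<Sum>k<r. (cmod (Y $$ (k, j)))\<^sup>2) = 0" by (simp only: of_real_eq_0_iff)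
      then have "Y $$ (i, j) = 0" using ij by (subst (asm) sum_nonneg_eq_0_iff) auto
      then show ?thesis by (simp add: z)
    qed
    finally show "Y $$ (i, j) = (U * ?S) $$ (i, j)" by simp
  qed (use Yc in \<open>auto simp: U_def singular_value_matrix_def simp del: Yc\<close>)
  moreover have "A = Y * mat_adjoint W"
    using W(1) by (simp add: Y_def assoc_mult_mat[of _ r n _ n _ n] unitary_matrix_def
        right_mult_one_mat[of _ r n])
  ultimately show ?thesis using UU unitary_matrix_adjoint[OF W(1)] by blast
qed

lemma ordered_eigenvalues_gram_unitary:
  assumes A: "A \<in> carrier_mat r n" and U: "unitary_matrix r U" and V: "unitary_matrix n V"
  shows "ordered_eigenvalues (mat_adjoint (U * A * V) * (U * A * V)) = ordered_eigenvalues (mat_adjoint A * A)"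
proof -
  have [simp]: "U \<in> carrier_mat r r" "V \<in> carrier_mat n n" and UV: "mat_adjoint U * U = 1\<^sub>m r"
    "mat_adjoint V * V = 1\<^sub>m n" "V * mat_adjoint V = 1\<^sub>m n"
    using U V by (auto simp: unitary_matrix_def)
  note [simp] = mult_carrier_mat[of _ n n _ n] mult_carrier_mat[of _ r n _ n] mult_carrier_mat[of _ r r _ n]
    mult_carrier_mat[of _ r r _ r] mult_carrier_mat[of _ n r _ r] mult_carrier_mat[of _ n r _ n] A
  note as = assoc_mult_mat[of _ n n _ r _ r] assoc_mult_mat[of _ n n _ r _ n] assoc_mult_mat[of _ n n _ n _ n]
    assoc_mult_mat[of _ n r _ n _ n] assoc_mult_mat[of _ r n _ n _ n] assoc_mult_mat[of _ n r _ r _ n]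
    assoc_mult_mat[of _ r r _ n _ n] assoc_mult_mat[of _ r r _ r _ n] assoc_mult_mat[of _ n r _ r _ r]
  have "mat_adjoint (U * A * V) * (U * A * V) = mat_adjoint V * (mat_adjoint A * ((mat_adjoint U * U) * A)) * V"
    by (simp add: mat_adjoint_mult[of _ r n _ n] mat_adjoint_mult[of _ r r _ n] as)
  also have "\<dots> = mat_adjoint V * (mat_adjoint A * A) * V"
    by (simp add: UV left_mult_one_mat[of A r n])
  finally have eq: "mat_adjoint (U * A * V) * (U * A * V) = mat_adjoint V * (mat_adjoint A * A) * V" .
  have "similar_mat_wit (mat_adjoint V * (mat_adjoint A * A) * V) (mat_adjoint A * A) (mat_adjoint V) V"
    by (rule similar_mat_witI[of _ _ n]) (simp_all add: UV)
  then have "char_poly (mat_adjoint V * (mat_adjoint A * A) * V) = char_poly (mat_adjoint A * A)"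
    by (intro char_poly_similar) (auto simp: similar_mat_def)
  then show ?thesis unfolding eq by (simp add: ordered_eigenvalues_def)
qed

section \<open>Eigenvalues depend measurably on the matrix\<close>

lemma pow_mat_diag:
  "mat n n (\<lambda>(i, j). if i = j then d i else 0) ^\<^sub>m q = mat n n (\<lambda>(i, j). if i = j then d i ^ q else (0 :: complex))"
proof (induction q)
  case (Suc q)
  show ?case
  proof (rule eq_matI)
    fix i j assume "i < dim_row (mat n n (\<lambda>(i, j). if i = j then d i ^ Suc q else 0))"
      "j < dim_col (mat n n (\<lambda>(i, j). if i = j then d i ^ Suc q else 0))"
    then have ij: "i < n" "j < n" by auto
    have "(mat n n (\<lambda>(i, j). if i = j then d i ^ q else 0) * mat n n (\<lambda>(i, j). if i = j then d i else 0)) $$ (i, j)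
        = (\<Sum>k<n. mat n n (\<lambda>(i, j). if i = j then d i ^ q else 0) $$ (i, k) * mat n n (\<lambda>(i, j). if i = j then d i else 0) $$ (k, j))"
      by (rule mat_mult_index[of _ n n _ n]) (use ij in auto)
    also have "\<dots> = (\<Sum>k<n. if k = j then (if i = j then d i ^ q * d i else 0) else 0)"
      by (intro sum.cong refl) (use ij in auto)
    also have "\<dots> = (if i = j then d i ^ Suc q else 0)" using ij by simp
    finally show "(mat n n (\<lambda>(i, j). if i = j then d i else 0) ^\<^sub>m Suc q) $$ (i, j) =
        mat n n (\<lambda>(i, j). if i = j then d i ^ Suc q else 0) $$ (i, j)"
      using ij Suc by simp
  qed auto
qed (auto intro!: eq_matI)

text \<open>This turns the power sums of the eigenvalues into polynomials in the matrix entries.\<close>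

lemma trace_gram_power:
  assumes A: "A \<in> carrier_mat r n"
  defines "xs \<equiv> ordered_eigenvalues (mat_adjoint A * A)"
  shows "(\<Sum>i<n. ((mat_adjoint A * A) ^\<^sub>m q) $$ (i, i)) = of_real (\<Sum>i<n. (xs ! i) ^ q)"
proof -
  let ?H = "mat_adjoint A * A"
  have H: "?H \<in> carrier_mat n n" using A by (intro mult_carrier_mat) auto
  have Hh: "mat_adjoint ?H = ?H" using A by (subst mat_adjoint_mult[of _ n r _ n]) auto
  note og = ordered_eigenvalues_gram[OF A, folded xs_def]
  have "char_poly ?H = (\<Prod>e\<leftarrow>map complex_of_real xs. [:- e, 1:])"
    using og(4) by (simp add: comp_def)
  from hermitian_diagonalisation[OF H Hh this] obtain W where W: "unitary_matrix n W"
    "?H = W * mat n n (\<lambda>(i, j). if i = j then map complex_of_real xs ! i else 0) * mat_adjoint W" (is "_ = _ * ?D * _")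
    by auto
  have Wc [simp]: "W \<in> carrier_mat n n" and WW: "mat_adjoint W * W = 1\<^sub>m n" "W * mat_adjoint W = 1\<^sub>m n"
    using W by (auto simp: unitary_matrix_def)
  have Dc [simp]: "?D \<in> carrier_mat n n" by simp
  have "similar_mat_wit ?H ?D W (mat_adjoint W)"
    by (rule similar_mat_witI[of _ _ n]) (use WW H W in simp_all)
  then have "similar_mat_wit (?H ^\<^sub>m q) (?D ^\<^sub>m q) W (mat_adjoint W)"
    by (rule similar_mat_wit_pow)
  moreover define E where "E = mat n n (\<lambda>(i, j). if i = j then (map complex_of_real xs ! i) ^ q else 0)"
  ultimately have Hq: "?H ^\<^sub>m q = W * E * mat_adjoint W"
    by (simp add: similar_mat_wit_def pow_mat_diag Let_def)
  have Ec [simp]: "E \<in> carrier_mat n n" by (simp add: E_def)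
  have "(\<Sum>i<n. (?H ^\<^sub>m q) $$ (i, i)) = (\<Sum>i<n. \<Sum>k<n. (W * E) $$ (i, k) * mat_adjoint W $$ (k, i))"
    unfolding Hq by (intro sum.cong refl mat_mult_index[OF mult_carrier_mat[OF Wc Ec] mat_adjoint_carrier[OF Wc]]) auto
  also have "\<dots> = (\<Sum>k<n. \<Sum>i<n. mat_adjoint W $$ (k, i) * (W * E) $$ (i, k))"
    by (subst sum.swap) (simp add: mult.commute)
  also have "\<dots> = (\<Sum>k<n. (mat_adjoint W * (W * E)) $$ (k, k))"
    by (intro sum.cong refl mat_mult_index[OF mat_adjoint_carrier[OF Wc] mult_carrier_mat[OF Wc Ec], symmetric]) auto
  also have "mat_adjoint W * (W * E) = E"
    by (simp add: assoc_mult_mat[of _ n n _ n _ n, symmetric] WW left_mult_one_mat[of _ n n])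
  also have "(\<Sum>k<n. E $$ (k, k)) = of_real (\<Sum>i<n. (xs ! i) ^ q)"
    using og(2) by (simp add: E_def)
  finally show ?thesis .
qed

lemma borel_measurable_pow_mat:
  fixes H :: "'a \<Rightarrow> complex mat"
  assumes H: "\<And>\<omega>. H \<omega> \<in> carrier_mat n n"
    and meas: "\<And>i j. i < n \<Longrightarrow> j < n \<Longrightarrow> (\<lambda>\<omega>. H \<omega> $$ (i, j)) \<in> borel_measurable M"
    and "i < n" "j < n"
  shows "(\<lambda>\<omega>. (H \<omega> ^\<^sub>m q) $$ (i, j)) \<in> borel_measurable M"
  using assms(3,4)
proof (induction q arbitrary: i j)
  case 0
  have "(H \<omega> ^\<^sub>m 0) $$ (i, j) = (if i = j then 1 else 0)" for \<omega>
    using 0 carrier_matD[OF H[of \<omega>]] by simp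
  then show ?case by simp
next
  case (Suc q)
  have "(H \<omega> ^\<^sub>m Suc q) $$ (i, j) = (\<Sum>k<n. (H \<omega> ^\<^sub>m q) $$ (i, k) * H \<omega> $$ (k, j))" for \<omega>
    unfolding pow_mat.simps using H Suc.prems by (intro mat_mult_index[of _ n n _ n]) auto
  then show ?case using Suc meas by (auto intro!: borel_measurable_sum borel_measurable_times)
qed

text \<open>The sum lies between \<open>x j ^ q\<close> and \<open>(j + 1) * x j ^ q\<close>, and the \<open>q\<close>-th root of \<open>j + 1\<close> tends to 1.\<close>

lemma root_power_sum_tendsto_top:
  fixes x :: "nat \<Rightarrow> real"
  assumes "\<And>i. i \<le> j \<Longrightarrow> 0 \<le> x i \<and> x i \<le> x j"
  shows "(\<lambda>q. root q (\<Sum>i\<le>j. x i ^ q)) \<longlonglongrightarrow> x j"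
proof (rule tendsto_sandwich)
  have nonneg: "0 \<le> x j" using assms by blast
  show "\<forall>\<^sub>F q in sequentially. x j \<le> root q (\<Sum>i\<le>j. x i ^ q)"
  proof (rule eventually_sequentiallyI[of 1])
    fix q :: nat assume "1 \<le> q"
    moreover have "x j ^ q \<le> (\<Sum>i\<le>j. x i ^ q)" using assms by (intro member_le_sum) auto
    ultimately have "root q (x j ^ q) \<le> root q (\<Sum>i\<le>j. x i ^ q)" by simp
    then show "x j \<le> root q (\<Sum>i\<le>j. x i ^ q)" using \<open>1 \<le> q\<close> nonneg by (simp add: real_root_power_cancel)
  qed
  show "\<forall>\<^sub>F q in sequentially. root q (\<Sum>i\<le>j. x i ^ q) \<le> root q (Suc j) * x j"
  proof (rule eventually_sequentiallyI[of 1])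
    fix q :: nat assume "1 \<le> q"
    moreover have "(\<Sum>i\<le>j. x i ^ q) \<le> (\<Sum>i\<le>j. x j ^ q)" using assms by (intro sum_mono power_mono) auto
    ultimately have "root q (\<Sum>i\<le>j. x i ^ q) \<le> root q (Suc j * x j ^ q)" by simp
    then show "root q (\<Sum>i\<le>j. x i ^ q) \<le> root q (Suc j) * x j"
      using \<open>1 \<le> q\<close> nonneg by (simp add: real_root_mult real_root_power_cancel)
  qed
  have "(\<lambda>q. root q (real (Suc j)) * x j) \<longlonglongrightarrow> 1 * x j"
    by (intro tendsto_mult LIMSEQ_root_const tendsto_const) simp
  then show "(\<lambda>q. root q (real (Suc j)) * x j) \<longlonglongrightarrow> x j" by simp
qed simp

text \<open>By induction from the largest eigenvalue downwards. Once the eigenvalues above position \<open>j\<close> are known to be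
measurable, subtracting their powers from the trace leaves the power sums of the first \<open>j + 1\<close> eigenvalues, whose \<open>q\<close>-th
roots converge to the eigenvalue in position \<open>j\<close>.\<close>

lemma borel_measurable_ordered_eigenvalues:
  assumes A: "\<And>\<omega>. A \<omega> \<in> carrier_mat r n"
    and meas [measurable]: "\<And>i j. i < r \<Longrightarrow> j < n \<Longrightarrow> (\<lambda>\<omega>. A \<omega> $$ (i, j)) \<in> borel_measurable M"
    and "j < n"
  shows "(\<lambda>\<omega>. ordered_eigenvalues (mat_adjoint (A \<omega>) * A \<omega>) ! j) \<in> borel_measurable M"
proof -
  define H where "H \<omega> = mat_adjoint (A \<omega>) * A \<omega>" for \<omega>
  define x where "x i \<omega> = ordered_eigenvalues (H \<omega>) ! i" for i \<omega>
  note og = ordered_eigenvalues_gram[OF A, folded H_def]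
  have Hc: "H \<omega> \<in> carrier_mat n n" for \<omega> unfolding H_def by (intro mult_carrier_mat[OF mat_adjoint_carrier[OF A] A])
  have H_meas: "(\<lambda>\<omega>. H \<omega> $$ (i, j)) \<in> borel_measurable M" if "i < n" "j < n" for i j
  proof -
    have "H \<omega> $$ (i, j) = (\<Sum>k<r. cnj (A \<omega> $$ (k, i)) * A \<omega> $$ (k, j))" for \<omega>
    proof -
      have "H \<omega> $$ (i, j) = (\<Sum>k<r. mat_adjoint (A \<omega>) $$ (i, k) * A \<omega> $$ (k, j))"
        unfolding H_def using that by (intro mat_mult_index[of _ n r _ n] mat_adjoint_carrier A)
      then show ?thesis using that carrier_matD[OF A[of \<omega>]] by simp
    qed
    moreover have "cnj \<in> borel_measurable borel" by (intro borel_measurable_continuous_onI continuous_intros)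
    ultimately show ?thesis using that meas
      by (auto intro!: borel_measurable_sum borel_measurable_times measurable_compose[where g = cnj])
  qed
  have power_sum: "(\<lambda>\<omega>. \<Sum>i<n. x i \<omega> ^ q) \<in> borel_measurable M" for q
  proof -
    have "(\<lambda>\<omega>. Re (\<Sum>i<n. (H \<omega> ^\<^sub>m q) $$ (i, i))) \<in> borel_measurable M"
    proof -
      have "(\<lambda>\<omega>. \<Sum>i<n. (H \<omega> ^\<^sub>m q) $$ (i, i)) \<in> borel_measurable M"
        by (rule borel_measurable_sum, rule borel_measurable_pow_mat[of H n, OF Hc H_meas]) auto
      then show ?thesis by (auto simp: borel_measurable_complex_iff)
    qed
    then show ?thesis unfolding H_def trace_gram_power[OF A] by (simp add: x_def H_def)
  qed
  have "x j \<in> borel_measurable M" using \<open>j < n\<close>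
  proof (induction "n - j" arbitrary: j rule: less_induct)
    case less
    have part: "(\<lambda>\<omega>. \<Sum>i\<le>j. x i \<omega> ^ q) \<in> borel_measurable M" for q
    proof -
      have "(\<Sum>i\<le>j. x i \<omega> ^ q) = (\<Sum>i<n. x i \<omega> ^ q) - (\<Sum>i\<in>{j<..<n}. x i \<omega> ^ q)" for \<omega>
      proof -
        have "(\<Sum>i<n. x i \<omega> ^ q) = (\<Sum>i\<in>{..j} \<union> {j<..<n}. x i \<omega> ^ q)"
          by (rule sum.cong) (use less.prems in auto)
        also have "\<dots> = (\<Sum>i\<le>j. x i \<omega> ^ q) + (\<Sum>i\<in>{j<..<n}. x i \<omega> ^ q)"
          by (rule sum.union_disjoint) auto
        finally show ?thesis by simp
      qed
      moreover have "(\<lambda>\<omega>. \<Sum>i\<in>{j<..<n}. x i \<omega> ^ q) \<in> borel_measurable M"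
        using less by (intro borel_measurable_sum borel_measurable_power less.hyps) auto
      ultimately show ?thesis using power_sum[of q] by simp
    qed
    have root_meas: "root q \<in> borel_measurable borel" for q
      by (intro borel_measurable_continuous_onI continuous_on_real_root continuous_on_id)
    show ?case
    proof (rule borel_measurable_LIMSEQ_real)
      show "(\<lambda>q. root q (\<Sum>i\<le>j. x i \<omega> ^ q)) \<longlonglongrightarrow> x j \<omega>" for \<omega>
      proof (rule root_power_sum_tendsto_top)
        fix i assume "i \<le> j"
        then show "0 \<le> x i \<omega> \<and> x i \<omega> \<le> x j \<omega>"
          using og(1-3)[of \<omega>] less.prems by (auto simp: x_def sorted_nth_mono)
      qed
      show "(\<lambda>\<omega>. root q (\<Sum>i\<le>j. x i \<omega> ^ q)) \<in> borel_measurable M" for q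
        using measurable_compose[OF part root_meas] by simp
    qed
  qed
  then show ?thesis by (simp add: x_def[abs_def] H_def)
qed

text \<open>The array \<open>f\<close> need not be confined to \<open>s\<close> rows: only its entries in the first \<open>s\<close> rows and \<open>N\<close>
columns count. In this way matrices of different heights are cut out of one array.\<close>

definition eigenvalue_vector :: "nat \<Rightarrow> nat \<Rightarrow> (nat \<times> nat \<Rightarrow> complex) \<Rightarrow> nat \<Rightarrow> real" where
  "eigenvalue_vector s N f = (\<lambda>j\<in>{1..N}. ordered_eigenvalues (mat_adjoint (mat s N f) * mat s N f) ! (j - 1))"

lemma eigenvalue_vector_cong:
  assumes "\<And>i j. i < s \<Longrightarrow> j < N \<Longrightarrow> f (i, j) = g (i, j)"
  shows "eigenvalue_vector s N f = eigenvalue_vector s N g"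
proof -
  have "mat s N f = mat s N g" using assms by (intro cong_mat) auto
  then show ?thesis by (simp add: eigenvalue_vector_def)
qed

lemma measurable_eigenvalue_vector:
  assumes "\<And>i j. i < s \<Longrightarrow> j < N \<Longrightarrow> (\<lambda>\<omega>. f \<omega> (i, j)) \<in> borel_measurable M"
  shows "(\<lambda>\<omega>. eigenvalue_vector s N (f \<omega>)) \<in> M \<rightarrow>\<^sub>M PiM {1..N} (\<lambda>_. borel)"
  unfolding eigenvalue_vector_def
proof (rule measurable_restrict)
  fix j assume "j \<in> {1..N}"
  then show "(\<lambda>\<omega>. ordered_eigenvalues (mat_adjoint (mat s N (f \<omega>)) * mat s N (f \<omega>)) ! (j - 1)) \<in> borel_measurable M"
    using assms by (intro borel_measurable_ordered_eigenvalues[of _ s N]) auto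
qed

section \<open>Characteristic functions determine finite-dimensional laws\<close>

text \<open>Levy's uniqueness theorem without normalisation: the value of the characteristic function at zero is the total mass,
so both measures can be rescaled to probability measures.\<close>

lemma finite_measure_char_eqI:
  fixes \<mu> \<nu> :: "real measure"
  assumes "finite_measure \<mu>" "finite_measure \<nu>"
    and sets [measurable_cong]: "sets \<mu> = sets borel" "sets \<nu> = sets borel"
    and char: "\<And>t. (\<integral>x. iexp (t * x) \<partial>\<mu>) = (\<integral>x. iexp (t * x) \<partial>\<nu>)"
  shows "\<mu> = \<nu>"
proof -
  interpret m: finite_measure \<mu> by fact
  interpret n: finite_measure \<nu> by fact
  have sp: "space \<mu> = UNIV" "space \<nu> = UNIV" using sets_eq_imp_space_eq[OF sets(1)] sets_eq_imp_space_eq[OF sets(2)] by auto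
  define c where "c = measure \<mu> UNIV"
  have "complex_of_real (measure \<mu> UNIV) = complex_of_real (measure \<nu> UNIV)"
    using char[of 0] sp by (simp add: scaleR_conv_of_real)
  then have c: "measure \<nu> UNIV = c" by (simp only: of_real_eq_iff c_def)
  show ?thesis
  proof (cases "c = 0")
    case True
    have "emeasure \<mu> A = 0" "emeasure \<nu> A = 0" for A
    proof -
      have "measure \<mu> A \<le> 0" "measure \<nu> A \<le> 0"
        using m.bounded_measure[of A] n.bounded_measure[of A] True c sp by (auto simp: c_def)
      then show "emeasure \<mu> A = 0" "emeasure \<nu> A = 0"
        by (auto simp: m.emeasure_eq_measure n.emeasure_eq_measure measure_le_0_iff)
    qed
    then show ?thesis by (intro measure_eqI) (auto simp: sets)
  next
    case False
    then have cpos: "c > 0" using measure_nonneg[of \<mu> UNIV] unfolding c_def by linarith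
    define \<mu>' where "\<mu>' = density \<mu> (\<lambda>_. ennreal (1 / c))"
    define \<nu>' where "\<nu>' = density \<nu> (\<lambda>_. ennreal (1 / c))"
    have em: "emeasure \<mu>' A = ennreal (1 / c) * emeasure \<mu> A" "emeasure \<nu>' A = ennreal (1 / c) * emeasure \<nu> A"
      if "A \<in> sets borel" for A
      using that unfolding \<mu>'_def \<nu>'_def by (auto simp: emeasure_density_const sets)
    have tot: "ennreal (1 / c) * ennreal c = 1"
      using cpos by (subst ennreal_mult[symmetric]) auto
    have "real_distribution \<mu>'"
      unfolding real_distribution_def real_distribution_axioms_def
    proof safe
      show "prob_space \<mu>'"
        using em(1)[of UNIV] tot by (intro prob_spaceI) (simp add: \<mu>'_def sp m.emeasure_eq_measure c_def)
    qed (auto simp: \<mu>'_def sets)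
    moreover have "real_distribution \<nu>'"
      unfolding real_distribution_def real_distribution_axioms_def
    proof safe
      show "prob_space \<nu>'"
        using em(2)[of UNIV] tot by (intro prob_spaceI) (simp add: \<nu>'_def sp n.emeasure_eq_measure c)
    qed (auto simp: \<nu>'_def sets)
    moreover have "char \<mu>' = char \<nu>'"
    proof
      fix t
      have "char \<mu>' t = (\<integral>x. (1 / c) *\<^sub>R iexp (t * x) \<partial>\<mu>)"
        unfolding char_def \<mu>'_def using cpos by (subst integral_density) auto
      also have "\<dots> = (\<integral>x. (1 / c) *\<^sub>R iexp (t * x) \<partial>\<nu>)" using char[of t] by (simp del: of_real_mult)
      also have "\<dots> = char \<nu>' t"
        unfolding char_def \<nu>'_def using cpos by (subst integral_density) auto
      finally show "char \<mu>' t = char \<nu>' t" .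
    qed
    ultimately have eq: "\<mu>' = \<nu>'" by (rule Levy_uniqueness)
    show ?thesis
    proof (rule measure_eqI)
      fix A assume "A \<in> sets \<mu>"
      then have A: "A \<in> sets borel" by (simp add: sets)
      have "ennreal c * (ennreal (1 / c) * emeasure \<mu> A) = ennreal c * (ennreal (1 / c) * emeasure \<nu> A)"
        using em(1)[OF A] em(2)[OF A] eq by simp
      then show "emeasure \<mu> A = emeasure \<nu> A"
        using tot by (simp add: mult.assoc[symmetric] mult.commute[of "ennreal c"])
    qed (simp add: sets)
  qed
qed

text \<open>Induction on the number of coordinates, by weighting with trigonometric functions of the old coordinates. For a
linear form \<open>s\<close> in the coordinates \<open>I\<close> and \<open>a \<in> {1, - \<i>}\<close> the weight \<open>2 + Re (a * exp (\<i> * s))\<close>, that is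
\<open>2 + cos s\<close> or \<open>2 + sin s\<close>, is bounded and positive, and the weighted law of
the new coordinate has a characteristic function that is a combination of three values of the given one. The
one-dimensional theorem therefore identifies it. Removing the constant 2 shows that, for each Borel set \<open>B\<close>, the
restrictions of the two measures to the event that the new coordinate lies in \<open>B\<close> have the same characteristic function in
the old coordinates, and the induction hypothesis applies to these.\<close>

lemma PiM_char_eqI:
  fixes \<mu> \<nu> :: "('i \<Rightarrow> real) measure"
  assumes "finite I" "finite_measure \<mu>" "finite_measure \<nu>"
    and "sets \<mu> = sets (PiM I (\<lambda>_. borel))" "sets \<nu> = sets (PiM I (\<lambda>_. borel))"
    and "\<And>\<theta>. (\<integral>z. iexp (\<Sum>x\<in>I. \<theta> x * z x) \<partial>\<mu>) = (\<integral>z. iexp (\<Sum>x\<in>I. \<theta> x * z x) \<partial>\<nu>)"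
  shows "\<mu> = \<nu>"
  using assms
proof (induction I arbitrary: \<mu> \<nu> rule: finite_induct)
  case empty
  interpret m: finite_measure \<mu> by fact
  interpret n: finite_measure \<nu> by fact
  have sets: "sets \<mu> = sets \<nu>" using empty by simp
  have "complex_of_real (measure \<mu> (space \<mu>)) = complex_of_real (measure \<nu> (space \<nu>))"
    using empty(5)[of "\<lambda>_. 0"] by (simp add: scaleR_conv_of_real)
  then have e: "emeasure \<mu> (space \<mu>) = emeasure \<nu> (space \<nu>)"
    by (simp only: of_real_eq_iff m.emeasure_eq_measure n.emeasure_eq_measure)
  show ?case
  proof (rule measure_eqI[OF sets])
    fix A assume "A \<in> sets \<mu>"
    then have "A = {} \<or> A = space \<mu>" using sets.sets_into_space[of A \<mu>]
      sets_eq_imp_space_eq[OF empty(3)] by (auto simp: space_PiM)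
    then show "emeasure \<mu> A = emeasure \<nu> A" using e sets_eq_imp_space_eq[OF sets] by auto
  qed
next
  case (insert x I)
  interpret m: finite_measure \<mu> by fact
  interpret n: finite_measure \<nu> by fact
  note sets [measurable_cong] = insert.prems(3,4)
  have sp: "space \<mu> = (\<Pi>\<^sub>E i\<in>insert x I. UNIV)" "space \<nu> = (\<Pi>\<^sub>E i\<in>insert x I. UNIV)"
    using sets_eq_imp_space_eq[OF sets(1)] sets_eq_imp_space_eq[OF sets(2)] by (auto simp: space_PiM)
  have meas [measurable]: "(\<lambda>z. \<Sum>y\<in>I. \<theta> y * z y) \<in> borel_measurable (PiM (insert x I) (\<lambda>_. borel))"
    "(\<lambda>z. \<Sum>y\<in>I. \<theta> y * z y) \<in> borel_measurable (PiM I (\<lambda>_. borel))" for \<theta> :: "'i \<Rightarrow> real"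
    by (auto intro!: borel_measurable_sum borel_measurable_times measurable_component_singleton)
  have meas_x [measurable]: "(\<lambda>z. z x) \<in> borel_measurable (PiM (insert x I) (\<lambda>_. borel :: real measure))"
    by (rule measurable_component_singleton) simp
  have meas_I [measurable]: "(\<lambda>z. restrict z I) \<in> PiM (insert x I) (\<lambda>_. borel :: real measure) \<rightarrow>\<^sub>M PiM I (\<lambda>_. borel)"
    by (rule measurable_restrict_subset) auto
  have char1: "(\<integral>z. iexp (t * z x + (\<Sum>y\<in>I. \<theta> y * z y)) \<partial>\<mu>) = (\<integral>z. iexp (t * z x + (\<Sum>y\<in>I. \<theta> y * z y)) \<partial>\<nu>)" for t \<theta>
  proof -
    have "(\<Sum>y\<in>I. (\<theta>(x := t)) y * z y) = (\<Sum>y\<in>I. \<theta> y * z y)" for z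
      using insert.hyps by (intro sum.cong) auto
    then show ?thesis using insert.prems(5)[of "\<theta>(x := t)"] insert.hyps by (simp del: of_real_add of_real_mult of_real_sum)
  qed
  have weighted: "(\<integral>z. indicator B (z x) * (2 + Re (a * iexp (\<Sum>y\<in>I. \<theta> y * z y))) \<partial>\<mu>) =
      (\<integral>z. indicator B (z x) * (2 + Re (a * iexp (\<Sum>y\<in>I. \<theta> y * z y))) \<partial>\<nu>)"
    if B: "B \<in> sets borel" and a: "cmod a \<le> 1" for a \<theta> B
  proof -
    \<comment> \<open>The constant 2 keeps the weight positive; it is removed again by taking \<open>a = 0\<close>.\<close>
    define w where "w z = 2 + Re (a * iexp (\<Sum>y\<in>I. \<theta> y * z y))" for z
    have w_meas [measurable]: "w \<in> borel_measurable (PiM (insert x I) (\<lambda>_. borel))"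
      unfolding w_def by measurable
    have w_bd: "0 \<le> w z" "w z \<le> 3" for z
    proof -
      have "\<bar>Re (a * iexp (\<Sum>y\<in>I. \<theta> y * z y))\<bar> \<le> cmod (a * iexp (\<Sum>y\<in>I. \<theta> y * z y))"
        by (rule abs_Re_le_cmod)
      also have "\<dots> \<le> 1" using a by (simp add: norm_mult del: of_real_sum)
      finally show "0 \<le> w z" "w z \<le> 3" by (auto simp: w_def)
    qed
    have key: "(\<integral>u. iexp (t * u) \<partial>distr (density \<kappa> w) borel (\<lambda>z. z x)) =
        2 * (\<integral>z. iexp (t * z x + (\<Sum>y\<in>I. 0 * z y)) \<partial>\<kappa>) + a / 2 * (\<integral>z. iexp (t * z x + (\<Sum>y\<in>I. \<theta> y * z y)) \<partial>\<kappa>)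
        + cnj a / 2 * (\<integral>z. iexp (t * z x + (\<Sum>y\<in>I. - \<theta> y * z y)) \<partial>\<kappa>)"
      and fin: "finite_measure (distr (density \<kappa> w) borel (\<lambda>z. z x))"
      and set_int: "measure (distr (density \<kappa> w) borel (\<lambda>z. z x)) B = (\<integral>z. indicator B (z x) * w z \<partial>\<kappa>)"
      if k: "finite_measure \<kappa>" and [measurable_cong]: "sets \<kappa> = sets (PiM (insert x I) (\<lambda>_. borel))" for \<kappa> t
    proof -
      interpret k: finite_measure \<kappa> by fact
      have int: "integrable \<kappa> (\<lambda>z. iexp (f z))" if [measurable]: "f \<in> borel_measurable \<kappa>" for f
        by (rule k.integrable_const_bound[of _ 1]) auto
      have "(\<integral>u. iexp (t * u) \<partial>distr (density \<kappa> w) borel (\<lambda>z. z x)) = (\<integral>z. w z *\<^sub>R iexp (t * z x) \<partial>\<kappa>)"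
        using w_bd by (subst integral_distr) (auto simp: integral_density)
      also have "\<dots> = (\<integral>z. 2 * iexp (t * z x + (\<Sum>y\<in>I. 0 * z y)) + a / 2 * iexp (t * z x + (\<Sum>y\<in>I. \<theta> y * z y))
        + cnj a / 2 * iexp (t * z x + (\<Sum>y\<in>I. - \<theta> y * z y)) \<partial>\<kappa>)"
      proof (rule Bochner_Integration.integral_cong[OF refl])
        fix z
        define s where "s = (\<Sum>y\<in>I. \<theta> y * z y)"
        have "complex_of_real (w z) = 2 + of_real (Re (a * iexp s))"
          by (simp only: w_def s_def of_real_add of_real_numeral)
        also have "complex_of_real (Re (a * iexp s)) = (a * iexp s + cnj (a * iexp s)) / 2"
          by (subst complex_add_cnj) simp
        also have "cnj (a * iexp s) = cnj a * iexp (- s)" by (simp add: exp_cnj)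
        finally have w: "complex_of_real (w z) = 2 + (a * iexp s + cnj a * iexp (- s)) / 2" .
        show "w z *\<^sub>R iexp (t * z x) = 2 * iexp (t * z x + (\<Sum>y\<in>I. 0 * z y)) + a / 2 * iexp (t * z x + (\<Sum>y\<in>I. \<theta> y * z y))
          + cnj a / 2 * iexp (t * z x + (\<Sum>y\<in>I. - \<theta> y * z y))"
        proof -
          have e: "iexp (t * z x + 0) = iexp (t * z x)" "iexp (t * z x + s) = iexp (t * z x) * iexp s"
            "iexp (t * z x + - s) = iexp (t * z x) * iexp (- s)"
            by (simp_all only: of_real_add distrib_left exp_add add_0_right of_real_0)
          have alg: "(2 + (a * E + cnj a * F) / 2) * X = 2 * X + a / 2 * (X * E) + cnj a / 2 * (X * F)" for E F X
            by (simp add: field_simps)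
          have sums: "(\<Sum>y\<in>I. 0 * z y) = 0" "(\<Sum>y\<in>I. \<theta> y * z y) = s" "(\<Sum>y\<in>I. - \<theta> y * z y) = - s"
            by (simp_all add: s_def sum_negf)
          show ?thesis unfolding sums e scaleR_conv_of_real w by (rule alg)
        qed
      qed
      also have "\<dots> = 2 * (\<integral>z. iexp (t * z x + (\<Sum>y\<in>I. 0 * z y)) \<partial>\<kappa>) + a / 2 * (\<integral>z. iexp (t * z x + (\<Sum>y\<in>I. \<theta> y * z y)) \<partial>\<kappa>)
        + cnj a / 2 * (\<integral>z. iexp (t * z x + (\<Sum>y\<in>I. - \<theta> y * z y)) \<partial>\<kappa>)"
      proof -
        have m: "(\<lambda>z. t * z x + (\<Sum>y\<in>I. \<phi> y * z y)) \<in> borel_measurable \<kappa>" for \<phi>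
          unfolding measurable_cong_sets[OF that(2) refl]
          by (intro borel_measurable_add borel_measurable_times borel_measurable_const meas_x meas)
        have i: "integrable \<kappa> (\<lambda>z. c * iexp (t * z x + (\<Sum>y\<in>I. \<phi> y * z y)))" for c \<phi>
          by (intro integrable_mult_right int m)
        show ?thesis
          by (simp only: Bochner_Integration.integral_add[OF Bochner_Integration.integrable_add[OF
                i[of 2 "\<lambda>_. 0"] i[of "a / 2" \<theta>]] i[of "cnj a / 2" "\<lambda>y. - \<theta> y"]]
              Bochner_Integration.integral_add[OF i[of 2 "\<lambda>_. 0"] i[of "a / 2" \<theta>]] integral_mult_right_zero)
      qed
      finally show "(\<integral>u. iexp (t * u) \<partial>distr (density \<kappa> w) borel (\<lambda>z. z x)) = \<dots>" .
      have em: "emeasure (distr (density \<kappa> w) borel (\<lambda>z. z x)) C = ennreal (\<integral>z. indicator C (z x) * w z \<partial>\<kappa>)"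
        if [measurable]: "C \<in> sets borel" for C
      proof -
        have "emeasure (distr (density \<kappa> w) borel (\<lambda>z. z x)) C = (\<integral>\<^sup>+z. indicator C (z x) * ennreal (w z) \<partial>\<kappa>)"
          by (subst emeasure_distr) (auto simp: emeasure_density intro!: nn_integral_cong split: split_indicator)
        also have "\<dots> = (\<integral>\<^sup>+z. ennreal (indicator C (z x) * w z) \<partial>\<kappa>)"
          by (intro nn_integral_cong) (auto split: split_indicator)
        also have "\<dots> = ennreal (\<integral>z. indicator C (z x) * w z \<partial>\<kappa>)"
          using w_bd by (intro nn_integral_eq_integral k.integrable_const_bound[of _ 3])
            (auto split: split_indicator)
        finally show ?thesis .
      qed
      show "finite_measure (distr (density \<kappa> w) borel (\<lambda>z. z x))"
        using em[of UNIV] by (intro finite_measureI) auto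
      show "measure (distr (density \<kappa> w) borel (\<lambda>z. z x)) B = (\<integral>z. indicator B (z x) * w z \<partial>\<kappa>)"
        using em[OF B] w_bd by (simp add: measure_def integral_nonneg_AE)
    qed
    have "distr (density \<mu> w) borel (\<lambda>z. z x) = distr (density \<nu> w) borel (\<lambda>z. z x)"
    proof (rule finite_measure_char_eqI)
      show "(\<integral>u. iexp (t * u) \<partial>distr (density \<mu> w) borel (\<lambda>z. z x)) =
          (\<integral>u. iexp (t * u) \<partial>distr (density \<nu> w) borel (\<lambda>z. z x))" for t
        unfolding key[OF insert.prems(1) sets(1)] key[OF insert.prems(2) sets(2)] char1 ..
    qed (use fin[OF insert.prems(1) sets(1)] fin[OF insert.prems(2) sets(2)] in auto)
    then show ?thesis
      using set_int[OF insert.prems(1) sets(1)] set_int[OF insert.prems(2) sets(2)] by (simp add: w_def)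
  qed
  show ?case
  proof (rule measure_eqI_PiM_finite[where A = "\<lambda>_. \<Pi>\<^sub>E i\<in>insert x I. UNIV" and I = "insert x I" and M = "\<lambda>_. borel"])
    show "finite (insert x I)" using insert by simp
    show "sets \<mu> = sets (PiM (insert x I) (\<lambda>_. borel))" "sets \<nu> = sets (PiM (insert x I) (\<lambda>_. borel))" by fact+
    show "range (\<lambda>_. \<Pi>\<^sub>E i\<in>insert x I. UNIV) \<subseteq> prod_algebra (insert x I) (\<lambda>_. borel :: real measure)"
      using space_in_prod_algebra[of "insert x I" "\<lambda>_. borel :: real measure"] by auto
    show "(\<Union>(i::nat). \<Pi>\<^sub>E i\<in>insert x I. UNIV) = space (PiM (insert x I) (\<lambda>_. borel :: real measure))"
      by (simp add: space_PiM)
    show "emeasure \<mu> (\<Pi>\<^sub>E i\<in>insert x I. UNIV) \<noteq> \<infinity>" by simp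
    fix A assume A: "\<And>i. i \<in> insert x I \<Longrightarrow> A i \<in> sets (borel :: real measure)"
    define B where "B = A x"
    have B [measurable]: "B \<in> sets borel" using A by (simp add: B_def)
    define sec where "sec \<kappa> = distr (density \<kappa> (\<lambda>z. indicator B (z x))) (PiM I (\<lambda>_. borel)) (\<lambda>z. restrict z I)"
      for \<kappa> :: "('i \<Rightarrow> real) measure"
    have em_sec: "emeasure (sec \<kappa>) C = emeasure \<kappa> {z \<in> space \<kappa>. z x \<in> B \<and> restrict z I \<in> C}"
      if [measurable_cong]: "sets \<kappa> = sets (PiM (insert x I) (\<lambda>_. borel))" and [measurable]: "C \<in> sets (PiM I (\<lambda>_. borel))" for \<kappa> C
    proof -
      have pre: "(\<lambda>z. restrict z I) -` C \<inter> space \<kappa> \<in> sets \<kappa>"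
        by (rule measurable_sets[of _ \<kappa> "PiM I (\<lambda>_. borel)"]) measurable
      have "emeasure (sec \<kappa>) C = emeasure (density \<kappa> (\<lambda>z. indicator B (z x))) ((\<lambda>z. restrict z I) -` C \<inter> space \<kappa>)"
        unfolding sec_def by (subst emeasure_distr) auto
      also have "\<dots> = (\<integral>\<^sup>+z. indicator B (z x) * indicator ((\<lambda>z. restrict z I) -` C \<inter> space \<kappa>) z \<partial>\<kappa>)"
        by (rule emeasure_density[OF _ pre]) measurable
      also have "\<dots> = (\<integral>\<^sup>+z. indicator {z \<in> space \<kappa>. z x \<in> B \<and> restrict z I \<in> C} z \<partial>\<kappa>)"
        by (intro nn_integral_cong) (auto split: split_indicator)
      finally have "emeasure (sec \<kappa>) C = (\<integral>\<^sup>+z. indicator {z \<in> space \<kappa>. z x \<in> B \<and> restrict z I \<in> C} z \<partial>\<kappa>)" .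
      moreover have "{z \<in> space \<kappa>. z x \<in> B \<and> restrict z I \<in> C} \<in> sets \<kappa>" by measurable
      ultimately show ?thesis by simp
    qed
    have "sec \<mu> = sec \<nu>"
    proof (rule insert.IH)
      show "finite_measure (sec \<mu>)"
        by (rule finite_measureI, subst em_sec) (auto simp: sets sec_def)
      show "finite_measure (sec \<nu>)"
        by (rule finite_measureI, subst em_sec) (auto simp: sets sec_def)
      show "sets (sec \<mu>) = sets (PiM I (\<lambda>_. borel))" "sets (sec \<nu>) = sets (PiM I (\<lambda>_. borel))"
        by (auto simp: sec_def)
      fix \<theta> :: "'i \<Rightarrow> real"
      let ?s = "\<lambda>z :: 'i \<Rightarrow> real. \<Sum>y\<in>I. \<theta> y * z y"
      have sec_int: "(\<integral>z. iexp (?s z) \<partial>sec \<kappa>) = (\<integral>z. indicator B (z x) *\<^sub>R iexp (?s z) \<partial>\<kappa>)"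
        and re: "Re (a * (\<integral>z. indicator B (z x) *\<^sub>R iexp (?s z) \<partial>\<kappa>)) =
          (\<integral>z. indicator B (z x) * (2 + Re (a * iexp (?s z))) \<partial>\<kappa>) - (\<integral>z. indicator B (z x) * (2 + Re (0 * iexp (?s z))) \<partial>\<kappa>)"
        if k: "finite_measure \<kappa>" and [measurable_cong]: "sets \<kappa> = sets (PiM (insert x I) (\<lambda>_. borel))" for \<kappa> a
      proof -
        interpret k: finite_measure \<kappa> by fact
        have ms: "?s \<in> borel_measurable \<kappa>"
          unfolding measurable_cong_sets[OF that(2) refl] by (rule meas)
        have [measurable]: "(\<lambda>z. iexp (?s z)) \<in> borel_measurable \<kappa>" using ms by measurable
        have "(\<integral>z. iexp (?s z) \<partial>sec \<kappa>) = (\<integral>z. iexp (?s (restrict z I)) \<partial>density \<kappa> (\<lambda>z. indicator B (z x)))"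
          unfolding sec_def by (subst integral_distr) auto
        also have "\<dots> = (\<integral>z. iexp (?s z) \<partial>density \<kappa> (\<lambda>z. ennreal (indicator B (z x))))"
          by (simp add: ennreal_indicator cong: sum.cong)
        also have "\<dots> = (\<integral>z. indicator B (z x) *\<^sub>R iexp (?s z) \<partial>\<kappa>)"
          by (subst integral_density) (auto simp del: of_real_sum)
        finally show "(\<integral>z. iexp (?s z) \<partial>sec \<kappa>) = (\<integral>z. indicator B (z x) *\<^sub>R iexp (?s z) \<partial>\<kappa>)" .
        have i1: "integrable \<kappa> (\<lambda>z. indicator B (z x) *\<^sub>R iexp (?s z))"
          by (rule k.integrable_const_bound[of _ 1]) (auto split: split_indicator simp del: of_real_sum)
        have i2: "integrable \<kappa> (\<lambda>z. indicator B (z x) * (2::real))"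
          by (rule k.integrable_const_bound[of _ 2]) (auto split: split_indicator)
        have i1a: "integrable \<kappa> (\<lambda>z. a * (indicator B (z x) *\<^sub>R iexp (?s z)))"
          by (intro integrable_mult_right i1)
        have "Re (a * (\<integral>z. indicator B (z x) *\<^sub>R iexp (?s z) \<partial>\<kappa>)) = Re (\<integral>z. a * (indicator B (z x) *\<^sub>R iexp (?s z)) \<partial>\<kappa>)"
          by (simp only: integral_mult_right_zero)
        also have "\<dots> = (\<integral>z. Re (a * (indicator B (z x) *\<^sub>R iexp (?s z))) \<partial>\<kappa>)"
          by (rule integral_Re[symmetric, OF i1a])
        also have "\<dots> = (\<integral>z. indicator B (z x) * Re (a * iexp (?s z)) \<partial>\<kappa>)"
          by (intro Bochner_Integration.integral_cong) (auto split: split_indicator simp del: of_real_sum)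
        finally have e: "Re (a * (\<integral>z. indicator B (z x) *\<^sub>R iexp (?s z) \<partial>\<kappa>)) = (\<integral>z. indicator B (z x) * Re (a * iexp (?s z)) \<partial>\<kappa>)" .
        have i3: "integrable \<kappa> (\<lambda>z. indicator B (z x) * Re (a * iexp (?s z)))"
        proof -
          have "integrable \<kappa> (\<lambda>z. Re (a * (indicator B (z x) *\<^sub>R iexp (?s z))))" by (rule integrable_Re[OF i1a])
          then show ?thesis by (rule Bochner_Integration.integrable_cong[THEN iffD1, rotated 2]) (auto split: split_indicator simp del: of_real_sum)
        qed
        show "Re (a * (\<integral>z. indicator B (z x) *\<^sub>R iexp (?s z) \<partial>\<kappa>)) =
          (\<integral>z. indicator B (z x) * (2 + Re (a * iexp (?s z))) \<partial>\<kappa>) - (\<integral>z. indicator B (z x) * (2 + Re (0 * iexp (?s z))) \<partial>\<kappa>)"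
          unfolding e using Bochner_Integration.integral_add[OF i2 i3] by (simp add: distrib_left del: of_real_sum)
      qed
      have re_eq: "Re (a * (\<integral>z. iexp (?s z) \<partial>sec \<mu>)) = Re (a * (\<integral>z. iexp (?s z) \<partial>sec \<nu>))" if "cmod a \<le> 1" for a
        unfolding sec_int[OF insert.prems(1) sets(1)] sec_int[OF insert.prems(2) sets(2)]
          re[OF insert.prems(1) sets(1)] re[OF insert.prems(2) sets(2)]
        using weighted[OF B that, of \<theta>] weighted[OF B, of 0 \<theta>] by simp
      show "(\<integral>z. iexp (?s z) \<partial>sec \<mu>) = (\<integral>z. iexp (?s z) \<partial>sec \<nu>)"
        \<comment> \<open>\<open>a = 1\<close> gives the real part and \<open>a = - \<i>\<close> the imaginary part.\<close>
        using re_eq[of 1] re_eq[of "- \<i>"] by (intro complex_eqI) (simp_all del: of_real_sum)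
    qed
    have C: "Pi\<^sub>E I A \<in> sets (PiM I (\<lambda>_. borel))" using A insert.hyps by (intro sets_PiM_I_finite) auto
    have "Pi\<^sub>E (insert x I) A = {z \<in> (\<Pi>\<^sub>E i\<in>insert x I. UNIV). z x \<in> B \<and> restrict z I \<in> Pi\<^sub>E I A}"
      using insert.hyps by (auto simp: B_def PiE_iff extensional_def)
    then show "emeasure \<mu> (Pi\<^sub>E (insert x I) A) = emeasure \<nu> (Pi\<^sub>E (insert x I) A)"
      using em_sec[OF sets(1) C] em_sec[OF sets(2) C] \<open>sec \<mu> = sec \<nu>\<close> sp by simp
  qed
qed

text \<open>The real case, applied to the real and imaginary parts of the coordinates.\<close>

lemma PiM_complex_char_eqI:
  fixes \<mu> \<nu> :: "('i \<Rightarrow> complex) measure"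
  assumes I: "finite I" and fin: "finite_measure \<mu>" "finite_measure \<nu>"
    and sets [measurable_cong]: "sets \<mu> = sets (PiM I (\<lambda>_. borel))" "sets \<nu> = sets (PiM I (\<lambda>_. borel))"
    and char: "\<And>\<theta>. (\<integral>z. iexp (\<Sum>x\<in>I. Re (cnj (\<theta> x) * z x)) \<partial>\<mu>) = (\<integral>z. iexp (\<Sum>x\<in>I. Re (cnj (\<theta> x) * z x)) \<partial>\<nu>)"
  shows "\<mu> = \<nu>"
proof -
  define T :: "('i \<Rightarrow> complex) \<Rightarrow> 'i + 'i \<Rightarrow> real"
    where "T z = (\<lambda>y\<in>I <+> I. case y of Inl x \<Rightarrow> Re (z x) | Inr x \<Rightarrow> Im (z x))" for z
  define S :: "('i + 'i \<Rightarrow> real) \<Rightarrow> 'i \<Rightarrow> complex"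
    where "S w = (\<lambda>x\<in>I. of_real (w (Inl x)) + \<i> * of_real (w (Inr x)))" for w
  have T [measurable]: "T \<in> PiM I (\<lambda>_. borel) \<rightarrow>\<^sub>M PiM (I <+> I) (\<lambda>_. borel)"
    unfolding T_def
  proof (rule measurable_restrict)
    fix y assume "y \<in> I <+> I"
    then show "(\<lambda>z. case y of Inl x \<Rightarrow> Re (z x) | Inr x \<Rightarrow> Im (z x)) \<in> PiM I (\<lambda>_. borel) \<rightarrow>\<^sub>M borel"
      by (auto intro!: borel_measurable_Re borel_measurable_Im measurable_component_singleton)
  qed
  have S [measurable]: "S \<in> PiM (I <+> I) (\<lambda>_. borel) \<rightarrow>\<^sub>M PiM I (\<lambda>_. borel)"
    unfolding S_def
  proof (rule measurable_restrict)
    fix x assume x: "x \<in> I"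
    have [measurable]: "(\<lambda>w. w (Inl x)) \<in> borel_measurable (PiM (I <+> I) (\<lambda>_. borel :: real measure))"
      "(\<lambda>w. w (Inr x)) \<in> borel_measurable (PiM (I <+> I) (\<lambda>_. borel :: real measure))"
      using x by (auto intro!: measurable_component_singleton)
    show "(\<lambda>w. of_real (w (Inl x)) + \<i> * of_real (w (Inr x))) \<in> PiM (I <+> I) (\<lambda>_. borel) \<rightarrow>\<^sub>M (borel :: complex measure)"
      by measurable
  qed
  have ST: "S (T z) = z" if "z \<in> space (PiM I (\<lambda>_. borel))" for z
    using that by (auto simp: S_def T_def space_PiM complex_eq_iff PiE_def extensional_def)
  have inverse: "distr (distr \<kappa> (PiM (I <+> I) (\<lambda>_. borel)) T) (PiM I (\<lambda>_. borel)) S = \<kappa>"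
    if [measurable_cong]: "sets \<kappa> = sets (PiM I (\<lambda>_. borel))" for \<kappa>
  proof -
    have "distr (distr \<kappa> (PiM (I <+> I) (\<lambda>_. borel)) T) (PiM I (\<lambda>_. borel)) S = distr \<kappa> (PiM I (\<lambda>_. borel)) (S \<circ> T)"
      by (rule distr_distr) measurable
    also have "\<dots> = distr \<kappa> \<kappa> (\<lambda>z. z)"
      using ST sets_eq_imp_space_eq[OF that] that by (intro distr_cong) auto
    finally show ?thesis by (simp add: distr_id2)
  qed
  have "distr \<mu> (PiM (I <+> I) (\<lambda>_. borel)) T = distr \<nu> (PiM (I <+> I) (\<lambda>_. borel)) T"
  proof (rule PiM_char_eqI)
    show "finite (I <+> I)" using I by simp
    show "finite_measure (distr \<mu> (PiM (I <+> I) (\<lambda>_. borel)) T)"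
      by (intro finite_measure.finite_measure_distr fin) measurable
    show "finite_measure (distr \<nu> (PiM (I <+> I) (\<lambda>_. borel)) T)"
      by (intro finite_measure.finite_measure_distr fin) measurable
    fix \<phi> :: "'i + 'i \<Rightarrow> real"
    define \<theta> where "\<theta> x = Complex (\<phi> (Inl x)) (\<phi> (Inr x))" for x
    have [measurable]: "(\<lambda>w. \<Sum>y\<in>I <+> I. \<phi> y * w y) \<in> borel_measurable (PiM (I <+> I) (\<lambda>_. borel))"
      by (auto intro!: borel_measurable_sum borel_measurable_times measurable_component_singleton)
    have sum: "(\<Sum>y\<in>I <+> I. \<phi> y * T z y) = (\<Sum>x\<in>I. Re (cnj (\<theta> x) * z x))" for z
      using I by (simp add: sum.Plus T_def \<theta>_def sum.distrib)
    have "(\<integral>w. iexp (\<Sum>y\<in>I <+> I. \<phi> y * w y) \<partial>distr \<kappa> (PiM (I <+> I) (\<lambda>_. borel)) T) =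
        (\<integral>z. iexp (\<Sum>x\<in>I. Re (cnj (\<theta> x) * z x)) \<partial>\<kappa>)"
      if [measurable_cong]: "sets \<kappa> = sets (PiM I (\<lambda>_. borel))" for \<kappa>
      by (subst integral_distr) (measurable, simp only: sum)
    then show "(\<integral>w. iexp (\<Sum>y\<in>I <+> I. \<phi> y * w y) \<partial>distr \<mu> (PiM (I <+> I) (\<lambda>_. borel)) T) =
        (\<integral>w. iexp (\<Sum>y\<in>I <+> I. \<phi> y * w y) \<partial>distr \<nu> (PiM (I <+> I) (\<lambda>_. borel)) T)"
      using char[of \<theta>] sets by simp
  qed auto
  then show ?thesis using inverse[OF sets(1)] inverse[OF sets(2)] by metis
qed

section \<open>Centred Gaussian arrays\<close>

text \<open>A family of centred, jointly Gaussian and circularly symmetric complex variables, described by its characteristic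
function. Entries at different positions \<open>p\<close> are independent. At a fixed position the entries for different
\<open>l\<close> have the real covariance matrix \<open>K p\<close>, normalised such that \<open>K p l l\<close> is the mean square of the modulus; this is
the origin of the constant 4, since the real and the imaginary part have half that variance each.\<close>

definition gaussian_array :: "'a measure \<Rightarrow> 'l set \<Rightarrow> 'p set \<Rightarrow> ('p \<Rightarrow> 'l \<Rightarrow> 'l \<Rightarrow> real) \<Rightarrow>
    ('l \<Rightarrow> 'p \<Rightarrow> 'a \<Rightarrow> complex) \<Rightarrow> bool" where
  "gaussian_array M L P K Y \<longleftrightarrow>
     (\<forall>l\<in>L. \<forall>p\<in>P. Y l p \<in> borel_measurable M) \<and>
     (\<forall>\<theta>. (\<integral>\<omega>. iexp (\<Sum>p\<in>P. \<Sum>l\<in>L. Re (cnj (\<theta> l p) * Y l p \<omega>)) \<partial>M) =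
        complex_of_real (exp (- (\<Sum>p\<in>P. \<Sum>l\<in>L. \<Sum>l'\<in>L. K p l l' * Re (cnj (\<theta> l p) * \<theta> l' p)) / 4)))"

definition array_law :: "'a measure \<Rightarrow> 'l set \<Rightarrow> 'p set \<Rightarrow> ('l \<Rightarrow> 'p \<Rightarrow> 'a \<Rightarrow> complex) \<Rightarrow> ('l \<times> 'p \<Rightarrow> complex) measure" where
  "array_law M L P Y = distr M (PiM (L \<times> P) (\<lambda>_. borel)) (\<lambda>\<omega>. \<lambda>(l, p)\<in>L \<times> P. Y l p \<omega>)"

lemma gaussian_array_entry_measurable:
  assumes "gaussian_array M L P K Y" "l \<in> L" "p \<in> P"
  shows "Y l p \<in> borel_measurable M"
  using assms unfolding gaussian_array_def by blast

lemma Re_of_real_mult: "Re (of_real x * z) = x * Re z"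
  by simp

lemma gaussian_array_measurable:
  assumes "gaussian_array M L P K Y"
  shows "(\<lambda>\<omega>. \<lambda>(l, p)\<in>L \<times> P. Y l p \<omega>) \<in> M \<rightarrow>\<^sub>M PiM (L \<times> P) (\<lambda>_. borel)"
  by (intro measurable_restrict) (auto intro: gaussian_array_entry_measurable[OF assms])

lemma gaussian_array_law_unique:
  fixes Y :: "'l \<Rightarrow> 'p \<Rightarrow> 'a \<Rightarrow> complex" and Y' :: "'l \<Rightarrow> 'p \<Rightarrow> 'b \<Rightarrow> complex"
  assumes fin: "finite L" "finite P" and prob: "prob_space M" "prob_space M'"
    and g: "gaussian_array M L P K Y" "gaussian_array M' L P K Y'"
  shows "array_law M L P Y = array_law M' L P Y'"
  unfolding array_law_def
proof (rule PiM_complex_char_eqI[of "L \<times> P"])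
  note m [measurable] = gaussian_array_measurable[OF g(1)] gaussian_array_measurable[OF g(2)]
  interpret M: prob_space M by fact
  interpret M': prob_space M' by fact
  show "finite_measure (distr M (PiM (L \<times> P) (\<lambda>_. borel)) (\<lambda>\<omega>. \<lambda>(l, p)\<in>L \<times> P. Y l p \<omega>))"
    "finite_measure (distr M' (PiM (L \<times> P) (\<lambda>_. borel)) (\<lambda>\<omega>. \<lambda>(l, p)\<in>L \<times> P. Y' l p \<omega>))"
    by (auto intro!: M.finite_measure_distr M'.finite_measure_distr m)
  fix \<theta> :: "'l \<times> 'p \<Rightarrow> complex"
  have [measurable]: "(\<lambda>z. \<Sum>x\<in>L \<times> P. Re (cnj (\<theta> x) * z x)) \<in> borel_measurable (PiM (L \<times> P) (\<lambda>_. borel))"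
    by (auto intro!: borel_measurable_sum borel_measurable_Re borel_measurable_times measurable_component_singleton)
  have sum: "(\<Sum>x\<in>L \<times> P. Re (cnj (\<theta> x) * (\<lambda>(l, p)\<in>L \<times> P. y l p) x)) = (\<Sum>p\<in>P. \<Sum>l\<in>L. Re (cnj (\<theta> (l, p)) * y l p))" for y
  proof -
    have "(\<Sum>x\<in>L \<times> P. Re (cnj (\<theta> x) * (\<lambda>(l, p)\<in>L \<times> P. y l p) x)) = (\<Sum>(l, p)\<in>L \<times> P. Re (cnj (\<theta> (l, p)) * y l p))"
      by (rule sum.cong) auto
    also have "\<dots> = (\<Sum>l\<in>L. \<Sum>p\<in>P. Re (cnj (\<theta> (l, p)) * y l p))" by (rule sum.cartesian_product[symmetric])
    finally show ?thesis by (simp only: sum.swap[of _ P L])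
  qed
  have "(\<integral>z. iexp (\<Sum>x\<in>L \<times> P. Re (cnj (\<theta> x) * z x)) \<partial>distr M (PiM (L \<times> P) (\<lambda>_. borel)) (\<lambda>\<omega>. \<lambda>(l, p)\<in>L \<times> P. Y l p \<omega>))
     = (\<integral>\<omega>. iexp (\<Sum>p\<in>P. \<Sum>l\<in>L. Re (cnj (\<theta> (l, p)) * Y l p \<omega>)) \<partial>M)"
    by (subst integral_distr) (measurable, simp only: sum)
  moreover have "(\<integral>z. iexp (\<Sum>x\<in>L \<times> P. Re (cnj (\<theta> x) * z x)) \<partial>distr M' (PiM (L \<times> P) (\<lambda>_. borel)) (\<lambda>\<omega>. \<lambda>(l, p)\<in>L \<times> P. Y' l p \<omega>))
     = (\<integral>\<omega>. iexp (\<Sum>p\<in>P. \<Sum>l\<in>L. Re (cnj (\<theta> (l, p)) * Y' l p \<omega>)) \<partial>M')"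
    by (subst integral_distr) (measurable, simp only: sum)
  ultimately show "(\<integral>z. iexp (\<Sum>x\<in>L \<times> P. Re (cnj (\<theta> x) * z x)) \<partial>distr M (PiM (L \<times> P) (\<lambda>_. borel)) (\<lambda>\<omega>. \<lambda>(l, p)\<in>L \<times> P. Y l p \<omega>))
     = (\<integral>z. iexp (\<Sum>x\<in>L \<times> P. Re (cnj (\<theta> x) * z x)) \<partial>distr M' (PiM (L \<times> P) (\<lambda>_. borel)) (\<lambda>\<omega>. \<lambda>(l, p)\<in>L \<times> P. Y' l p \<omega>))"
    using g unfolding gaussian_array_def by (simp only:)
qed (use fin in auto)

text \<open>Subtracting from each variable a multiple of the variable with index \<open>k\<close> at the same position changes the
covariance bilinearly. For a Brownian array and \<open>b p l = t l / t k\<close> this is the passage to the Brownian bridge.\<close>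

lemma gaussian_array_combine:
  fixes a b :: "'p \<Rightarrow> 'l \<Rightarrow> real"
  assumes g: "gaussian_array M L P K Y" and L: "finite L" "k \<in> L"
  shows "gaussian_array M L P
    (\<lambda>p l l'. a p l * a p l' * K p l l' - a p l * b p l' * K p l k - b p l * a p l' * K p k l' + b p l * b p l' * K p k k)
    (\<lambda>l p \<omega>. of_real (a p l) * Y l p \<omega> - of_real (b p l) * Y k p \<omega>)"
  unfolding gaussian_array_def
proof (intro conjI ballI allI)
  fix l p assume "l \<in> L" "p \<in> P"
  then show "(\<lambda>\<omega>. of_real (a p l) * Y l p \<omega> - of_real (b p l) * Y k p \<omega>) \<in> borel_measurable M"
    using L by (intro borel_measurable_diff borel_measurable_times borel_measurable_const gaussian_array_entry_measurable[OF g])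
next
  fix \<theta> :: "'l \<Rightarrow> 'p \<Rightarrow> complex"
  \<comment> \<open>Moving the combination to the frequencies: \<open>k\<close> collects the terms that were subtracted everywhere.\<close>
  define \<beta> where "\<beta> p = (\<Sum>l\<in>L. of_real (b p l) * \<theta> l p)" for p
  define \<theta>' where "\<theta>' l p = of_real (a p l) * \<theta> l p - (if l = k then \<beta> p else 0)" for l p
  have lin: "(\<Sum>l\<in>L. Re (cnj (\<theta> l p) * (of_real (a p l) * Y l p \<omega> - of_real (b p l) * Y k p \<omega>)))
     = (\<Sum>l\<in>L. Re (cnj (\<theta>' l p) * Y l p \<omega>))" for p \<omega>
  proof -
    have "(\<Sum>l\<in>L. cnj (\<theta>' l p) * Y l p \<omega>) = (\<Sum>l\<in>L. of_real (a p l) * cnj (\<theta> l p) * Y l p \<omega>)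
        - (\<Sum>l\<in>L. if l = k then cnj (\<beta> p) * Y k p \<omega> else 0)"
      unfolding sum_subtractf[symmetric] by (intro sum.cong) (auto simp: \<theta>'_def algebra_simps)
    also have "(\<Sum>l\<in>L. if l = k then cnj (\<beta> p) * Y k p \<omega> else 0) = (\<Sum>l\<in>L. of_real (b p l) * cnj (\<theta> l p) * Y k p \<omega>)"
      using L by (simp add: \<beta>_def sum_distrib_right)
    finally have "(\<Sum>l\<in>L. cnj (\<theta>' l p) * Y l p \<omega>) =
        (\<Sum>l\<in>L. cnj (\<theta> l p) * (of_real (a p l) * Y l p \<omega> - of_real (b p l) * Y k p \<omega>))"
      by (simp add: sum_subtractf[symmetric] algebra_simps)
    from arg_cong[OF this, of Re] show ?thesis by (simp only: Re_sum)
  qed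
  have quad: "(\<Sum>l\<in>L. \<Sum>l'\<in>L. K p l l' * Re (cnj (\<theta>' l p) * \<theta>' l' p)) =
    (\<Sum>l\<in>L. \<Sum>l'\<in>L. (a p l * a p l' * K p l l' - a p l * b p l' * K p l k - b p l * a p l' * K p k l' + b p l * b p l' * K p k k)
       * Re (cnj (\<theta> l p) * \<theta> l' p))" for p
  proof -
    have inner: "(\<Sum>l'\<in>L. of_real (K p l l') * \<theta>' l' p) = (\<Sum>l'\<in>L. of_real (a p l' * K p l l' - b p l' * K p l k) * \<theta> l' p)" for l
    proof -
      have "(\<Sum>l'\<in>L. of_real (K p l l') * \<theta>' l' p) = (\<Sum>l'\<in>L. of_real (a p l' * K p l l') * \<theta> l' p)
          - (\<Sum>l'\<in>L. if l' = k then of_real (K p l k) * \<beta> p else 0)"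
        unfolding sum_subtractf[symmetric] by (intro sum.cong) (auto simp: \<theta>'_def algebra_simps)
      also have "(\<Sum>l'\<in>L. if l' = k then of_real (K p l k) * \<beta> p else 0) = (\<Sum>l'\<in>L. of_real (b p l' * K p l k) * \<theta> l' p)"
        using L by (simp add: \<beta>_def sum_distrib_left algebra_simps)
      finally show ?thesis by (simp add: sum_subtractf[symmetric] algebra_simps)
    qed
    define G where "G l = (\<Sum>l'\<in>L. of_real (a p l' * K p l l' - b p l' * K p l k) * \<theta> l' p)" for l
    have "(\<Sum>l\<in>L. \<Sum>l'\<in>L. of_real (K p l l') * (cnj (\<theta>' l p) * \<theta>' l' p)) = (\<Sum>l\<in>L. cnj (\<theta>' l p) * G l)"
      unfolding G_def inner[symmetric] sum_distrib_left by (intro sum.cong) (auto simp: algebra_simps)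
    also have "\<dots> = (\<Sum>l\<in>L. of_real (a p l) * cnj (\<theta> l p) * G l) - (\<Sum>l\<in>L. if l = k then cnj (\<beta> p) * G k else 0)"
      unfolding sum_subtractf[symmetric] by (intro sum.cong) (auto simp: \<theta>'_def algebra_simps)
    also have "(\<Sum>l\<in>L. if l = k then cnj (\<beta> p) * G k else 0) = (\<Sum>l\<in>L. of_real (b p l) * cnj (\<theta> l p) * G k)"
      using L by (simp add: \<beta>_def sum_distrib_right)
    also have "(\<Sum>l\<in>L. of_real (a p l) * cnj (\<theta> l p) * G l) - (\<Sum>l\<in>L. of_real (b p l) * cnj (\<theta> l p) * G k) =
      (\<Sum>l\<in>L. \<Sum>l'\<in>L. of_real (a p l * a p l' * K p l l' - a p l * b p l' * K p l k - b p l * a p l' * K p k l' + b p l * b p l' * K p k k)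
       * (cnj (\<theta> l p) * \<theta> l' p))"
      unfolding G_def sum_distrib_left sum_subtractf[symmetric] by (intro sum.cong) (auto simp: algebra_simps)
    finally have "Re (\<Sum>l\<in>L. \<Sum>l'\<in>L. of_real (K p l l') * (cnj (\<theta>' l p) * \<theta>' l' p)) = Re \<dots>" by (rule arg_cong)
    then show ?thesis by (simp only: Re_sum Re_of_real_mult)
  qed
  show "(\<integral>\<omega>. iexp (\<Sum>p\<in>P. \<Sum>l\<in>L. Re (cnj (\<theta> l p) * (of_real (a p l) * Y l p \<omega> - of_real (b p l) * Y k p \<omega>))) \<partial>M) =
    complex_of_real (exp (- (\<Sum>p\<in>P. \<Sum>l\<in>L. \<Sum>l'\<in>L. (a p l * a p l' * K p l l' - a p l * b p l' * K p l k - b p l * a p l' * K p k l' + b p l * b p l' * K p k k)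
       * Re (cnj (\<theta> l p) * \<theta> l' p)) / 4))"
    using g unfolding lin quad[symmetric] gaussian_array_def by blast
qed

text \<open>The law is invariant under a unitary mixing \<open>T\<close> of positions that mixes only positions with the same
covariance. The first assumption on \<open>T\<close> is unitarity, the second says that \<open>T\<close> commutes with \<open>K\<close>.\<close>

lemma gaussian_array_rotate:
  fixes T :: "'p \<Rightarrow> 'p \<Rightarrow> complex" and Y :: "'l \<Rightarrow> 'p \<Rightarrow> 'a \<Rightarrow> complex"
  assumes g: "gaussian_array M L P K Y" and fin: "finite P"
    and T: "\<And>q q'. q \<in> P \<Longrightarrow> q' \<in> P \<Longrightarrow> (\<Sum>p\<in>P. T q p * cnj (T q' p)) = (if q = q' then 1 else 0)"
    and comm: "\<And>q p. q \<in> P \<Longrightarrow> p \<in> P \<Longrightarrow> T q p \<noteq> 0 \<Longrightarrow> K q = K p"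
  shows "gaussian_array M L P K (\<lambda>l q \<omega>. \<Sum>p\<in>P. T q p * Y l p \<omega>)"
  unfolding gaussian_array_def
proof (intro conjI ballI allI)
  fix l p assume "l \<in> L" "p \<in> P"
  then show "(\<lambda>\<omega>. \<Sum>q\<in>P. T p q * Y l q \<omega>) \<in> borel_measurable M"
    by (intro borel_measurable_sum borel_measurable_times borel_measurable_const gaussian_array_entry_measurable[OF g])
next
  fix \<theta> :: "'l \<Rightarrow> 'p \<Rightarrow> complex"
  define \<theta>' where "\<theta>' l p = (\<Sum>q\<in>P. cnj (T q p) * \<theta> l q)" for l p
  have lin: "(\<Sum>q\<in>P. \<Sum>l\<in>L. Re (cnj (\<theta> l q) * (\<Sum>p\<in>P. T q p * Y l p \<omega>))) =
      (\<Sum>p\<in>P. \<Sum>l\<in>L. Re (cnj (\<theta>' l p) * Y l p \<omega>))" for \<omega>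
  proof -
    have "(\<Sum>q\<in>P. cnj (\<theta> l q) * (\<Sum>p\<in>P. T q p * Y l p \<omega>)) = (\<Sum>p\<in>P. cnj (\<theta>' l p) * Y l p \<omega>)" for l
    proof -
      have "(\<Sum>q\<in>P. cnj (\<theta> l q) * (\<Sum>p\<in>P. T q p * Y l p \<omega>)) = (\<Sum>q\<in>P. \<Sum>p\<in>P. T q p * cnj (\<theta> l q) * Y l p \<omega>)"
        by (simp add: sum_distrib_left ac_simps)
      also have "\<dots> = (\<Sum>p\<in>P. \<Sum>q\<in>P. T q p * cnj (\<theta> l q) * Y l p \<omega>)" by (rule sum.swap)
      finally show ?thesis by (simp add: \<theta>'_def sum_distrib_right)
    qed
    from arg_cong[OF this, of Re] have "(\<Sum>q\<in>P. Re (cnj (\<theta> l q) * (\<Sum>p\<in>P. T q p * Y l p \<omega>))) =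
      (\<Sum>p\<in>P. Re (cnj (\<theta>' l p) * Y l p \<omega>))" for l by (simp only: Re_sum)
    then show ?thesis by (subst (1 2) sum.swap) (simp only:)
  qed
  have quad: "(\<Sum>p\<in>P. K p l l' * Re (cnj (\<theta>' l p) * \<theta>' l' p)) = (\<Sum>q\<in>P. K q l l' * Re (cnj (\<theta> l q) * \<theta> l' q))" for l l'
  proof -
    have "(\<Sum>p\<in>P. of_real (K p l l') * (cnj (\<theta>' l p) * \<theta>' l' p)) =
        (\<Sum>p\<in>P. \<Sum>q\<in>P. \<Sum>q'\<in>P. of_real (K p l l') * (T q p * cnj (\<theta> l q)) * (cnj (T q' p) * \<theta> l' q'))"
    proof -
      have "cnj (\<theta>' l p) = (\<Sum>q\<in>P. T q p * cnj (\<theta> l q))" for l p by (simp add: \<theta>'_def)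
      then have "cnj (\<theta>' l p) * \<theta>' l' p = (\<Sum>q\<in>P. \<Sum>q'\<in>P. T q p * cnj (\<theta> l q) * (cnj (T q' p) * \<theta> l' q'))" for p
        by (simp only:) (simp only: \<theta>'_def sum_product)
      then show ?thesis by (simp only: sum_distrib_left mult.assoc)
    qed
    also have "\<dots> = (\<Sum>q\<in>P. \<Sum>q'\<in>P. \<Sum>p\<in>P. of_real (K p l l') * (T q p * cnj (\<theta> l q)) * (cnj (T q' p) * \<theta> l' q'))"
      by (subst sum.swap, rule sum.cong[OF refl], rule sum.swap)
    also have "\<dots> = (\<Sum>q\<in>P. \<Sum>q'\<in>P. of_real (K q l l') * cnj (\<theta> l q) * \<theta> l' q' * (\<Sum>p\<in>P. T q p * cnj (T q' p)))"
    proof (intro sum.cong refl)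
      fix q q' assume q: "q \<in> P" "q' \<in> P"
      have "of_real (K p l l') * (T q p * cnj (\<theta> l q)) * (cnj (T q' p) * \<theta> l' q') =
        of_real (K q l l') * cnj (\<theta> l q) * \<theta> l' q' * (T q p * cnj (T q' p))" if "p \<in> P" for p
        using comm[OF q(1) that] by (cases "T q p = 0") auto
      then show "(\<Sum>p\<in>P. of_real (K p l l') * (T q p * cnj (\<theta> l q)) * (cnj (T q' p) * \<theta> l' q')) =
        of_real (K q l l') * cnj (\<theta> l q) * \<theta> l' q' * (\<Sum>p\<in>P. T q p * cnj (T q' p))"
        unfolding sum_distrib_left by (rule sum.cong[OF refl])
    qed
    also have "\<dots> = (\<Sum>q\<in>P. of_real (K q l l') * (cnj (\<theta> l q) * \<theta> l' q))"
    proof (intro sum.cong refl)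
      fix q assume q: "q \<in> P"
      have "(\<Sum>q'\<in>P. of_real (K q l l') * cnj (\<theta> l q) * \<theta> l' q' * (\<Sum>p\<in>P. T q p * cnj (T q' p))) =
        (\<Sum>q'\<in>P. if q' = q then of_real (K q l l') * (cnj (\<theta> l q) * \<theta> l' q) else 0)"
        using T q by (intro sum.cong refl) auto
      then show "(\<Sum>q'\<in>P. of_real (K q l l') * cnj (\<theta> l q) * \<theta> l' q' * (\<Sum>p\<in>P. T q p * cnj (T q' p))) =
        of_real (K q l l') * (cnj (\<theta> l q) * \<theta> l' q)"
        using q fin by simp
    qed
    finally have "Re (\<Sum>p\<in>P. of_real (K p l l') * (cnj (\<theta>' l p) * \<theta>' l' p)) = Re \<dots>" by (rule arg_cong)
    then show ?thesis by (simp only: Re_sum Re_of_real_mult)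
  qed
  have swap: "(\<Sum>p\<in>P. \<Sum>l\<in>L. \<Sum>l'\<in>L. F p l l') = (\<Sum>l\<in>L. \<Sum>l'\<in>L. \<Sum>p\<in>P. F p l l')" for F :: "'p \<Rightarrow> 'l \<Rightarrow> 'l \<Rightarrow> real"
    by (subst sum.swap, rule sum.cong[OF refl], rule sum.swap)
  have quad': "(\<Sum>p\<in>P. \<Sum>l\<in>L. \<Sum>l'\<in>L. K p l l' * Re (cnj (\<theta> l p) * \<theta> l' p)) =
     (\<Sum>p\<in>P. \<Sum>l\<in>L. \<Sum>l'\<in>L. K p l l' * Re (cnj (\<theta>' l p) * \<theta>' l' p))"
    unfolding swap quad ..
  show "(\<integral>\<omega>. iexp (\<Sum>q\<in>P. \<Sum>l\<in>L. Re (cnj (\<theta> l q) * (\<Sum>p\<in>P. T q p * Y l p \<omega>))) \<partial>M) =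
     complex_of_real (exp (- (\<Sum>p\<in>P. \<Sum>l\<in>L. \<Sum>l'\<in>L. K p l l' * Re (cnj (\<theta> l p) * \<theta> l' p)) / 4))"
    using g unfolding lin quad' gaussian_array_def by blast
qed

text \<open>Uncorrelated blocks are independent: the law does not change if the variables with index outside \<open>L1\<close> are taken
from a second, independent copy of the probability space.\<close>

lemma gaussian_array_decouple:
  fixes Y :: "'l \<Rightarrow> 'p \<Rightarrow> 'a \<Rightarrow> complex"
  assumes g: "gaussian_array M L P K Y" and "prob_space M"
    and block: "\<And>p l l'. p \<in> P \<Longrightarrow> l \<in> L \<Longrightarrow> l' \<in> L \<Longrightarrow> (l \<in> L1) \<noteq> (l' \<in> L1) \<Longrightarrow> K p l l' = 0"
  shows "gaussian_array (M \<Otimes>\<^sub>M M) L P K (\<lambda>l p (\<omega>, \<omega>'). if l \<in> L1 then Y l p \<omega> else Y l p \<omega>')"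
proof -
  interpret M: prob_space M by fact
  interpret MM: pair_prob_space M M ..
  have Y [measurable]: "Y l p \<in> borel_measurable M" if "l \<in> L" "p \<in> P" for l p
    using that by (rule gaussian_array_entry_measurable[OF g])
  show ?thesis
    unfolding gaussian_array_def
  proof (intro conjI ballI allI)
    fix l p assume [simp]: "l \<in> L" "p \<in> P"
    show "(\<lambda>(\<omega>, \<omega>'). if l \<in> L1 then Y l p \<omega> else Y l p \<omega>') \<in> borel_measurable (M \<Otimes>\<^sub>M M)"
      by (cases "l \<in> L1") (auto simp: case_prod_beta' intro!: measurable_compose[OF measurable_fst] measurable_compose[OF measurable_snd])
  next
    fix \<theta> :: "'l \<Rightarrow> 'p \<Rightarrow> complex"
    define \<theta>1 where "\<theta>1 l p = (if l \<in> L1 then \<theta> l p else 0)" for l p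
    define \<theta>2 where "\<theta>2 l p = (if l \<in> L1 then 0 else \<theta> l p)" for l p
    define S where "S \<phi> \<omega> = (\<Sum>p\<in>P. \<Sum>l\<in>L. Re (cnj (\<phi> l p) * Y l p \<omega>))" for \<phi> :: "'l \<Rightarrow> 'p \<Rightarrow> complex" and \<omega>
    define Q where "Q \<phi> = (\<Sum>p\<in>P. \<Sum>l\<in>L. \<Sum>l'\<in>L. K p l l' * Re (cnj (\<phi> l p) * \<phi> l' p))" for \<phi> :: "'l \<Rightarrow> 'p \<Rightarrow> complex"
    have S_meas [measurable]: "S \<phi> \<in> borel_measurable M" for \<phi>
      unfolding S_def by (intro borel_measurable_sum borel_measurable_Re borel_measurable_times) auto
    have char: "(\<integral>\<omega>. iexp (S \<phi> \<omega>) \<partial>M) = complex_of_real (exp (- Q \<phi> / 4))" for \<phi>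
      using g unfolding gaussian_array_def S_def Q_def by blast
    have split: "(\<Sum>p\<in>P. \<Sum>l\<in>L. Re (cnj (\<theta> l p) * (if l \<in> L1 then Y l p \<omega> else Y l p \<omega>'))) = S \<theta>1 \<omega> + S \<theta>2 \<omega>'" for \<omega> \<omega>'
      unfolding S_def sum.distrib[symmetric] by (intro sum.cong refl) (auto simp: \<theta>1_def \<theta>2_def)
    have "Q \<theta> = Q \<theta>1 + Q \<theta>2"
      unfolding Q_def sum.distrib[symmetric] using block by (intro sum.cong refl) (auto simp: \<theta>1_def \<theta>2_def)
    have "(\<integral>x. iexp (\<Sum>p\<in>P. \<Sum>l\<in>L. Re (cnj (\<theta> l p) * (case x of (\<omega>, \<omega>') \<Rightarrow> if l \<in> L1 then Y l p \<omega> else Y l p \<omega>'))) \<partial>(M \<Otimes>\<^sub>M M))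
        = (\<integral>(\<omega>, \<omega>'). iexp (S \<theta>1 \<omega>) * iexp (S \<theta>2 \<omega>') \<partial>(M \<Otimes>\<^sub>M M))"
      by (simp only: case_prod_beta' split of_real_add distrib_left exp_add)
    also have "\<dots> = (\<integral>\<omega>. \<integral>\<omega>'. iexp (S \<theta>1 \<omega>) * iexp (S \<theta>2 \<omega>') \<partial>M \<partial>M)"
      by (rule MM.integral_fst[symmetric], rule MM.integrable_const_bound[of _ 1]) (auto simp: norm_mult case_prod_beta')
    also have "\<dots> = (\<integral>\<omega>. iexp (S \<theta>1 \<omega>) \<partial>M) * (\<integral>\<omega>'. iexp (S \<theta>2 \<omega>') \<partial>M)"
      by simp
    also have "\<dots> = complex_of_real (exp (- Q \<theta> / 4))" unfolding char \<open>Q \<theta> = Q \<theta>1 + Q \<theta>2\<close>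
      by (simp only: of_real_mult[symmetric] exp_add[symmetric]) (simp add: add_divide_distrib)
    finally show "(\<integral>x. iexp (\<Sum>p\<in>P. \<Sum>l\<in>L. Re (cnj (\<theta> l p) * (case x of (\<omega>, \<omega>') \<Rightarrow> if l \<in> L1 then Y l p \<omega> else Y l p \<omega>'))) \<partial>(M \<Otimes>\<^sub>M M))
        = complex_of_real (exp (- (\<Sum>p\<in>P. \<Sum>l\<in>L. \<Sum>l'\<in>L. K p l l' * Re (cnj (\<theta> l p) * \<theta> l' p)) / 4))"
      unfolding Q_def .
  qed
qed

section \<open>Brownian motions at finitely many times\<close>

lemma (in prob_space) char_centered_normal:
  assumes D: "distributed M lborel D (normal_density 0 (sqrt v))" and v: "v > 0"
  shows "(\<integral>\<omega>. iexp (s * D \<omega>) \<partial>M) = complex_of_real (exp (- (s\<^sup>2 * v) / 2))"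
proof -
  let ?\<sigma> = "sqrt v"
  have \<sigma>: "?\<sigma> > 0" using v by simp
  have "distributed M lborel (\<lambda>\<omega>. (D \<omega> - 0) / ?\<sigma>) std_normal_density"
    using D normal_standard_normal_convert[OF \<sigma>, of D 0] by simp
  then have std: "distr M lborel (\<lambda>\<omega>. D \<omega> / ?\<sigma>) = std_normal_distribution"
    and [measurable]: "(\<lambda>\<omega>. D \<omega> / ?\<sigma>) \<in> borel_measurable M"
    by (auto simp: distributed_def)
  have "complex_of_real (exp (- ((s * ?\<sigma>)\<^sup>2) / 2)) = char std_normal_distribution (s * ?\<sigma>)"
    by (simp add: char_std_normal_distribution)
  also have "\<dots> = (\<integral>\<omega>. iexp (s * ?\<sigma> * (D \<omega> / ?\<sigma>)) \<partial>M)"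
    unfolding char_def std[symmetric] by (subst integral_distr) auto
  also have "\<dots> = (\<integral>\<omega>. iexp (s * D \<omega>) \<partial>M)" using \<sigma> by simp
  finally show ?thesis using v by (simp add: power_mult_distrib)
qed

text \<open>A linear combination of values of a Brownian motion is rewritten as a linear combination of its independent increments.
The quadratic form in the exponent becomes the covariance \<open>min (t l) (t l')\<close> because the minimum of two times is the
total length of the increments before both.\<close>

lemma brownian_motion_char:
  fixes t :: "nat \<Rightarrow> real"
  assumes "prob_space M" and W: "standard_brownian_motion M W"
    and t: "mono_on {1..n} t" "\<forall>l\<in>{1..n}. 0 \<le> t l"
  shows "(\<integral>\<omega>. iexp (\<Sum>l\<in>{1..n}. \<theta> l * W (t l) \<omega>) \<partial>M) =
    complex_of_real (exp (- (\<Sum>l\<in>{1..n}. \<Sum>l'\<in>{1..n}. min (t l) (t l') * (\<theta> l * \<theta> l')) / 2))"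
proof -
  interpret prob_space M by fact
  \<comment> \<open>Adding the time \<open>0\<close> in front makes each \<open>W (t l)\<close> a sum of increments, as \<open>W 0 = 0\<close> almost surely.\<close>
  define \<tau> where "\<tau> l = (if l = 0 then 0 else t l)" for l
  have \<tau>_mono: "\<tau> i \<le> \<tau> j" if "i \<le> j" "j \<le> n" for i j
    using t that by (auto simp: \<tau>_def mono_on_def)
  have \<tau>_step: "\<tau> i \<le> \<tau> (Suc i)" if "i < n" for i using \<tau>_mono that by simp
  have \<tau>_nonneg: "0 \<le> \<tau> i" if "i \<le> n" for i using \<tau>_mono[of 0 i] that by (simp add: \<tau>_def)
  define \<Delta> where "\<Delta> i \<omega> = W (\<tau> (Suc i)) \<omega> - W (\<tau> i) \<omega>" for i \<omega>
  define \<delta> where "\<delta> i = \<tau> (Suc i) - \<tau> i" for i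
  define s where "s i = (\<Sum>l\<in>{1..n}. if i < l then \<theta> l else 0)" for i
  have W_meas [measurable]: "W x \<in> borel_measurable M" if "0 \<le> x" for x
    using W that by (simp add: standard_brownian_motion_def)
  have W0: "AE \<omega> in M. W 0 \<omega> = 0" using W by (simp add: standard_brownian_motion_def)
  have \<Delta>_meas: "\<Delta> i \<in> borel_measurable M" if "i < n" for i
    unfolding \<Delta>_def using that by (intro borel_measurable_diff W_meas \<tau>_nonneg) auto
  have "0 \<le> \<tau> 0 \<longrightarrow> (\<forall>i<n. \<tau> i \<le> \<tau> (Suc i)) \<longrightarrow>
        indep_vars (\<lambda>_. borel) (\<lambda>i \<omega>. W (\<tau> (Suc i)) \<omega> - W (\<tau> i) \<omega>) {..<n}"
    using W unfolding standard_brownian_motion_def by blast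
  then have "indep_vars (\<lambda>_. borel) \<Delta> {..<n}" using \<tau>_step by (simp add: \<Delta>_def[abs_def] \<tau>_def)
  then have indep: "indep_vars (\<lambda>_. borel) (\<lambda>i \<omega>. iexp (s i * \<Delta> i \<omega>)) {..<n}"
    by (rule indep_vars_compose2[where Y = "\<lambda>i x. iexp (s i * x)"]) measurable
  have decomp: "AE \<omega> in M. iexp (\<Sum>l\<in>{1..n}. \<theta> l * W (t l) \<omega>) = (\<Prod>i<n. iexp (s i * \<Delta> i \<omega>))"
    using W0
  proof eventually_elim
    case (elim \<omega>)
    have "W (t l) \<omega> = (\<Sum>i<n. if i < l then \<Delta> i \<omega> else 0)" if "l \<in> {1..n}" for l
    proof -
      have "(\<Sum>i<n. if i < l then \<Delta> i \<omega> else 0) = (\<Sum>i<l. \<Delta> i \<omega>)"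
        using that by (subst sum.inter_filter[symmetric]) (auto intro: sum.cong)
      also have "\<dots> = W (\<tau> l) \<omega> - W (\<tau> 0) \<omega>" unfolding \<Delta>_def by (rule sum_lessThan_telescope)
      finally show ?thesis using that elim by (auto simp: \<tau>_def)
    qed
    then have "(\<Sum>l\<in>{1..n}. \<theta> l * W (t l) \<omega>) = (\<Sum>l\<in>{1..n}. \<Sum>i<n. if i < l then \<theta> l * \<Delta> i \<omega> else 0)"
      by (intro sum.cong) (auto simp: sum_distrib_left intro!: sum.cong)
    also have "\<dots> = (\<Sum>i<n. \<Sum>l\<in>{1..n}. if i < l then \<theta> l * \<Delta> i \<omega> else 0)" by (rule sum.swap)
    also have "\<dots> = (\<Sum>i<n. s i * \<Delta> i \<omega>)"
      by (auto simp: s_def sum_distrib_right intro!: sum.cong)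
    finally show ?case by (simp only: of_real_sum sum_distrib_left exp_sum finite_lessThan)
  qed
  have char_\<Delta>: "(\<integral>\<omega>. iexp (s i * \<Delta> i \<omega>) \<partial>M) = complex_of_real (exp (- ((s i)\<^sup>2 * \<delta> i) / 2))" if i: "i < n" for i
  \<comment> \<open>Equal consecutive times are possible, and then the increment is zero instead of normal.\<close>
  proof (cases "\<tau> i = \<tau> (Suc i)")
    case True
    then show ?thesis by (simp add: \<Delta>_def \<delta>_def prob_space)
  next
    case False
    then have lt: "\<tau> i < \<tau> (Suc i)" using \<tau>_step[OF i] by simp
    have "\<forall>s\<ge>0. \<forall>t>s. distributed M lborel (\<lambda>\<omega>. W t \<omega> - W s \<omega>) (normal_density 0 (sqrt (t - s)))"
      using W unfolding standard_brownian_motion_def by blast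
    then have "distributed M lborel (\<Delta> i) (normal_density 0 (sqrt (\<delta> i)))"
      using lt \<tau>_nonneg[of i] i unfolding \<Delta>_def[abs_def] \<delta>_def by simp
    then show ?thesis by (rule char_centered_normal) (use lt in \<open>simp add: \<delta>_def\<close>)
  qed
  have min_eq: "min (t l) (t l') = (\<Sum>i<n. if i < l \<and> i < l' then \<delta> i else 0)" if "l \<in> {1..n}" "l' \<in> {1..n}" for l l'
  proof -
    have "(\<Sum>i<n. if i < l \<and> i < l' then \<delta> i else 0) = (\<Sum>i<min l l'. \<delta> i)"
      using that by (subst sum.inter_filter[symmetric]) (auto intro: sum.cong)
    also have "\<dots> = \<tau> (min l l') - \<tau> 0" unfolding \<delta>_def by (rule sum_lessThan_telescope)
    also have "\<dots> = min (t l) (t l')"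
      using \<tau>_mono[of l l'] \<tau>_mono[of l' l] that by (auto simp: \<tau>_def min_def split: if_splits)
    finally show ?thesis by simp
  qed
  have quad: "(\<Sum>i<n. (s i)\<^sup>2 * \<delta> i) = (\<Sum>l\<in>{1..n}. \<Sum>l'\<in>{1..n}. min (t l) (t l') * (\<theta> l * \<theta> l'))"
  proof -
    have "(\<Sum>i<n. (s i)\<^sup>2 * \<delta> i) = (\<Sum>i<n. \<Sum>l\<in>{1..n}. \<Sum>l'\<in>{1..n}. (if i < l \<and> i < l' then \<delta> i else 0) * (\<theta> l * \<theta> l'))"
    proof (intro sum.cong refl)
      fix i
      have "(s i)\<^sup>2 = (\<Sum>l\<in>{1..n}. \<Sum>l'\<in>{1..n}. (if i < l then \<theta> l else 0) * (if i < l' then \<theta> l' else 0))"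
        by (simp only: s_def power2_eq_square sum_product)
      then show "(s i)\<^sup>2 * \<delta> i = (\<Sum>l\<in>{1..n}. \<Sum>l'\<in>{1..n}. (if i < l \<and> i < l' then \<delta> i else 0) * (\<theta> l * \<theta> l'))"
        by (simp only: sum_distrib_right) (intro sum.cong refl, auto)
    qed
    also have "\<dots> = (\<Sum>l\<in>{1..n}. \<Sum>i<n. \<Sum>l'\<in>{1..n}. (if i < l \<and> i < l' then \<delta> i else 0) * (\<theta> l * \<theta> l'))"
      by (rule sum.swap)
    also have "\<dots> = (\<Sum>l\<in>{1..n}. \<Sum>l'\<in>{1..n}. \<Sum>i<n. (if i < l \<and> i < l' then \<delta> i else 0) * (\<theta> l * \<theta> l'))"
      by (intro sum.cong refl sum.swap)
    also have "\<dots> = (\<Sum>l\<in>{1..n}. \<Sum>l'\<in>{1..n}. min (t l) (t l') * (\<theta> l * \<theta> l'))"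
      by (intro sum.cong refl) (simp only: min_eq sum_distrib_right)
    finally show ?thesis .
  qed
  have "(\<integral>\<omega>. iexp (\<Sum>l\<in>{1..n}. \<theta> l * W (t l) \<omega>) \<partial>M) = (\<integral>\<omega>. (\<Prod>i<n. iexp (s i * \<Delta> i \<omega>)) \<partial>M)"
  proof (rule integral_cong_AE[OF _ _ decomp])
    have "0 \<le> t l" if "l \<in> {1..n}" for l using \<tau>_nonneg[of l] that by (auto simp: \<tau>_def split: if_splits)
    then have "(\<lambda>\<omega>. \<Sum>l\<in>{1..n}. \<theta> l * W (t l) \<omega>) \<in> borel_measurable M"
      by (intro borel_measurable_sum borel_measurable_times borel_measurable_const W_meas) auto
    then show "(\<lambda>\<omega>. iexp (\<Sum>l\<in>{1..n}. \<theta> l * W (t l) \<omega>)) \<in> borel_measurable M" by measurable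
    have "(\<lambda>\<omega>. iexp (s i * \<Delta> i \<omega>)) \<in> borel_measurable M" if "i < n" for i
      using \<Delta>_meas[OF that] by measurable
    then show "(\<lambda>\<omega>. \<Prod>i<n. iexp (s i * \<Delta> i \<omega>)) \<in> borel_measurable M"
      by (intro borel_measurable_prod) auto
  qed
  also have "\<dots> = (\<Prod>i<n. \<integral>\<omega>. iexp (s i * \<Delta> i \<omega>) \<partial>M)"
  proof (rule indep_vars_lebesgue_integral[OF _ indep])
    show "integrable M (\<lambda>\<omega>. iexp (s i * \<Delta> i \<omega>))" if "i \<in> {..<n}" for i
      using \<Delta>_meas[of i] that by (intro integrable_iexp) auto
  qed simp
  also have "\<dots> = (\<Prod>i<n. complex_of_real (exp (- ((s i)\<^sup>2 * \<delta> i) / 2)))"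
    by (intro prod.cong refl char_\<Delta>) simp
  also have "\<dots> = complex_of_real (exp (\<Sum>i<n. - ((s i)\<^sup>2 * \<delta> i) / 2))"
    by (simp add: exp_sum del: exp_of_real)
  also have "(\<Sum>i<n. - ((s i)\<^sup>2 * \<delta> i) / 2) = - (\<Sum>i<n. (s i)\<^sup>2 * \<delta> i) / 2"
    by (simp add: sum_negf sum_divide_distrib)
  finally show ?thesis unfolding quad .
qed

text \<open>The real and the imaginary part each contribute half of the Hermitian form, since both are scaled by \<open>1 / sqrt 2\<close>.\<close>

lemma complex_brownian_motion_char:
  fixes t :: "nat \<Rightarrow> real"
  assumes "prob_space M" and Z: "complex_brownian_motion M Z"
    and t: "mono_on {1..n} t" "\<forall>l\<in>{1..n}. 0 \<le> t l"
  shows "(\<integral>\<omega>. iexp (\<Sum>l\<in>{1..n}. Re (cnj (\<theta> l) * Z (t l) \<omega>)) \<partial>M) =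
    complex_of_real (exp (- (\<Sum>l\<in>{1..n}. \<Sum>l'\<in>{1..n}. min (t l) (t l') * Re (cnj (\<theta> l) * \<theta> l')) / 4))"
proof -
  interpret prob_space M by fact
  have t_nonneg: "0 \<le> t l" if "l \<in> {1..n}" for l using t(2) that by blast
  obtain b b' where b: "standard_brownian_motion M b" "standard_brownian_motion M b'"
    and indep: "indep_var path_space (sample_path b) path_space (sample_path b')"
    and Z_eq: "\<And>u \<omega>. 0 \<le> u \<Longrightarrow> \<omega> \<in> space M \<Longrightarrow> Z u \<omega> = 1 / complex_of_real (sqrt 2) * complex_of_real (b u \<omega>)
                  + \<i> / complex_of_real (sqrt 2) * complex_of_real (b' u \<omega>)"
    using Z unfolding complex_brownian_motion_def by blast
  define S where "S \<phi> w = (\<Sum>l\<in>{1..n}. \<phi> l * w (t l))" for \<phi> :: "nat \<Rightarrow> real" and w :: "real \<Rightarrow> real"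
  have S_meas: "(\<lambda>w. iexp (S \<phi> w)) \<in> borel_measurable path_space" for \<phi>
  proof -
    have "S \<phi> \<in> borel_measurable path_space"
      unfolding S_def by (intro borel_measurable_sum borel_measurable_times borel_measurable_const
          measurable_component_singleton) (use t_nonneg in auto)
    then show ?thesis by measurable
  qed
  have S_path: "S \<phi> (sample_path w \<omega>) = (\<Sum>l\<in>{1..n}. \<phi> l * w (t l) \<omega>)" for \<phi> w and \<omega> :: 'a
    unfolding S_def by (intro sum.cong refl) (use t_nonneg in \<open>simp add: sample_path_def\<close>)
  define \<phi>1 where "\<phi>1 l = Re (\<theta> l) / sqrt 2" for l
  define \<phi>2 where "\<phi>2 l = Im (\<theta> l) / sqrt 2" for l
  have ind: "indep_var borel (\<lambda>\<omega>. iexp (S \<phi>1 (sample_path b \<omega>))) borel (\<lambda>\<omega>. iexp (S \<phi>2 (sample_path b' \<omega>)))"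
    using indep_var_compose[OF indep S_meas[of \<phi>1] S_meas[of \<phi>2]] by (simp add: comp_def)
  have meas: "(\<lambda>\<omega>. iexp (S \<phi>1 (sample_path b \<omega>))) \<in> borel_measurable M"
    "(\<lambda>\<omega>. iexp (S \<phi>2 (sample_path b' \<omega>))) \<in> borel_measurable M"
    using indep_var_rv1[OF ind] indep_var_rv2[OF ind] by auto
  have "(\<integral>\<omega>. iexp (\<Sum>l\<in>{1..n}. Re (cnj (\<theta> l) * Z (t l) \<omega>)) \<partial>M) =
     (\<integral>\<omega>. iexp (S \<phi>1 (sample_path b \<omega>)) * iexp (S \<phi>2 (sample_path b' \<omega>)) \<partial>M)"
  proof (rule Bochner_Integration.integral_cong[OF refl])
    fix \<omega> assume \<omega>: "\<omega> \<in> space M"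
    have "Re (cnj (\<theta> l) * Z (t l) \<omega>) = \<phi>1 l * b (t l) \<omega> + \<phi>2 l * b' (t l) \<omega>" if "l \<in> {1..n}" for l
      using Z_eq[OF t_nonneg[OF that] \<omega>] by (simp add: \<phi>1_def \<phi>2_def Re_divide_of_real Im_divide_of_real)
    then have "(\<Sum>l\<in>{1..n}. Re (cnj (\<theta> l) * Z (t l) \<omega>)) = S \<phi>1 (sample_path b \<omega>) + S \<phi>2 (sample_path b' \<omega>)"
      by (simp add: S_path sum.distrib del: times_complex.sel)
    then show "iexp (\<Sum>l\<in>{1..n}. Re (cnj (\<theta> l) * Z (t l) \<omega>)) = iexp (S \<phi>1 (sample_path b \<omega>)) * iexp (S \<phi>2 (sample_path b' \<omega>))"
      by (simp only: of_real_add distrib_left exp_add)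
  qed
  also have "\<dots> = (\<integral>\<omega>. iexp (S \<phi>1 (sample_path b \<omega>)) \<partial>M) * (\<integral>\<omega>. iexp (S \<phi>2 (sample_path b' \<omega>)) \<partial>M)"
    by (rule indep_var_lebesgue_integral[OF ind]; rule integrable_const_bound[of _ 1]) (auto simp: meas)
  also have "\<dots> = complex_of_real (exp (- (\<Sum>l\<in>{1..n}. \<Sum>l'\<in>{1..n}. min (t l) (t l') * (\<phi>1 l * \<phi>1 l')) / 2
      - (\<Sum>l\<in>{1..n}. \<Sum>l'\<in>{1..n}. min (t l) (t l') * (\<phi>2 l * \<phi>2 l')) / 2))"
    unfolding S_path brownian_motion_char[where t = t and n = n, OF \<open>prob_space M\<close> b(1) t]
      brownian_motion_char[where t = t and n = n, OF \<open>prob_space M\<close> b(2) t]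
    by (simp only: of_real_mult[symmetric] exp_add[symmetric]) simp
  also have "- (\<Sum>l\<in>{1..n}. \<Sum>l'\<in>{1..n}. min (t l) (t l') * (\<phi>1 l * \<phi>1 l')) / 2
      - (\<Sum>l\<in>{1..n}. \<Sum>l'\<in>{1..n}. min (t l) (t l') * (\<phi>2 l * \<phi>2 l')) / 2 =
    - (\<Sum>l\<in>{1..n}. \<Sum>l'\<in>{1..n}. min (t l) (t l') * Re (cnj (\<theta> l) * \<theta> l')) / 4"
  proof -
    have "(\<Sum>l\<in>{1..n}. \<Sum>l'\<in>{1..n}. min (t l) (t l') * (\<phi>1 l * \<phi>1 l')) + (\<Sum>l\<in>{1..n}. \<Sum>l'\<in>{1..n}. min (t l) (t l') * (\<phi>2 l * \<phi>2 l'))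
      = (\<Sum>l\<in>{1..n}. \<Sum>l'\<in>{1..n}. min (t l) (t l') * Re (cnj (\<theta> l) * \<theta> l')) / 2"
      unfolding sum.distrib[symmetric] sum_divide_distrib
      by (intro sum.cong refl) (simp add: \<phi>1_def \<phi>2_def field_simps)
    then show ?thesis by (simp add: field_simps)
  qed
  finally show ?thesis .
qed

lemma brownian_array_gaussian:
  fixes t :: "nat \<Rightarrow> real"
  assumes "prob_space M" and B: "iid_complex_brownian_motions M B"
    and t: "mono_on {1..n} t" "\<forall>l\<in>{1..n}. 0 \<le> t l" and P: "finite P"
  shows "gaussian_array M {1..n} P (\<lambda>p l l'. min (t l) (t l'))
    (\<lambda>l p \<omega>. B (Suc (fst p)) (Suc (snd p)) (t l) \<omega>)"
proof -
  interpret prob_space M by fact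
  have t_nonneg: "0 \<le> t l" if "l \<in> {1..n}" for l using t(2) that by blast
  \<comment> \<open>The Brownian motions are indexed from 1 and array positions from 0.\<close>
  define sh where "sh p = (Suc (fst p), Suc (snd p))" for p :: "nat \<times> nat"
  have inj: "inj_on sh P" by (auto simp: sh_def inj_on_def prod_eq_iff)
  have cbm: "complex_brownian_motion M (B (Suc i) (Suc j))" for i j
    using B by (simp add: iid_complex_brownian_motions_def)
  have ind0: "indep_vars (\<lambda>_. path_space) (\<lambda>(i, j). sample_path (B i j)) ({1..} \<times> {1..})"
    using B by (simp add: iid_complex_brownian_motions_def)
  have path_meas: "sample_path (B (Suc i) (Suc j)) \<in> M \<rightarrow>\<^sub>M path_space" for i j
    using ind0 by (auto simp: indep_vars_def)
  show ?thesis
    unfolding gaussian_array_def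
  proof (intro conjI ballI allI)
    fix l p assume l: "l \<in> {1..n}"
    have "(\<lambda>\<omega>. sample_path (B (Suc (fst p)) (Suc (snd p))) \<omega> (t l)) \<in> borel_measurable M"
      by (rule measurable_compose[OF path_meas measurable_component_singleton]) (use t_nonneg[OF l] in simp)
    then show "(\<lambda>\<omega>. B (Suc (fst p)) (Suc (snd p)) (t l) \<omega>) \<in> borel_measurable M"
      using t_nonneg[OF l] by (simp add: sample_path_def)
  next
    fix \<theta> :: "nat \<Rightarrow> nat \<times> nat \<Rightarrow> complex"
    define S where "S p w = (\<Sum>l\<in>{1..n}. Re (cnj (\<theta> l p) * w (t l)))" for p and w :: "real \<Rightarrow> complex"
    have S_meas: "(\<lambda>w. iexp (S p w)) \<in> borel_measurable path_space" for p
    proof -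
      have "(\<lambda>w. cnj (\<theta> l p) * w (t l)) \<in> borel_measurable path_space" if "l \<in> {1..n}" for l
        by (intro borel_measurable_times borel_measurable_const measurable_component_singleton)
          (use t_nonneg that in auto)
      then have "S p \<in> borel_measurable path_space"
        unfolding S_def by (intro borel_measurable_sum) (simp add: borel_measurable_complex_iff)
      then show ?thesis by measurable
    qed
    define F where "F q \<omega> = iexp (S (fst q - 1, snd q - 1) (sample_path (B (fst q) (snd q)) \<omega>))" for q \<omega>
    have F_sh: "F (sh p) \<omega> = iexp (\<Sum>l\<in>{1..n}. Re (cnj (\<theta> l p) * B (Suc (fst p)) (Suc (snd p)) (t l) \<omega>))" for p \<omega>
    proof -
      have "S p (sample_path (B (Suc (fst p)) (Suc (snd p))) \<omega>) = (\<Sum>l\<in>{1..n}. Re (cnj (\<theta> l p) * B (Suc (fst p)) (Suc (snd p)) (t l) \<omega>))"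
        unfolding S_def by (intro sum.cong refl) (use t_nonneg in \<open>simp add: sample_path_def\<close>)
      then show ?thesis by (simp add: F_def sh_def)
    qed
    have "indep_vars (\<lambda>_. path_space) (\<lambda>(i, j). sample_path (B i j)) (sh ` P)"
      by (rule indep_vars_subset[OF ind0]) (auto simp: sh_def)
    then have ind: "indep_vars (\<lambda>_. borel) F (sh ` P)"
      using indep_vars_compose2[where Y = "\<lambda>q w. iexp (S (fst q - 1, snd q - 1) w)", of "\<lambda>_. path_space" _ "sh ` P" "\<lambda>_. borel"] S_meas
      by (simp add: F_def[abs_def] case_prod_beta')
    have "(\<integral>\<omega>. iexp (\<Sum>p\<in>P. \<Sum>l\<in>{1..n}. Re (cnj (\<theta> l p) * B (Suc (fst p)) (Suc (snd p)) (t l) \<omega>)) \<partial>M)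
       = (\<integral>\<omega>. (\<Prod>q\<in>sh ` P. F q \<omega>) \<partial>M)"
    proof (rule Bochner_Integration.integral_cong[OF refl])
      fix \<omega>
      have "iexp (\<Sum>p\<in>P. \<Sum>l\<in>{1..n}. Re (cnj (\<theta> l p) * B (Suc (fst p)) (Suc (snd p)) (t l) \<omega>)) = (\<Prod>p\<in>P. F (sh p) \<omega>)"
        unfolding F_sh by (subst of_real_sum) (simp only: sum_distrib_left exp_sum[OF P])
      then show "iexp (\<Sum>p\<in>P. \<Sum>l\<in>{1..n}. Re (cnj (\<theta> l p) * B (Suc (fst p)) (Suc (snd p)) (t l) \<omega>)) = (\<Prod>q\<in>sh ` P. F q \<omega>)"
        by (simp only: prod.reindex[OF inj] comp_def)
    qed
    also have "\<dots> = (\<Prod>q\<in>sh ` P. \<integral>\<omega>. F q \<omega> \<partial>M)"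
    proof (rule indep_vars_lebesgue_integral[OF _ ind])
      show "integrable M (F q)" if "q \<in> sh ` P" for q
        by (rule integrable_const_bound[of _ 1]) (use ind that in \<open>auto simp: F_def indep_vars_def\<close>)
    qed (use P in simp)
    also have "\<dots> = (\<Prod>p\<in>P. \<integral>\<omega>. F (sh p) \<omega> \<partial>M)" by (simp only: prod.reindex[OF inj] comp_def)
    also have "\<dots> = (\<Prod>p\<in>P. complex_of_real (exp (- (\<Sum>l\<in>{1..n}. \<Sum>l'\<in>{1..n}. min (t l) (t l') * Re (cnj (\<theta> l p) * \<theta> l' p)) / 4)))"
      unfolding F_sh complex_brownian_motion_char[where t = t and n = n, OF \<open>prob_space M\<close> cbm t] ..
    also have "\<dots> = complex_of_real (exp (\<Sum>p\<in>P. - (\<Sum>l\<in>{1..n}. \<Sum>l'\<in>{1..n}. min (t l) (t l') * Re (cnj (\<theta> l p) * \<theta> l' p)) / 4))"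
      using P by (simp only: exp_sum of_real_prod)
    also have "(\<Sum>p\<in>P. - (\<Sum>l\<in>{1..n}. \<Sum>l'\<in>{1..n}. min (t l) (t l') * Re (cnj (\<theta> l p) * \<theta> l' p)) / 4) =
      - (\<Sum>p\<in>P. \<Sum>l\<in>{1..n}. \<Sum>l'\<in>{1..n}. min (t l) (t l') * Re (cnj (\<theta> l p) * \<theta> l' p)) / 4"
    proof -
      have "(\<Sum>p\<in>P. - f p / 4) = - (\<Sum>p\<in>P. f p) / 4" for f :: "nat \<times> nat \<Rightarrow> real"
        by (simp add: sum_negf sum_divide_distrib)
      then show ?thesis .
    qed
    finally show "(\<integral>\<omega>. iexp (\<Sum>p\<in>P. \<Sum>l\<in>{1..n}. Re (cnj (\<theta> l p) * B (Suc (fst p)) (Suc (snd p)) (t l) \<omega>)) \<partial>M) =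
      complex_of_real (exp (- (\<Sum>p\<in>P. \<Sum>l\<in>{1..n}. \<Sum>l'\<in>{1..n}. min (t l) (t l') * Re (cnj (\<theta> l p) * \<theta> l' p)) / 4))" .
  qed
qed

section \<open>Rotations of a rectangular array\<close>

lemma unitary_matrix_rowsI:
  assumes U: "U \<in> carrier_mat n n"
    and rows: "\<And>i j. i < n \<Longrightarrow> j < n \<Longrightarrow> (\<Sum>k<n. U $$ (i, k) * cnj (U $$ (j, k))) = (if i = j then 1 else 0)"
  shows "unitary_matrix n U"
proof -
  have "U * mat_adjoint U = 1\<^sub>m n"
  proof (rule eq_matI)
    fix i j assume "i < dim_row (1\<^sub>m n :: complex mat)" "j < dim_col (1\<^sub>m n :: complex mat)"
    then have ij: "i < n" "j < n" by auto
    have "(U * mat_adjoint U) $$ (i, j) = (\<Sum>k<n. U $$ (i, k) * mat_adjoint U $$ (k, j))"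
      by (rule mat_mult_index[OF U mat_adjoint_carrier[OF U] ij])
    also have "\<dots> = (\<Sum>k<n. U $$ (i, k) * cnj (U $$ (j, k)))"
      using ij carrier_matD[OF U] by (intro sum.cong) auto
    finally show "(U * mat_adjoint U) $$ (i, j) = 1\<^sub>m n $$ (i, j)" using rows ij by auto
  qed (use carrier_matD[OF U] in auto)
  then have "unitary_matrix n (mat_adjoint U)"
    using U by (intro unitary_matrixI) auto
  from unitary_matrix_adjoint[OF this] show ?thesis by simp
qed

lemma unitary_matrix_rows:
  assumes U: "unitary_matrix n U" and ij: "i < n" "j < n"
  shows "(\<Sum>k<n. U $$ (i, k) * cnj (U $$ (j, k))) = (if i = j then 1 else 0)"
proof -
  have Uc: "U \<in> carrier_mat n n" using U by (simp add: unitary_matrix_def)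
  have "(\<Sum>k<n. U $$ (i, k) * cnj (U $$ (j, k))) = (\<Sum>k<n. U $$ (i, k) * mat_adjoint U $$ (k, j))"
    using ij carrier_matD[OF Uc] by (intro sum.cong) auto
  also have "\<dots> = (U * mat_adjoint U) $$ (i, j)"
    by (rule mat_mult_index[OF Uc mat_adjoint_carrier[OF Uc] ij, symmetric])
  finally show ?thesis using U ij by (simp add: unitary_matrix_def)
qed

text \<open>The block diagonal matrix with blocks \<open>U\<close>, of size \<open>r\<close>, and the identity. It is a function on all indices and not a
matrix, so that its restriction to any number \<open>s \<ge> r\<close> of rows is available.\<close>

definition extended_unitary :: "nat \<Rightarrow> complex mat \<Rightarrow> nat \<Rightarrow> nat \<Rightarrow> complex" where
  "extended_unitary r U i k = (if i < r \<and> k < r then U $$ (i, k) else if i = k then 1 else 0)"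

definition block_rotation :: "nat \<Rightarrow> complex mat \<Rightarrow> complex mat \<Rightarrow> nat \<times> nat \<Rightarrow> nat \<times> nat \<Rightarrow> complex" where
  "block_rotation r U V q p = extended_unitary r U (fst q) (fst p) * V $$ (snd p, snd q)"

lemma extended_unitary_rows:
  assumes U: "unitary_matrix r U" and s: "r \<le> s" and ij: "i < s" "j < s"
  shows "(\<Sum>k<s. extended_unitary r U i k * cnj (extended_unitary r U j k)) = (if i = j then 1 else 0)"
proof -
  have split: "(\<Sum>k<s. f k) = (\<Sum>k<r. f k) + (\<Sum>k\<in>{r..<s}. f k)" for f :: "nat \<Rightarrow> complex"
  proof -
    have "(\<Sum>k<s. f k) = (\<Sum>k\<in>{..<r} \<union> {r..<s}. f k)" by (rule sum.cong) (use s in auto)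
    also have "\<dots> = (\<Sum>k<r. f k) + (\<Sum>k\<in>{r..<s}. f k)" by (rule sum.union_disjoint) auto
    finally show ?thesis .
  qed
  consider "i < r" "j < r" | "i < r" "\<not> j < r" | "\<not> i < r" "j < r" | "\<not> i < r" "\<not> j < r" by blast
  then show ?thesis
  proof cases
    case 1
    have "(\<Sum>k\<in>{r..<s}. extended_unitary r U i k * cnj (extended_unitary r U j k)) = 0"
      using 1 by (intro sum.neutral) (auto simp: extended_unitary_def)
    moreover have "(\<Sum>k<r. extended_unitary r U i k * cnj (extended_unitary r U j k)) = (\<Sum>k<r. U $$ (i, k) * cnj (U $$ (j, k)))"
      using 1 by (intro sum.cong) (auto simp: extended_unitary_def)
    ultimately show ?thesis unfolding split using unitary_matrix_rows[OF U 1] by simp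
  next
    case 2
    then show ?thesis by (subst sum.neutral) (auto simp: extended_unitary_def)
  next
    case 3
    then show ?thesis by (subst sum.neutral) (auto simp: extended_unitary_def)
  next
    case 4
    then have "(\<Sum>k<s. extended_unitary r U i k * cnj (extended_unitary r U j k)) = (\<Sum>k<s. if k = i then (if i = j then 1 else 0) else 0)"
      by (intro sum.cong) (auto simp: extended_unitary_def)
    then show ?thesis using ij by simp
  qed
qed

lemma unitary_matrix_columns:
  assumes V: "unitary_matrix n V" and ij: "i < n" "j < n"
  shows "(\<Sum>k<n. V $$ (k, i) * cnj (V $$ (k, j))) = (if i = j then 1 else 0)"
proof -
  have Vc: "V \<in> carrier_mat n n" using V by (simp add: unitary_matrix_def)
  have "(\<Sum>k<n. mat_adjoint V $$ (j, k) * cnj (mat_adjoint V $$ (i, k))) = (\<Sum>k<n. V $$ (k, i) * cnj (V $$ (k, j)))"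
    using ij carrier_matD[OF Vc] by (intro sum.cong) (auto simp: mult.commute)
  then show ?thesis using unitary_matrix_rows[OF unitary_matrix_adjoint[OF V] ij(2,1)] by auto
qed

lemma block_rotation_unitary:
  assumes U: "unitary_matrix r U" and V: "unitary_matrix N V" and "r \<le> n"
    and q: "q \<in> {..<n} \<times> {..<N}" "q' \<in> {..<n} \<times> {..<N}"
  shows "(\<Sum>p\<in>{..<n} \<times> {..<N}. block_rotation r U V q p * cnj (block_rotation r U V q' p)) = (if q = q' then 1 else 0)"
proof -
  let ?u = "extended_unitary r U"
  have "(\<Sum>p\<in>{..<n} \<times> {..<N}. block_rotation r U V q p * cnj (block_rotation r U V q' p)) =
    (\<Sum>i<n. \<Sum>j<N. (?u (fst q) i * cnj (?u (fst q') i)) * (V $$ (j, snd q) * cnj (V $$ (j, snd q'))))"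
    by (subst sum.cartesian_product) (auto simp: block_rotation_def intro!: sum.cong)
  also have "\<dots> = (\<Sum>i<n. ?u (fst q) i * cnj (?u (fst q') i)) * (\<Sum>j<N. V $$ (j, snd q) * cnj (V $$ (j, snd q')))"
    by (simp only: sum_product)
  also have "\<dots> = (if q = q' then 1 else 0)"
  proof -
    have "fst q < n" "fst q' < n" "snd q < N" "snd q' < N" using q by auto
    then show ?thesis
      using extended_unitary_rows[OF U \<open>r \<le> n\<close>, of "fst q" "fst q'"] unitary_matrix_columns[OF V, of "snd q" "snd q'"]
      by (auto simp: prod_eq_iff)
  qed
  finally show ?thesis .
qed

text \<open>On the level of matrices a block rotation is multiplication from both sides. The first \<open>s\<close> rows of the rotated
array involve only the first \<open>s\<close> rows of the original one because the rows beyond \<open>r\<close> are not mixed.\<close>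

lemma mat_block_rotation:
  assumes V: "V \<in> carrier_mat N N" and s: "r \<le> s" "s \<le> n"
  shows "mat s N (\<lambda>q. \<Sum>p\<in>{..<n} \<times> {..<N}. block_rotation r U V q p * f p) =
    mat s s (\<lambda>(i, k). extended_unitary r U i k) * mat s N f * V"
proof -
  let ?u = "extended_unitary r U"
  define Us where "Us = mat s s (\<lambda>(i, k). ?u i k)"
  have Usc: "Us \<in> carrier_mat s s" by (simp add: Us_def)
  note Vc = V
  have Fc: "mat s N f \<in> carrier_mat s N" by simp
  have "mat s N (\<lambda>q. \<Sum>p\<in>{..<n} \<times> {..<N}. block_rotation r U V q p * f p) = Us * mat s N f * V"
  proof (rule eq_matI)
    fix i j assume "i < dim_row (Us * mat s N f * V)" "j < dim_col (Us * mat s N f * V)"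
    then have ij: "i < s" "j < N" using Vc by (auto simp: Us_def)
    have "(Us * mat s N f * V) $$ (i, j) = (\<Sum>l<N. (Us * mat s N f) $$ (i, l) * V $$ (l, j))"
      by (rule mat_mult_index[OF mult_carrier_mat[OF Usc Fc] Vc ij])
    also have "\<dots> = (\<Sum>l<N. (\<Sum>k<s. ?u i k * f (k, l)) * V $$ (l, j))"
    proof (intro sum.cong refl)
      fix l assume l: "l \<in> {..<N}"
      have "(Us * mat s N f) $$ (i, l) = (\<Sum>k<s. Us $$ (i, k) * mat s N f $$ (k, l))"
        by (rule mat_mult_index[OF Usc Fc]) (use ij l in auto)
      also have "\<dots> = (\<Sum>k<s. ?u i k * f (k, l))" using ij l by (intro sum.cong) (auto simp: Us_def)
      finally show "(Us * mat s N f) $$ (i, l) * V $$ (l, j) = (\<Sum>k<s. ?u i k * f (k, l)) * V $$ (l, j)" by simp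
    qed
    also have "\<dots> = (\<Sum>l<N. (\<Sum>k<n. ?u i k * f (k, l)) * V $$ (l, j))"
    proof -
      have "(\<Sum>k<s. ?u i k * f (k, l)) = (\<Sum>k<n. ?u i k * f (k, l))" for l
        using ij s by (intro sum.mono_neutral_left) (auto simp: extended_unitary_def)
      then show ?thesis by simp
    qed
    also have "\<dots> = (\<Sum>l<N. \<Sum>k<n. ?u i k * f (k, l) * V $$ (l, j))"
      by (simp only: sum_distrib_right)
    also have "\<dots> = (\<Sum>k<n. \<Sum>l<N. ?u i k * f (k, l) * V $$ (l, j))"
      by (rule sum.swap)
    also have "\<dots> = (\<Sum>p\<in>{..<n} \<times> {..<N}. block_rotation r U V (i, j) p * f p)"
      by (subst sum.cartesian_product) (auto simp: block_rotation_def ac_simps intro!: sum.cong)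
    finally show "mat s N (\<lambda>q. \<Sum>p\<in>{..<n} \<times> {..<N}. block_rotation r U V q p * f p) $$ (i, j) = (Us * mat s N f * V) $$ (i, j)"
      using ij by simp
  qed (use Vc in \<open>auto simp: Us_def\<close>)
  then show ?thesis by (simp add: Us_def)
qed

lemma eigenvalue_vector_block_rotation:
  assumes U: "unitary_matrix r U" and V: "unitary_matrix N V" and s: "r \<le> s" "s \<le> n"
  shows "eigenvalue_vector s N (\<lambda>q. \<Sum>p\<in>{..<n} \<times> {..<N}. block_rotation r U V q p * f p) = eigenvalue_vector s N f"
proof -
  let ?u = "extended_unitary r U"
  define Us where "Us = mat s s (\<lambda>(i, k). ?u i k)"
  have Usc: "Us \<in> carrier_mat s s" by (simp add: Us_def)
  have Vc: "V \<in> carrier_mat N N" using V by (simp add: unitary_matrix_def)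
  have UU: "unitary_matrix s Us"
  proof (rule unitary_matrix_rowsI[OF Usc])
    fix i j assume ij: "i < s" "j < s"
    then have "(\<Sum>k<s. Us $$ (i, k) * cnj (Us $$ (j, k))) = (\<Sum>k<s. ?u i k * cnj (?u j k))"
      by (intro sum.cong) (auto simp: Us_def)
    then show "(\<Sum>k<s. Us $$ (i, k) * cnj (Us $$ (j, k))) = (if i = j then 1 else 0)"
      using extended_unitary_rows[OF U s(1) ij] by simp
  qed
  show ?thesis
    unfolding eigenvalue_vector_def mat_block_rotation[OF Vc s] Us_def[symmetric]
    using ordered_eigenvalues_gram_unitary[OF _ UU V, of "mat s N f"] by simp
qed

section \<open>Comparing two conditional expectations\<close>

lemma subalgebra_vimage:
  assumes "f \<in> M \<rightarrow>\<^sub>M T" "space M = \<Omega>"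
  shows "subalgebra M (vimage_algebra \<Omega> f T)"
  unfolding subalgebra_def using assms sets_image_in_sets[of M \<Omega> f T] by simp

text \<open>Conditional independence given \<open>G\<close> is symmetric. If the conditional probability of every event of the past \<open>F\<close>
given the larger field \<open>H\<close>, with respect to which the future variable \<open>f\<close> is measurable, depends only on the present \<open>G\<close>,
then conditioning \<open>f\<close> on the past is the same as conditioning it on the present. For \<open>E\<close> in \<open>F\<close>, replace the indicator of
\<open>E\<close> by its conditional probability \<open>g\<close>, then \<open>f\<close> by its conditional expectation given \<open>G\<close>, and then \<open>g\<close> by the
indicator again.\<close>

lemma (in prob_space) real_cond_exp_eq_of_intermediate:
  fixes f :: "'a \<Rightarrow> real"
  assumes sub: "subalgebra M F" "subalgebra M H" "subalgebra F G" "subalgebra H G"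
    and f: "f \<in> borel_measurable H" "\<And>\<omega>. 0 \<le> f \<omega> \<and> f \<omega> \<le> 1"
    and cond: "\<And>E. E \<in> sets F \<Longrightarrow> \<exists>g\<in>borel_measurable G. AE \<omega> in M. real_cond_exp M H (indicator E) \<omega> = g \<omega>"
  shows "AE \<omega> in M. real_cond_exp M F f \<omega> = real_cond_exp M G f \<omega>"
proof -
  have subG: "subalgebra M G" using sub by (auto simp: subalgebra_def)
  interpret F: finite_measure_subalgebra M F by unfold_locales (rule sub)
  interpret H: finite_measure_subalgebra M H by unfold_locales (rule sub)
  interpret G: finite_measure_subalgebra M G by unfold_locales (rule subG)
  have fM [measurable]: "f \<in> borel_measurable M" by (rule measurable_from_subalg[OF sub(2) f(1)])
  have int_f: "integrable M f" by (rule integrable_const_bound[of _ 1]) (use f in auto)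
  show ?thesis
  proof (rule F.real_cond_exp_charact[OF _ int_f])
    show "integrable M (real_cond_exp M G f)" by (rule G.real_cond_exp_int(1)[OF int_f])
    show "real_cond_exp M G f \<in> borel_measurable F"
      by (rule measurable_from_subalg[OF sub(3)]) (rule borel_measurable_cond_exp)
    have GfH: "real_cond_exp M G f \<in> borel_measurable H"
      by (rule measurable_from_subalg[OF sub(4)]) (rule borel_measurable_cond_exp)
    fix E assume E: "E \<in> sets F"
    then have EM [measurable]: "E \<in> sets M" using sub(1) by (auto simp: subalgebra_def)
    obtain g where g: "g \<in> borel_measurable G" and AE_g: "AE \<omega> in M. real_cond_exp M H (indicator E) \<omega> = g \<omega>"
      using cond[OF E] by auto
    have gM [measurable]: "g \<in> borel_measurable M" by (rule measurable_from_subalg[OF subG g])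
    have i1: "integrable M (\<lambda>\<omega>. f \<omega> * indicator E \<omega>)"
      by (rule integrable_const_bound[of _ 1]) (use f in \<open>auto split: split_indicator\<close>)
    have i2: "integrable M (\<lambda>\<omega>. real_cond_exp M G f \<omega> * indicator E \<omega>)"
      by (rule integrable_real_mult_indicator[OF EM G.real_cond_exp_int(1)[OF int_f]])
    have HE: "real_cond_exp M H (indicator E) \<in> borel_measurable M" by simp
    have i3: "integrable M (\<lambda>\<omega>. g \<omega> * f \<omega>)"
      by (rule integrable_cong_AE_imp[OF H.real_cond_exp_intg(1)[OF i1 f(1)]]) (use AE_g in auto)
    have "(\<integral>\<omega>\<in>E. f \<omega> \<partial>M) = (\<integral>\<omega>. f \<omega> * indicator E \<omega> \<partial>M)"
      by (simp add: set_lebesgue_integral_def mult.commute)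
    also have "\<dots> = (\<integral>\<omega>. f \<omega> * real_cond_exp M H (indicator E) \<omega> \<partial>M)"
      by (rule H.real_cond_exp_intg(2)[OF i1 f(1), symmetric]) simp
    also have "\<dots> = (\<integral>\<omega>. g \<omega> * f \<omega> \<partial>M)"
      by (rule integral_cong_AE) (use AE_g in auto)
    also have "\<dots> = (\<integral>\<omega>. g \<omega> * real_cond_exp M G f \<omega> \<partial>M)"
      by (rule G.real_cond_exp_intg(2)[OF i3 g fM, symmetric])
    also have "\<dots> = (\<integral>\<omega>. real_cond_exp M G f \<omega> * real_cond_exp M H (indicator E) \<omega> \<partial>M)"
      by (rule integral_cong_AE) (use AE_g in auto)
    also have "\<dots> = (\<integral>\<omega>. real_cond_exp M G f \<omega> * indicator E \<omega> \<partial>M)"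
      by (rule H.real_cond_exp_intg(2)[OF i2 GfH]) simp
    also have "\<dots> = (\<integral>\<omega>\<in>E. real_cond_exp M G f \<omega> \<partial>M)"
      by (simp add: set_lebesgue_integral_def mult.commute)
    finally show "(\<integral>\<omega>\<in>E. f \<omega> \<partial>M) = (\<integral>\<omega>\<in>E. real_cond_exp M G f \<omega> \<partial>M)" .
  qed
qed

section \<open>One step of a space-like path\<close>

text \<open>The transition from step \<open>k\<close> to step \<open>k + 1\<close> of a space-like path, together with its past. All matrices up to step
\<open>k + 1\<close> are cut out of one Brownian array with \<open>n = N + \<alpha> 1\<close> rows, and \<open>r\<close> is the number of rows of the present
matrix.\<close>

locale space_like_step = prob_space M for M :: "'a measure" +
  fixes B :: "nat \<Rightarrow> nat \<Rightarrow> real \<Rightarrow> 'a \<Rightarrow> complex" and N k :: nat and \<alpha> :: "nat \<Rightarrow> nat" and t :: "nat \<Rightarrow> real"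
  assumes B: "iid_complex_brownian_motions M B"
    and k: "1 \<le> k"
    and t_pos: "\<And>l. l \<in> {1..Suc k} \<Longrightarrow> 0 < t l"
    and t_mono: "\<And>l l'. 1 \<le> l \<Longrightarrow> l \<le> l' \<Longrightarrow> l' \<le> Suc k \<Longrightarrow> t l \<le> t l'"
    and \<alpha>_anti: "\<And>l l'. 1 \<le> l \<Longrightarrow> l \<le> l' \<Longrightarrow> l' \<le> Suc k \<Longrightarrow> \<alpha> l' \<le> \<alpha> l"
begin

definition "n = N + \<alpha> 1"
definition "r = N + \<alpha> k"
definition entry_set :: "(nat \<times> nat) set" where "entry_set = {..<n} \<times> {..<N}"
definition time_set :: "nat set" where "time_set = {1..Suc k}"

definition Y :: "nat \<Rightarrow> nat \<times> nat \<Rightarrow> 'a \<Rightarrow> complex" where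
  "Y l p \<omega> = B (Suc (fst p)) (Suc (snd p)) (t l) \<omega>"

text \<open>The next three definitions introduce the residual array \<open>Z\<close>. For past times \<open>l < k\<close> it is the Brownian array, with the bridge taken in the first \<open>r\<close> rows.
For the times \<open>k\<close> and \<open>k + 1\<close> it consists of the first \<open>r\<close> rows of the Brownian array, with all other rows set to
zero.\<close>

definition keep_coeff :: "nat \<times> nat \<Rightarrow> nat \<Rightarrow> real" where "keep_coeff p l = (if fst p < r \<or> l < k then 1 else 0)"
definition bridge_coeff :: "nat \<times> nat \<Rightarrow> nat \<Rightarrow> real" where "bridge_coeff p l = (if fst p < r \<and> l < k then t l / t k else 0)"

definition Z :: "nat \<Rightarrow> nat \<times> nat \<Rightarrow> 'a \<Rightarrow> complex" where
  "Z l p \<omega> = of_real (keep_coeff p l) * Y l p \<omega> - of_real (bridge_coeff p l) * Y k p \<omega>"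

definition X :: "nat \<Rightarrow> 'a \<Rightarrow> nat \<Rightarrow> real" where
  "X l \<omega> = eigenvalue_vector (N + \<alpha> l) N (\<lambda>p. Y l p \<omega>)"

abbreviation spectrum_space :: "(nat \<Rightarrow> real) measure" where "spectrum_space \<equiv> PiM {1..N} (\<lambda>_. borel)"

abbreviation array_space :: "(nat \<times> nat \<times> nat \<Rightarrow> complex) measure" where "array_space \<equiv> PiM (time_set \<times> entry_set) (\<lambda>_. borel)"

definition residual :: "'a \<Rightarrow> nat \<times> nat \<times> nat \<Rightarrow> complex" where
  "residual \<omega> = (\<lambda>(l, p)\<in>time_set \<times> entry_set. Z l p \<omega>)"

text \<open>Recovers the spectra of steps \<open>1, \<dots>, k\<close> from the residual array by undoing the bridge; see
\<open>spectra_residual\<close>.\<close>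

definition spectra :: "(nat \<times> nat \<times> nat \<Rightarrow> complex) \<Rightarrow> nat \<Rightarrow> nat \<Rightarrow> real" where
  "spectra z = (\<lambda>l\<in>{1..k}. eigenvalue_vector (N + \<alpha> l) N
     (\<lambda>p. if l = k then z (k, p) else z (l, p) + (if fst p < r then of_real (t l / t k) * z (k, p) else 0)))"

text \<open>Pairs an independent copy \<open>z\<close> of the past residuals with a realisation \<open>v\<close> of the present and future rows.\<close>

definition join_arrays :: "(nat \<times> nat \<times> nat \<Rightarrow> complex) \<Rightarrow> (nat \<times> nat \<times> nat \<Rightarrow> complex) \<Rightarrow> nat \<times> nat \<times> nat \<Rightarrow> complex" where
  "join_arrays z v = (\<lambda>(l, p)\<in>time_set \<times> entry_set. if l < k then z (l, p) else v (l, p))"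

definition rotate_array :: "complex mat \<Rightarrow> complex mat \<Rightarrow> (nat \<times> nat \<times> nat \<Rightarrow> complex) \<Rightarrow> nat \<times> nat \<times> nat \<Rightarrow> complex" where
  "rotate_array U V z = (\<lambda>(l, q)\<in>time_set \<times> entry_set. \<Sum>p\<in>entry_set. block_rotation r U V q p * z (l, p))"

lemma finite_index_sets: "finite time_set" "finite entry_set"
  by (auto simp: time_set_def entry_set_def)

lemma k_in_time_set: "k \<in> time_set" "Suc k \<in> time_set" and kpos: "0 < t k"
  using k t_pos by (auto simp: time_set_def)

lemma rows_le: "l \<in> {1..Suc k} \<Longrightarrow> N + \<alpha> l \<le> n" "l \<in> {1..k} \<Longrightarrow> r \<le> N + \<alpha> l" "N + \<alpha> (Suc k) \<le> r" "r \<le> n"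
  using \<alpha>_anti[of 1 l] \<alpha>_anti[of l k] \<alpha>_anti[of k "Suc k"] \<alpha>_anti[of 1 k] k by (auto simp: n_def r_def)

lemma in_entry_set: "i < n \<Longrightarrow> j < N \<Longrightarrow> (i, j) \<in> entry_set"
  by (simp add: entry_set_def)

definition residual_cov :: "nat \<times> nat \<Rightarrow> nat \<Rightarrow> nat \<Rightarrow> real" where
  "residual_cov p l l' = keep_coeff p l * keep_coeff p l' * min (t l) (t l') - keep_coeff p l * bridge_coeff p l' * min (t l) (t k)
    - bridge_coeff p l * keep_coeff p l' * min (t k) (t l') + bridge_coeff p l * bridge_coeff p l' * min (t k) (t k)"

lemma residual_gaussian: "gaussian_array M time_set entry_set residual_cov Z"
proof -
  have gY: "gaussian_array M time_set entry_set (\<lambda>p l l'. min (t l) (t l')) Y"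
    unfolding time_set_def Y_def[abs_def]
  proof (rule brownian_array_gaussian[OF prob_space_axioms B])
    show "mono_on {1..Suc k} t" using t_mono by (auto simp: mono_on_def)
    show "\<forall>l\<in>{1..Suc k}. 0 \<le> t l" using t_pos by (auto simp: less_imp_le)
  qed (rule finite_index_sets)
  show ?thesis
    using gaussian_array_combine[OF gY finite_index_sets(1) k_in_time_set(1), of keep_coeff bridge_coeff]
    unfolding residual_cov_def[abs_def] Z_def[abs_def] .
qed

lemma residual_cov_row_class: "(fst p < r) = (fst q < r) \<Longrightarrow> residual_cov p = residual_cov q"
  by (simp add: residual_cov_def keep_coeff_def bridge_coeff_def fun_eq_iff)

text \<open>In the first \<open>r\<close> rows and for \<open>l < k \<le> l'\<close> the covariance is
\<open>min (t l) (t l') - t l / t k * min (t k) (t l') = t l - t l / t k * t k\<close>; in the other rows the later variable is zero.\<close>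

lemma residual_cov_block:
  assumes "l \<in> time_set" "l' \<in> time_set" "(l \<in> {..<k}) \<noteq> (l' \<in> {..<k})"
  shows "residual_cov p l l' = 0"
proof -
  have "residual_cov p l l' = 0" if "l \<in> time_set" "l' \<in> time_set" "l < k" "\<not> l' < k" for l l'
    using that kpos t_mono[of l k] t_mono[of k l'] t_mono[of l l']
    by (auto simp: residual_cov_def keep_coeff_def bridge_coeff_def time_set_def min_def)
  moreover have "residual_cov p l l' = residual_cov p l' l" for l l' by (simp add: residual_cov_def min.commute)
  ultimately show ?thesis using assms by (metis lessThan_iff)
qed

lemma measurable_residual [measurable]: "residual \<in> M \<rightarrow>\<^sub>M array_space"
  unfolding residual_def[abs_def] by (rule gaussian_array_measurable[OF residual_gaussian])

text \<open>Whether a row lies among the first \<open>r\<close> is all that the residual covariance depends on, and a block rotation does not mix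
the two classes of rows.\<close>

lemma law_rotate:
  assumes U: "unitary_matrix r U" and V: "unitary_matrix N V"
  shows "distr M array_space residual = distr M array_space (\<lambda>\<omega>. rotate_array U V (residual \<omega>))"
    and "(\<lambda>\<omega>. rotate_array U V (residual \<omega>)) \<in> M \<rightarrow>\<^sub>M array_space"
proof -
  have g: "gaussian_array M time_set entry_set residual_cov (\<lambda>l q \<omega>. \<Sum>p\<in>entry_set. block_rotation r U V q p * Z l p \<omega>)"
  proof (rule gaussian_array_rotate[OF residual_gaussian finite_index_sets(2)])
    show "(\<Sum>p\<in>entry_set. block_rotation r U V q p * cnj (block_rotation r U V q' p)) = (if q = q' then 1 else 0)"
      if "q \<in> entry_set" "q' \<in> entry_set" for q q'
      using that unfolding entry_set_def by (rule block_rotation_unitary[OF U V rows_le(4)])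
    show "residual_cov q = residual_cov p" if "block_rotation r U V q p \<noteq> 0" for q p
      by (rule residual_cov_row_class) (use that in \<open>auto simp: block_rotation_def extended_unitary_def split: if_splits\<close>)
  qed
  have eq: "(\<lambda>\<omega>. \<lambda>(l, q)\<in>time_set \<times> entry_set. \<Sum>p\<in>entry_set. block_rotation r U V q p * Z l p \<omega>) = (\<lambda>\<omega>. rotate_array U V (residual \<omega>))"
    by (auto simp: rotate_array_def residual_def fun_eq_iff restrict_def intro!: sum.cong)
  show "distr M array_space residual = distr M array_space (\<lambda>\<omega>. rotate_array U V (residual \<omega>))"
    using gaussian_array_law_unique[OF finite_index_sets prob_space_axioms prob_space_axioms residual_gaussian g]
    unfolding array_law_def eq residual_def[symmetric] .
  show "(\<lambda>\<omega>. rotate_array U V (residual \<omega>)) \<in> M \<rightarrow>\<^sub>M array_space"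
    using gaussian_array_measurable[OF g] unfolding eq .
qed

lemma law_decouple:
  shows "distr M array_space residual = distr (M \<Otimes>\<^sub>M M) array_space (\<lambda>(\<omega>, \<omega>'). join_arrays (residual \<omega>) (residual \<omega>'))"
    and "(\<lambda>(\<omega>, \<omega>'). join_arrays (residual \<omega>) (residual \<omega>')) \<in> M \<Otimes>\<^sub>M M \<rightarrow>\<^sub>M array_space"
proof -
  interpret MM: pair_prob_space M M ..
  have g: "gaussian_array (M \<Otimes>\<^sub>M M) time_set entry_set residual_cov (\<lambda>l p (\<omega>, \<omega>'). if l \<in> {..<k} then Z l p \<omega> else Z l p \<omega>')"
    by (rule gaussian_array_decouple[OF residual_gaussian prob_space_axioms]) (rule residual_cov_block)
  have eq: "(\<lambda>x. \<lambda>(l, p)\<in>time_set \<times> entry_set. (case x of (\<omega>, \<omega>') \<Rightarrow> if l \<in> {..<k} then Z l p \<omega> else Z l p \<omega>')) =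
      (\<lambda>(\<omega>, \<omega>'). join_arrays (residual \<omega>) (residual \<omega>'))"
    by (auto simp: join_arrays_def residual_def fun_eq_iff restrict_def)
  show "distr M array_space residual = distr (M \<Otimes>\<^sub>M M) array_space (\<lambda>(\<omega>, \<omega>'). join_arrays (residual \<omega>) (residual \<omega>'))"
    using gaussian_array_law_unique[OF finite_index_sets prob_space_axioms MM.prob_space_axioms residual_gaussian g]
    unfolding array_law_def eq residual_def[symmetric] .
  show "(\<lambda>(\<omega>, \<omega>'). join_arrays (residual \<omega>) (residual \<omega>')) \<in> M \<Otimes>\<^sub>M M \<rightarrow>\<^sub>M array_space"
    using gaussian_array_measurable[OF g] unfolding eq .
qed

lemma measurable_entry: "l \<in> time_set \<Longrightarrow> p \<in> entry_set \<Longrightarrow> (\<lambda>z. z (l, p)) \<in> borel_measurable array_space"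
  by (rule measurable_component_singleton) simp

lemma measurable_spectra [measurable]: "spectra \<in> array_space \<rightarrow>\<^sub>M PiM {1..k} (\<lambda>_. spectrum_space)"
  unfolding spectra_def
proof (intro measurable_restrict measurable_eigenvalue_vector)
  fix l i j assume l: "l \<in> {1..k}" and ij: "i < N + \<alpha> l" "j < N"
  have "l \<in> time_set" "(i, j) \<in> entry_set" using l ij rows_le(1)[of l] by (auto simp: in_entry_set time_set_def)
  note [measurable] = measurable_entry[OF this] measurable_entry[OF k_in_time_set(1) this(2)]
  show "(\<lambda>z. if l = k then z (k, i, j)
      else z (l, i, j) + (if fst (i, j) < r then of_real (t l / t k) * z (k, i, j) else 0)) \<in> borel_measurable array_space"
    by measurable
qed

lemma measurable_join: "(\<lambda>z. join_arrays z v) \<in> array_space \<rightarrow>\<^sub>M array_space"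
  unfolding join_arrays_def
proof (rule measurable_restrict)
  fix x assume "x \<in> time_set \<times> entry_set"
  then show "(\<lambda>z. case x of (l, p) \<Rightarrow> if l < k then z (l, p) else v (l, p)) \<in> borel_measurable array_space"
    by (auto simp: split_beta intro!: measurable_entry)
qed

lemma X_eq_Z:
  shows "X k \<omega> = eigenvalue_vector r N (\<lambda>p. residual \<omega> (k, p))"
    and "X (Suc k) \<omega> = eigenvalue_vector (N + \<alpha> (Suc k)) N (\<lambda>p. residual \<omega> (Suc k, p))"
proof -
  show "X k \<omega> = eigenvalue_vector r N (\<lambda>p. residual \<omega> (k, p))"
    unfolding X_def r_def[symmetric]
    by (rule eigenvalue_vector_cong) (use rows_le k_in_time_set in \<open>auto simp: residual_def in_entry_set Z_def keep_coeff_def bridge_coeff_def\<close>)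
  show "X (Suc k) \<omega> = eigenvalue_vector (N + \<alpha> (Suc k)) N (\<lambda>p. residual \<omega> (Suc k, p))"
    unfolding X_def
    by (rule eigenvalue_vector_cong) (use rows_le k_in_time_set in \<open>auto simp: residual_def in_entry_set Z_def keep_coeff_def bridge_coeff_def\<close>)
qed

lemma spectra_residual: "spectra (residual \<omega>) = (\<lambda>l\<in>{1..k}. X l \<omega>)"
  unfolding spectra_def X_def
proof (intro restrict_ext eigenvalue_vector_cong)
  fix l i j assume l: "l \<in> {1..k}" and ij: "i < N + \<alpha> l" "j < N"
  have "(i, j) \<in> entry_set" "l \<in> time_set" using l ij rows_le(1)[of l] by (auto simp: in_entry_set time_set_def)
  then show "(if l = k then residual \<omega> (k, i, j)
      else residual \<omega> (l, i, j) + (if fst (i, j) < r then of_real (t l / t k) * residual \<omega> (k, i, j) else 0)) = Y l (i, j) \<omega>"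
    using l ij k_in_time_set by (auto simp: residual_def Z_def keep_coeff_def bridge_coeff_def r_def)
qed

text \<open>The spectra of the past see the array \<open>v\<close> only through the present matrix.\<close>

lemma spectra_join_cong:
  assumes "\<And>p. p \<in> entry_set \<Longrightarrow> fst p < r \<Longrightarrow> v (k, p) = v' (k, p)"
  shows "spectra (join_arrays z v) = spectra (join_arrays z v')"
  unfolding spectra_def
proof (intro restrict_ext eigenvalue_vector_cong)
  fix l i j assume l: "l \<in> {1..k}" and ij: "i < N + \<alpha> l" "j < N"
  have "(i, j) \<in> entry_set" "l \<in> time_set" using l ij rows_le(1)[of l] by (auto simp: in_entry_set time_set_def)
  then show "(if l = k then join_arrays z v (k, i, j)
      else join_arrays z v (l, i, j) + (if fst (i, j) < r then of_real (t l / t k) * join_arrays z v (k, i, j) else 0)) =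
    (if l = k then join_arrays z v' (k, i, j)
      else join_arrays z v' (l, i, j) + (if fst (i, j) < r then of_real (t l / t k) * join_arrays z v' (k, i, j) else 0))"
    using l ij k_in_time_set assms by (auto simp: join_arrays_def r_def)
qed

text \<open>Undoing the bridge commutes with the rotation, which therefore acts on each of the matrices by multiplication
with unitary matrices from both sides.\<close>

lemma spectra_rotate:
  assumes U: "unitary_matrix r U" and V: "unitary_matrix N V"
  shows "spectra (rotate_array U V z) = spectra z"
proof -
  let ?T = "block_rotation r U V"
  have "eigenvalue_vector (N + \<alpha> l) N
     (\<lambda>p. if l = k then rotate_array U V z (k, p) else rotate_array U V z (l, p) + (if fst p < r then of_real (t l / t k) * rotate_array U V z (k, p) else 0)) =
    eigenvalue_vector (N + \<alpha> l) N
     (\<lambda>p. if l = k then z (k, p) else z (l, p) + (if fst p < r then of_real (t l / t k) * z (k, p) else 0))"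
    (is "eigenvalue_vector _ _ ?f = eigenvalue_vector _ _ ?g") if l: "l \<in> {1..k}" for l
  proof -
    have "eigenvalue_vector (N + \<alpha> l) N ?f = eigenvalue_vector (N + \<alpha> l) N (\<lambda>q. \<Sum>p\<in>entry_set. ?T q p * ?g p)"
    proof (rule eigenvalue_vector_cong)
      fix i j assume ij: "i < N + \<alpha> l" "j < N"
      have q: "(i, j) \<in> entry_set" "l \<in> time_set" using l ij rows_le(1)[of l] by (auto simp: in_entry_set time_set_def)
      show "?f (i, j) = (\<Sum>p\<in>entry_set. ?T (i, j) p * ?g p)"
      proof (cases "l = k")
        case True
        then show ?thesis using q by (simp add: rotate_array_def)
      next
        case False
        have "(\<Sum>p\<in>entry_set. ?T (i, j) p * ?g p) = (\<Sum>p\<in>entry_set. ?T (i, j) p * z (l, p) + (if i < r then of_real (t l / t k) * (?T (i, j) p * z (k, p)) else 0))"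
          using False
          by (intro sum.cong refl) (auto simp: block_rotation_def extended_unitary_def algebra_simps)
        also have "\<dots> = ?f (i, j)"
          using False q k_in_time_set by (simp add: sum.distrib rotate_array_def sum_distrib_left)
        finally show ?thesis ..
      qed
    qed
    also have "\<dots> = eigenvalue_vector (N + \<alpha> l) N ?g"
      unfolding entry_set_def using l rows_le(1)[of l] rows_le(2)[of l] by (intro eigenvalue_vector_block_rotation[OF U V]) auto
    finally show ?thesis .
  qed
  then show ?thesis unfolding spectra_def by (intro restrict_ext) blast
qed

lemma join_rotate: "join_arrays (rotate_array U V z) (rotate_array U V v) = rotate_array U V (join_arrays z v)"
  by (auto simp: join_arrays_def rotate_array_def fun_eq_iff restrict_def intro!: sum.cong)

text \<open>The conditional probability that the spectra of steps \<open>1, \<dots>, k\<close> lie in \<open>E\<close>, as a function of the present and future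
rows \<open>v\<close>.\<close>

definition past_prob :: "(nat \<Rightarrow> nat \<Rightarrow> real) set \<Rightarrow> (nat \<times> nat \<times> nat \<Rightarrow> complex) \<Rightarrow> real" where
  "past_prob E v = (\<integral>\<omega>. indicator E (spectra (join_arrays (residual \<omega>) v)) \<partial>M)"

lemma past_prob_rotate:
  assumes U: "unitary_matrix r U" and V: "unitary_matrix N V" and E: "E \<in> sets (PiM {1..k} (\<lambda>_. spectrum_space))"
  shows "past_prob E (rotate_array U V v) = past_prob E v"
proof -
  define g :: "(nat \<times> nat \<times> nat \<Rightarrow> complex) \<Rightarrow> real" where "g z = indicator E (spectra (join_arrays z (rotate_array U V v)))" for z
  have g: "g \<in> borel_measurable array_space"
    unfolding g_def by (rule measurable_compose[OF measurable_join]) (use E in measurable)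
  have "past_prob E (rotate_array U V v) = (\<integral>z. g z \<partial>distr M array_space residual)"
    unfolding past_prob_def by (subst integral_distr[OF measurable_residual g]) (simp add: g_def)
  also have "\<dots> = (\<integral>\<omega>. g (rotate_array U V (residual \<omega>)) \<partial>M)"
    unfolding law_rotate(1)[OF U V] by (rule integral_distr[OF law_rotate(2)[OF U V] g])
  also have "\<dots> = past_prob E v"
    by (simp add: g_def past_prob_def join_rotate spectra_rotate[OF U V])
  finally show ?thesis .
qed

text \<open>For nonnegative \<open>x\<close>, cutting out a matrix with at least \<open>N\<close> rows gives a diagonal one whose Gram matrix has the eigenvalues
\<open>x 1, \<dots>, x N\<close>; the index shift accounts for array positions starting at zero.\<close>

definition diagonal_array :: "(nat \<Rightarrow> real) \<Rightarrow> nat \<times> nat \<times> nat \<Rightarrow> complex" where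
  "diagonal_array x = (\<lambda>(l, i, j). if i = j then of_real (sqrt (x (Suc i))) else 0)"

text \<open>By the singular value decomposition the present matrix is a rotation of the diagonal array of its own
eigenvalues, so rotation invariance reduces \<open>past_prob\<close> to a function of \<open>X k\<close>.\<close>

lemma past_prob_eigenvalues:
  assumes E: "E \<in> sets (PiM {1..k} (\<lambda>_. spectrum_space))"
  shows "past_prob E (residual \<omega>) = past_prob E (diagonal_array (X k \<omega>))"
proof -
  define A where "A = mat r N (\<lambda>p. Y k p \<omega>)"
  have Ac: "A \<in> carrier_mat r N" by (simp add: A_def)
  have "N \<le> r" by (simp add: r_def)
  from singular_value_decomposition[OF Ac this] obtain U V where U: "unitary_matrix r U" and V: "unitary_matrix N V"
    and svd: "A = U * singular_value_matrix r N (\<lambda>i. ordered_eigenvalues (mat_adjoint A * A) ! i) * V" by blast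
  have Uc: "U \<in> carrier_mat r r" and Vc: "V \<in> carrier_mat N N" using U V by (auto simp: unitary_matrix_def)
  have "singular_value_matrix r N (\<lambda>i. ordered_eigenvalues (mat_adjoint A * A) ! i) = mat r N (\<lambda>p. diagonal_array (X k \<omega>) (k, p))"
    unfolding singular_value_matrix_def
    by (rule cong_mat) (auto simp: diagonal_array_def X_def eigenvalue_vector_def A_def r_def)
  moreover have "mat r r (\<lambda>(i, k). extended_unitary r U i k) = U"
    using carrier_matD[OF Uc] by (intro eq_matI) (auto simp: extended_unitary_def)
  ultimately have A_rot: "A = mat r N (\<lambda>q. \<Sum>p\<in>entry_set. block_rotation r U V q p * diagonal_array (X k \<omega>) (k, p))"
    using svd unfolding entry_set_def mat_block_rotation[OF Vc order_refl rows_le(4)] by simp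
  have "past_prob E (residual \<omega>) = past_prob E (rotate_array U V (diagonal_array (X k \<omega>)))"
  proof -
    have "residual \<omega> (k, p) = rotate_array U V (diagonal_array (X k \<omega>)) (k, p)" if p: "p \<in> entry_set" "fst p < r" for p
    proof -
      have "snd p < N" using p by (auto simp: entry_set_def)
      then have "Y k p \<omega> = A $$ p" using p by (cases p) (simp add: A_def)
      also have "\<dots> = (\<Sum>p'\<in>entry_set. block_rotation r U V p p' * diagonal_array (X k \<omega>) (k, p'))"
        using p \<open>snd p < N\<close> by (subst A_rot) (cases p, simp)
      finally show ?thesis using p k_in_time_set by (simp add: residual_def rotate_array_def Z_def keep_coeff_def bridge_coeff_def)
    qed
    then show ?thesis unfolding past_prob_def by (simp only: spectra_join_cong[of "residual \<omega>" "rotate_array U V (diagonal_array (X k \<omega>))"])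
  qed
  also have "\<dots> = past_prob E (diagonal_array (X k \<omega>))" by (rule past_prob_rotate[OF U V E])
  finally show ?thesis .
qed

lemma measurable_past_prob_diagonal:
  assumes E: "E \<in> sets (PiM {1..k} (\<lambda>_. spectrum_space))"
  shows "(\<lambda>x. past_prob E (diagonal_array x)) \<in> borel_measurable spectrum_space"
  unfolding past_prob_def
proof (rule borel_measurable_lebesgue_integral)
  have "(\<lambda>y. join_arrays (residual (snd y)) (diagonal_array (fst y))) \<in> spectrum_space \<Otimes>\<^sub>M M \<rightarrow>\<^sub>M array_space"
    unfolding join_arrays_def
  proof (rule measurable_restrict)
    fix x assume "x \<in> time_set \<times> entry_set"
    then obtain l i j where x: "x = (l, i, j)" and l: "l \<in> time_set" and p: "(i, j) \<in> entry_set" by (cases x) auto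
    have zm: "(\<lambda>y. residual (snd y) (l, i, j)) \<in> borel_measurable (spectrum_space \<Otimes>\<^sub>M M)"
      by (intro measurable_compose[OF measurable_compose[OF measurable_snd measurable_residual]] measurable_entry l p)
    have dm: "(\<lambda>y. diagonal_array (fst y) (l, i, j)) \<in> borel_measurable (spectrum_space \<Otimes>\<^sub>M M)"
    proof (cases "i = j")
      case True
      then have "Suc i \<in> {1..N}" using p by (auto simp: entry_set_def)
      then have [measurable]: "(\<lambda>y. fst y (Suc i)) \<in> borel_measurable (spectrum_space \<Otimes>\<^sub>M M)"
        by (intro measurable_compose[OF measurable_fst] measurable_component_singleton)
      have "(\<lambda>y. complex_of_real (sqrt (fst y (Suc i)))) \<in> borel_measurable (spectrum_space \<Otimes>\<^sub>M M)" by measurable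
      then show ?thesis using True by (simp add: diagonal_array_def)
    qed (simp add: diagonal_array_def)
    show "(\<lambda>y. case x of (l, p) \<Rightarrow> if l < k then residual (snd y) (l, p) else diagonal_array (fst y) (l, p)) \<in> borel_measurable (spectrum_space \<Otimes>\<^sub>M M)"
      using zm dm by (simp add: x)
  qed
  from measurable_compose[OF this, of "\<lambda>z. indicator E (spectra z) :: real" borel] E
  show "(\<lambda>(x, \<omega>). indicator E (spectra (join_arrays (residual \<omega>) (diagonal_array x))) :: real) \<in> borel_measurable (spectrum_space \<Otimes>\<^sub>M M)"
    by (simp add: split_beta')
qed

text \<open>The intermediate field \<open>H\<close> is generated by the first \<open>r\<close> rows at the times \<open>k\<close> and \<open>k + 1\<close>. Given \<open>H\<close>, the past
residuals can be integrated out because they are independent of it, and the result depends on \<open>X k\<close> only.\<close>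

lemma markov_step:
  assumes A: "A \<in> sets spectrum_space"
  shows "AE \<omega> in M.
    real_cond_exp M (vimage_algebra (space M) (\<lambda>\<omega>. \<lambda>i\<in>{1..k}. X i \<omega>) (PiM {1..k} (\<lambda>_. spectrum_space))) (\<lambda>\<omega>. indicator A (X (Suc k) \<omega>)) \<omega> =
    real_cond_exp M (vimage_algebra (space M) (X k) spectrum_space) (\<lambda>\<omega>. indicator A (X (Suc k) \<omega>)) \<omega>"
proof -
  define L2 where "L2 = {k, Suc k}"
  have L2: "L2 \<times> entry_set \<subseteq> time_set \<times> entry_set" using k_in_time_set by (auto simp: L2_def)
  define V where "V \<omega> = restrict (residual \<omega>) (L2 \<times> entry_set)" for \<omega>
  let ?PV = "PiM (L2 \<times> entry_set) (\<lambda>_. borel) :: (nat \<times> nat \<times> nat \<Rightarrow> complex) measure"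
  have V_meas: "V \<in> M \<rightarrow>\<^sub>M ?PV"
    unfolding V_def by (rule measurable_compose[OF measurable_residual measurable_restrict_subset[OF L2]])
  have XX_meas: "(\<lambda>\<omega>. \<lambda>i\<in>{1..k}. X i \<omega>) \<in> M \<rightarrow>\<^sub>M PiM {1..k} (\<lambda>_. spectrum_space)"
    unfolding spectra_residual[symmetric] by measurable
  define F where "F = vimage_algebra (space M) (\<lambda>\<omega>. \<lambda>i\<in>{1..k}. X i \<omega>) (PiM {1..k} (\<lambda>_. spectrum_space))"
  define G where "G = vimage_algebra (space M) (X k) spectrum_space"
  define H where "H = vimage_algebra (space M) V ?PV"
  have F1: "(\<lambda>\<omega>. \<lambda>i\<in>{1..k}. X i \<omega>) \<in> F \<rightarrow>\<^sub>M PiM {1..k} (\<lambda>_. spectrum_space)"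
    unfolding F_def using measurable_space[OF XX_meas] by (intro measurable_vimage_algebra1) auto
  have H1: "V \<in> H \<rightarrow>\<^sub>M ?PV"
    unfolding H_def using measurable_space[OF V_meas] by (intro measurable_vimage_algebra1) auto
  have V_entry: "(\<lambda>\<omega>. V \<omega> (l, p)) \<in> borel_measurable H" if "l \<in> L2" "p \<in> entry_set" for l p
    by (rule measurable_compose[OF H1 measurable_component_singleton]) (use that in auto)
  have Xk_H: "X k \<in> H \<rightarrow>\<^sub>M spectrum_space"
  proof -
    have "X k = (\<lambda>\<omega>. eigenvalue_vector r N (\<lambda>p. V \<omega> (k, p)))"
      unfolding X_eq_Z(1) fun_eq_iff[of "X k"]
      by (intro allI eigenvalue_vector_cong) (use rows_le(4) in \<open>auto simp: V_def L2_def in_entry_set\<close>)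
    moreover have "(\<lambda>\<omega>. eigenvalue_vector r N (\<lambda>p. V \<omega> (k, p))) \<in> H \<rightarrow>\<^sub>M spectrum_space"
      using rows_le(4) by (intro measurable_eigenvalue_vector V_entry) (auto simp: L2_def in_entry_set)
    ultimately show ?thesis by simp
  qed
  have Xk'_H: "X (Suc k) \<in> H \<rightarrow>\<^sub>M spectrum_space"
  proof -
    have "X (Suc k) = (\<lambda>\<omega>. eigenvalue_vector (N + \<alpha> (Suc k)) N (\<lambda>p. V \<omega> (Suc k, p)))"
      unfolding X_eq_Z(2) fun_eq_iff[of "X (Suc k)"]
      by (intro allI eigenvalue_vector_cong) (use rows_le(3,4) in \<open>auto simp: V_def L2_def in_entry_set\<close>)
    moreover have "(\<lambda>\<omega>. eigenvalue_vector (N + \<alpha> (Suc k)) N (\<lambda>p. V \<omega> (Suc k, p))) \<in> H \<rightarrow>\<^sub>M spectrum_space"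
      using rows_le(3,4) by (intro measurable_eigenvalue_vector V_entry) (auto simp: L2_def in_entry_set)
    ultimately show ?thesis by simp
  qed
  have Xk_F: "X k \<in> F \<rightarrow>\<^sub>M spectrum_space"
    using measurable_compose[OF F1 measurable_component_singleton[of k]] k by simp
  have sub_MF: "subalgebra M F" unfolding F_def by (rule subalgebra_vimage[OF XX_meas]) simp
  have sub_MH: "subalgebra M H" unfolding H_def by (rule subalgebra_vimage[OF V_meas]) simp
  have sub_FG: "subalgebra F G" unfolding G_def by (rule subalgebra_vimage[OF Xk_F]) (simp add: F_def)
  have sub_HG: "subalgebra H G" unfolding G_def by (rule subalgebra_vimage[OF Xk_H]) (simp add: H_def)
  have Xk_G: "X k \<in> G \<rightarrow>\<^sub>M spectrum_space"
    unfolding G_def using measurable_space[OF measurable_from_subalg[OF sub_MF Xk_F]] by (intro measurable_vimage_algebra1) auto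
  show ?thesis unfolding F_def[symmetric] G_def[symmetric]
  proof (rule real_cond_exp_eq_of_intermediate[OF sub_MF sub_MH sub_FG sub_HG])
    show "(\<lambda>\<omega>. indicator A (X (Suc k) \<omega>)) \<in> borel_measurable H"
      by (rule measurable_compose[OF Xk'_H]) (use A in measurable)
    show "0 \<le> (indicator A (X (Suc k) \<omega>) :: real) \<and> indicator A (X (Suc k) \<omega>) \<le> (1 :: real)" for \<omega>
      by (simp split: split_indicator)
    fix E assume "E \<in> sets F"
    then obtain E' where E': "E' \<in> sets (PiM {1..k} (\<lambda>_. spectrum_space))" and E: "E = (\<lambda>\<omega>. \<lambda>i\<in>{1..k}. X i \<omega>) -` E' \<inter> space M"
      unfolding F_def using measurable_space[OF XX_meas] by (subst (asm) sets_vimage_algebra2) auto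
    have EM: "E \<in> sets M" unfolding E by (rule measurable_sets[OF XX_meas E'])
    define g where "g \<omega> = past_prob E' (diagonal_array (X k \<omega>))" for \<omega>
    have g_G: "g \<in> borel_measurable G"
      unfolding g_def by (rule measurable_compose[OF Xk_G measurable_past_prob_diagonal[OF E']])
    have g_M: "g \<in> borel_measurable M"
      by (rule measurable_from_subalg[OF sub_MH measurable_from_subalg[OF sub_HG g_G]])
    have g_bd: "0 \<le> g \<omega>" "g \<omega> \<le> 1" for \<omega>
    proof -
      show "0 \<le> g \<omega>" unfolding g_def past_prob_def by (intro integral_nonneg_AE) auto
      have "g \<omega> \<le> (\<integral>\<omega>. 1 \<partial>M)"
        unfolding g_def past_prob_def
      proof (rule integral_mono)
        show "integrable M (\<lambda>\<omega>'. indicator E' (spectra (join_arrays (residual \<omega>') (diagonal_array (X k \<omega>)))) :: real)"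
        proof (rule integrable_const_bound[of _ 1])
          show "(\<lambda>\<omega>'. indicator E' (spectra (join_arrays (residual \<omega>') (diagonal_array (X k \<omega>)))) :: real) \<in> borel_measurable M"
            by (rule measurable_compose[OF measurable_compose[OF measurable_residual measurable_join]]) (use E' in measurable)
        qed (auto split: split_indicator)
      qed (auto split: split_indicator)
      then show "g \<omega> \<le> 1" by (simp add: prob_space)
    qed
    interpret H: finite_measure_subalgebra M H by unfold_locales (rule sub_MH)
    interpret MM: pair_prob_space M M ..
    have "AE \<omega> in M. real_cond_exp M H (indicator E) \<omega> = g \<omega>"
    proof (rule H.real_cond_exp_charact)
      show "integrable M (indicator E :: 'a \<Rightarrow> real)"
        by (rule integrable_const_bound[of _ 1]) (use EM in \<open>auto split: split_indicator\<close>)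
      show "integrable M g" by (rule integrable_const_bound[of _ 1]) (use g_bd g_M in auto)
      show "g \<in> borel_measurable H" by (rule measurable_from_subalg[OF sub_HG g_G])
      fix D assume "D \<in> sets H"
      then obtain R where R [measurable]: "R \<in> sets ?PV" and D: "D = V -` R \<inter> space M"
        unfolding H_def using measurable_space[OF V_meas] by (subst (asm) sets_vimage_algebra2) auto
      \<comment> \<open>The event \<open>D \<inter> E\<close> in terms of the residual array, to which the decoupled law applies.\<close>
      define h :: "(nat \<times> nat \<times> nat \<Rightarrow> complex) \<Rightarrow> real"
        where "h z = indicator R (restrict z (L2 \<times> entry_set)) * indicator E' (spectra z)" for z
      have h: "h \<in> borel_measurable array_space"
        unfolding h_def
      proof (rule borel_measurable_times)
        show "(\<lambda>z. indicator R (restrict z (L2 \<times> entry_set)) :: real) \<in> borel_measurable array_space"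
          by (rule measurable_compose[OF measurable_restrict_subset[OF L2]]) measurable
        show "(\<lambda>z. indicator E' (spectra z) :: real) \<in> borel_measurable array_space" using E' by measurable
      qed
      have V_merge: "restrict (join_arrays z (residual \<omega>')) (L2 \<times> entry_set) = V \<omega>'" for z \<omega>'
        using L2 by (auto simp: V_def join_arrays_def fun_eq_iff restrict_def L2_def)
      have "(\<integral>\<omega>\<in>D. indicator E \<omega> \<partial>M) = (\<integral>\<omega>. h (residual \<omega>) \<partial>M)"
        unfolding set_lebesgue_integral_def
      proof (rule Bochner_Integration.integral_cong[OF refl])
        fix \<omega> assume "\<omega> \<in> space M"
        then show "indicator D \<omega> *\<^sub>R indicator E \<omega> = h (residual \<omega>)"
          by (simp add: h_def spectra_residual D E V_def split: split_indicator)
      qed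
      also have "\<dots> = (\<integral>z. h z \<partial>distr M array_space residual)" by (rule integral_distr[OF measurable_residual h, symmetric])
      also have "\<dots> = (\<integral>(\<omega>, \<omega>'). h (join_arrays (residual \<omega>) (residual \<omega>')) \<partial>(M \<Otimes>\<^sub>M M))"
        unfolding law_decouple(1) by (subst integral_distr[OF law_decouple(2) h]) (simp add: split_beta')
      also have "\<dots> = (\<integral>\<omega>'. \<integral>\<omega>. h (join_arrays (residual \<omega>) (residual \<omega>')) \<partial>M \<partial>M)"
      proof (rule MM.integral_snd[symmetric], rule MM.integrable_const_bound[of _ 1])
        show "(\<lambda>(\<omega>, \<omega>'). h (join_arrays (residual \<omega>) (residual \<omega>'))) \<in> borel_measurable (M \<Otimes>\<^sub>M M)"
          using measurable_compose[OF law_decouple(2) h] by (simp add: split_beta')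
      qed (auto simp: h_def split: split_indicator)
      also have "\<dots> = (\<integral>\<omega>'. indicator R (V \<omega>') * past_prob E' (residual \<omega>') \<partial>M)"
        by (simp add: h_def V_merge past_prob_def)
      also have "\<dots> = (\<integral>\<omega>\<in>D. g \<omega> \<partial>M)"
        unfolding set_lebesgue_integral_def
        by (rule Bochner_Integration.integral_cong[OF refl])
          (simp add: past_prob_eigenvalues[OF E'] g_def D split: split_indicator)
      finally show "(\<integral>\<omega>\<in>D. indicator E \<omega> \<partial>M) = (\<integral>\<omega>\<in>D. g \<omega> \<partial>M)" .
    qed
    then show "\<exists>g\<in>borel_measurable G. AE \<omega> in M. real_cond_exp M H (indicator E) \<omega> = g \<omega>"
      using g_G by blast
  qed
qed

end

section \<open>The Markov property\<close>

theorem lemma4p1: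
  fixes M :: "'a measure"
    and B :: "nat \<Rightarrow> nat \<Rightarrow> real \<Rightarrow> 'a \<Rightarrow> complex"
    and N m :: nat
    and \<alpha> :: "nat \<Rightarrow> nat"
    and t :: "nat \<Rightarrow> real"
  assumes "prob_space M"
    and "iid_complex_brownian_motions M B"
    and "N \<ge> 1"
    and "m \<ge> 1"
    and "\<forall>k\<in>{1..m}. t k > 0"
    and "space_like_path m \<alpha> t"
  shows "markov_process M (PiM {1..N} (\<lambda>_. borel)) m
           (\<lambda>k \<omega>. \<lambda>j\<in>{1..N}. X_ev B N (\<alpha> k) (t k) j \<omega>)"
proof -
  interpret prob_space M by fact
  have Y: "(\<lambda>j\<in>{1..N}. X_ev B N (\<alpha> k) (t k) j \<omega>) =
      eigenvalue_vector (N + \<alpha> k) N (\<lambda>p. B (Suc (fst p)) (Suc (snd p)) (t k) \<omega>)" for k \<omega>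
    by (simp add: eigenvalue_vector_def X_ev_def BM_matrix_def case_prod_beta')
  have mono: "t l \<le> t l' \<and> \<alpha> l' \<le> \<alpha> l" if "l \<le> l'" "1 \<le> l" "l' \<le> m" for l l'
    using that
  proof (induction rule: dec_induct)
    case (step i)
    then have "i \<in> {1..<m}" by auto
    then have "\<alpha> (Suc i) \<le> \<alpha> i \<and> t i \<le> t (Suc i)"
      using \<open>space_like_path m \<alpha> t\<close> unfolding space_like_path_def by blast
    then show ?case using step by auto
  qed auto
  have meas: "(\<lambda>\<omega>. eigenvalue_vector (N + \<alpha> k) N (\<lambda>p. B (Suc (fst p)) (Suc (snd p)) (t k) \<omega>))
      \<in> M \<rightarrow>\<^sub>M PiM {1..N} (\<lambda>_. borel)" if k: "k \<in> {1..m}" for k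
  proof (rule measurable_eigenvalue_vector)
    fix i j
    have "gaussian_array M {1..m} {(i, j)} (\<lambda>p l l'. min (t l) (t l')) (\<lambda>l p \<omega>. B (Suc (fst p)) (Suc (snd p)) (t l) \<omega>)"
      using mono assms(5) by (intro brownian_array_gaussian assms(1,2)) (auto simp: mono_on_def less_imp_le)
    from gaussian_array_entry_measurable[OF this k]
    show "(\<lambda>\<omega>. B (Suc (fst (i, j))) (Suc (snd (i, j))) (t k) \<omega>) \<in> borel_measurable M" by simp
  qed
  show ?thesis
    unfolding markov_process_def Y
  proof (intro conjI ballI)
    fix k A assume k: "k \<in> {1..<m}" and A: "A \<in> sets (PiM {1..N} (\<lambda>_. borel :: real measure))"
    interpret step: space_like_step M B N k \<alpha> t
      by unfold_locales (use assms k mono in auto)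
    show "AE \<omega> in M.
      real_cond_exp M (vimage_algebra (space M) (\<lambda>\<omega>. \<lambda>i\<in>{1..k}. eigenvalue_vector (N + \<alpha> i) N (\<lambda>p. B (Suc (fst p)) (Suc (snd p)) (t i) \<omega>))
          (PiM {1..k} (\<lambda>_. PiM {1..N} (\<lambda>_. borel))))
        (\<lambda>\<omega>. indicator A (eigenvalue_vector (N + \<alpha> (Suc k)) N (\<lambda>p. B (Suc (fst p)) (Suc (snd p)) (t (Suc k)) \<omega>))) \<omega> =
      real_cond_exp M (vimage_algebra (space M) (\<lambda>\<omega>. eigenvalue_vector (N + \<alpha> k) N (\<lambda>p. B (Suc (fst p)) (Suc (snd p)) (t k) \<omega>)) (PiM {1..N} (\<lambda>_. borel)))
        (\<lambda>\<omega>. indicator A (eigenvalue_vector (N + \<alpha> (Suc k)) N (\<lambda>p. B (Suc (fst p)) (Suc (snd p)) (t (Suc k)) \<omega>))) \<omega>"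
      using step.markov_step[OF A] unfolding step.X_def[abs_def] step.Y_def .
  qed (rule meas)
qed

end
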